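(* Let $(F,G):\mathcal{A}\to\mathcal{B}$ be an adjoint pair ($F$ left adjoint to $G$) between locally small and bicomplete abelian categories and let $(\varphi,\psi):Pr(\mathcal{A})\to Pr(\mathcal{B})$ be the Galois connection induced by it. Let $\tau\in Pr(\mathcal{A})$ and $\sigma\in Pr(\mathcal{B})$. (1) If $\tau$ is idempotent then $\varphi(\tau)$ is idempotent. (2) If $\sigma$ is a radical then $\psi(\sigma)$ is a radical.
   Context: Hom-classes are sets; an abelian category is called locally small if the class of subobjects of each object is a set, and bicomplete if it is complete and cocomplete. A preradical of an abelian category $\mathcal{A}$ is a subobject of the identity functor $1_{\mathcal{A}}$ in the (possibly extended) abelian category $\mathrm{Fun}(\mathcal{A},\mathcal{A})$, i.e. the equivalence class of a monomorphic natural transformation $\tau:T\hookrightarrow 1_{\mathcal{A}}$, two such being equivalent if each factors through the other. $Pr(\mathcal{A})$ is the collection of preradicals, ordered by $\tau\leq\sigma$ iff $\tau$ factors through $\sigma$. For $\sigma:S\hookrightarrow 1_{\mathcal{A}}$, $\sigma^*:1_{\mathcal{A}}\twoheadrightarrow S^*$ denotes its cokernel. For $\tau:T\hookrightarrow 1_{\mathcal{A}}$ and $\sigma:S\hookrightarrow 1_{\mathcal{A}}$, the product $\tau\cdot\sigma$ is the class of $\sigma\circ\tau S=\tau\circ T\sigma:TS\to 1_{\mathcal{A}}$ (where $(\tau S)_A=\tau_{S(A)}$, $(T\sigma)_A=T(\sigma_A)$). The coproduct $(\sigma:\tau)$ is the preradical represented by the pullback of $\tau S^*:TS^*\hookrightarrow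 S^*$ along $\sigma^*:1_{\mathcal{A}}\to S^*$. The preradical $\tau$ is idempotent if $\tau\cdot\tau=\tau$, and $\sigma$ is a radical if $(\sigma:\sigma)=\sigma$. With unit $\eta:1_{\mathcal{A}}\to GF$ and counit $\varepsilon:FG\to1_{\mathcal{B}}$, the induced Galois connection is given by $\varphi(\tau)=\mathrm{Im}(\varepsilon\circ F\tau G:FTG\to 1_{\mathcal{B}})$ for $\tau:T\hookrightarrow1_{\mathcal{A}}$, and $\psi(\sigma)=\mathrm{Ker}(\pi_\sigma\circ\eta)$ for $\sigma:S\hookrightarrow 1_{\mathcal{B}}$, where $\pi_\sigma:GF\to\mathrm{Ckr}(G\sigma F)$ is a cokernel of $G\sigma F:GSF\to GF$. *)

theory Defs
  imports "HOL-Algebra.Group" "HOL-Library.Equipollence" "HOL-Library.FuncSet"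
begin

section \<open>Categories\<close>

record ('o, 'm) cat =
  Obj :: "'o set"
  Arr :: "'m set"
  Dom :: "'m \<Rightarrow> 'o"
  Cod :: "'m \<Rightarrow> 'o"
  Idn :: "'o \<Rightarrow> 'm"
  Comp :: "'m \<Rightarrow> 'm \<Rightarrow> 'm" (infixl "\<bullet>\<index>" 70)

definition Hom :: "('o, 'm) cat \<Rightarrow> 'o \<Rightarrow> 'o \<Rightarrow> 'm set" where
  "Hom C a b = {f \<in> Arr C. Dom C f = a \<and> Cod C f = b}"

definition category :: "('o, 'm) cat \<Rightarrow> bool" where
  "category C \<longleftrightarrow>
     (\<forall>f\<in>Arr C. Dom C f \<in> Obj C \<and> Cod C f \<in> Obj C) \<and>
     (\<forall>a\<in>Obj C. Idn C a \<in> Hom C a a) \<and>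
     (\<forall>f\<in>Arr C. \<forall>g\<in>Arr C. Dom C g = Cod C f \<longrightarrow> g \<bullet>\<^bsub>C\<^esub> f \<in> Hom C (Dom C f) (Cod C g)) \<and>
     (\<forall>f\<in>Arr C. f \<bullet>\<^bsub>C\<^esub> Idn C (Dom C f) = f \<and> Idn C (Cod C f) \<bullet>\<^bsub>C\<^esub> f = f) \<and>
     (\<forall>f\<in>Arr C. \<forall>g\<in>Arr C. \<forall>h\<in>Arr C. Dom C g = Cod C f \<and> Dom C h = Cod C g \<longrightarrow>
        h \<bullet>\<^bsub>C\<^esub> (g \<bullet>\<^bsub>C\<^esub> f) = (h \<bullet>\<^bsub>C\<^esub> g) \<bullet>\<^bsub>C\<^esub> f)"

definition op_cat :: "('o, 'm) cat \<Rightarrow> ('o, 'm) cat" where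
  "op_cat C = \<lparr>Obj = Obj C, Arr = Arr C, Dom = Cod C, Cod = Dom C, Idn = Idn C,
               Comp = (\<lambda>g f. f \<bullet>\<^bsub>C\<^esub> g)\<rparr>"

definition mono_arr :: "('o, 'm) cat \<Rightarrow> 'm \<Rightarrow> bool" where
  "mono_arr C m \<longleftrightarrow> m \<in> Arr C \<and>
     (\<forall>f\<in>Arr C. \<forall>g\<in>Arr C. Dom C f = Dom C g \<and> Cod C f = Dom C m \<and> Cod C g = Dom C m \<and>
        m \<bullet>\<^bsub>C\<^esub> f = m \<bullet>\<^bsub>C\<^esub> g \<longrightarrow> f = g)"

definition epi_arr :: "('o, 'm) cat \<Rightarrow> 'm \<Rightarrow> bool" where
  "epi_arr C e \<longleftrightarrow> e \<in> Arr C \<and>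
     (\<forall>f\<in>Arr C. \<forall>g\<in>Arr C. Cod C f = Cod C g \<and> Dom C f = Cod C e \<and> Dom C g = Cod C e \<and>
        f \<bullet>\<^bsub>C\<^esub> e = g \<bullet>\<^bsub>C\<^esub> e \<longrightarrow> f = g)"

definition zero_obj :: "('o, 'm) cat \<Rightarrow> 'o \<Rightarrow> bool" where
  "zero_obj C z \<longleftrightarrow> z \<in> Obj C \<and>
     (\<forall>a\<in>Obj C. (\<exists>!f. f \<in> Hom C a z) \<and> (\<exists>!f. f \<in> Hom C z a))"

definition zero_arr :: "('o, 'm) cat \<Rightarrow> 'm \<Rightarrow> bool" where
  "zero_arr C f \<longleftrightarrow> f \<in> Arr C \<and>
     (\<exists>z g h. zero_obj C z \<and> g \<in> Hom C (Dom C f) z \<and> h \<in> Hom C z (Cod C f) \<and> f = h \<bullet>\<^bsub>C\<^esub> g)"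

definition is_kernel :: "('o, 'm) cat \<Rightarrow> 'm \<Rightarrow> 'm \<Rightarrow> bool" where
  "is_kernel C f k \<longleftrightarrow> f \<in> Arr C \<and> k \<in> Arr C \<and> Cod C k = Dom C f \<and> zero_arr C (f \<bullet>\<^bsub>C\<^esub> k) \<and>
     (\<forall>h\<in>Arr C. Cod C h = Dom C f \<and> zero_arr C (f \<bullet>\<^bsub>C\<^esub> h) \<longrightarrow>
        (\<exists>!u. u \<in> Hom C (Dom C h) (Dom C k) \<and> k \<bullet>\<^bsub>C\<^esub> u = h))"

definition is_cokernel :: "('o, 'm) cat \<Rightarrow> 'm \<Rightarrow> 'm \<Rightarrow> bool" where
  "is_cokernel C f q \<longleftrightarrow> f \<in> Arr C \<and> q \<in> Arr C \<and> Dom C q = Cod C f \<and> zero_arr C (q \<bullet>\<^bsub>C\<^esub> f) \<and>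
     (\<forall>h\<in>Arr C. Dom C h = Cod C f \<and> zero_arr C (h \<bullet>\<^bsub>C\<^esub> f) \<longrightarrow>
        (\<exists>!u. u \<in> Hom C (Cod C q) (Cod C h) \<and> u \<bullet>\<^bsub>C\<^esub> q = h))"

definition is_image :: "('o, 'm) cat \<Rightarrow> 'm \<Rightarrow> 'm \<Rightarrow> bool" where
  "is_image C f m \<longleftrightarrow> (\<exists>q. is_cokernel C f q \<and> is_kernel C q m)"

text \<open>In \<open>is_pullback C f g p q\<close>, the arrow \<open>p\<close> is the pullback of \<open>g\<close> along \<open>f\<close>.\<close>

definition is_pullback :: "('o, 'm) cat \<Rightarrow> 'm \<Rightarrow> 'm \<Rightarrow> 'm \<Rightarrow> 'm \<Rightarrow> bool" where
  "is_pullback C f g p q \<longleftrightarrow>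
     f \<in> Arr C \<and> g \<in> Arr C \<and> p \<in> Arr C \<and> q \<in> Arr C \<and>
     Cod C f = Cod C g \<and> Cod C p = Dom C f \<and> Cod C q = Dom C g \<and> Dom C p = Dom C q \<and>
     f \<bullet>\<^bsub>C\<^esub> p = g \<bullet>\<^bsub>C\<^esub> q \<and>
     (\<forall>h\<in>Arr C. \<forall>k\<in>Arr C. Dom C h = Dom C k \<and> Cod C h = Dom C f \<and> Cod C k = Dom C g \<and>
        f \<bullet>\<^bsub>C\<^esub> h = g \<bullet>\<^bsub>C\<^esub> k \<longrightarrow>
        (\<exists>!u. u \<in> Hom C (Dom C h) (Dom C p) \<and> p \<bullet>\<^bsub>C\<^esub> u = h \<and> q \<bullet>\<^bsub>C\<^esub> u = k))"

definition is_product :: "('o, 'm) cat \<Rightarrow> 'o \<Rightarrow> 'o \<Rightarrow> 'm \<Rightarrow> 'm \<Rightarrow> bool" where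
  "is_product C a b p q \<longleftrightarrow>
     p \<in> Arr C \<and> q \<in> Arr C \<and> Dom C p = Dom C q \<and> Cod C p = a \<and> Cod C q = b \<and>
     (\<forall>h\<in>Arr C. \<forall>k\<in>Arr C. Dom C h = Dom C k \<and> Cod C h = a \<and> Cod C k = b \<longrightarrow>
        (\<exists>!u. u \<in> Hom C (Dom C h) (Dom C p) \<and> p \<bullet>\<^bsub>C\<^esub> u = h \<and> q \<bullet>\<^bsub>C\<^esub> u = k))"

section \<open>Abelian categories\<close>

definition hom_group :: "('o, 'm) cat \<Rightarrow> ('m \<Rightarrow> 'm \<Rightarrow> 'm) \<Rightarrow> ('o \<Rightarrow> 'o \<Rightarrow> 'm) \<Rightarrow> 'o \<Rightarrow> 'o \<Rightarrow> 'm monoid"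
  where "hom_group C add zer a b = \<lparr>carrier = Hom C a b, mult = add, one = zer a b\<rparr>"

definition preadditive :: "('o, 'm) cat \<Rightarrow> ('m \<Rightarrow> 'm \<Rightarrow> 'm) \<Rightarrow> ('o \<Rightarrow> 'o \<Rightarrow> 'm) \<Rightarrow> bool" where
  "preadditive C add zer \<longleftrightarrow>
     (\<forall>a\<in>Obj C. \<forall>b\<in>Obj C. comm_group (hom_group C add zer a b)) \<and>
     (\<forall>a\<in>Obj C. \<forall>b\<in>Obj C. \<forall>c\<in>Obj C. \<forall>f\<in>Hom C a b. \<forall>g\<in>Hom C a b. \<forall>h\<in>Hom C b c.
        h \<bullet>\<^bsub>C\<^esub> add f g = add (h \<bullet>\<^bsub>C\<^esub> f) (h \<bullet>\<^bsub>C\<^esub> g)) \<and>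
     (\<forall>a\<in>Obj C. \<forall>b\<in>Obj C. \<forall>c\<in>Obj C. \<forall>h\<in>Hom C a b. \<forall>f\<in>Hom C b c. \<forall>g\<in>Hom C b c.
        add f g \<bullet>\<^bsub>C\<^esub> h = add (f \<bullet>\<^bsub>C\<^esub> h) (g \<bullet>\<^bsub>C\<^esub> h))"

definition abelian_cat :: "('o, 'm) cat \<Rightarrow> bool" where
  "abelian_cat C \<longleftrightarrow> category C \<and>
     (\<exists>add zer. preadditive C add zer) \<and>
     (\<exists>z. zero_obj C z) \<and>
     (\<forall>a\<in>Obj C. \<forall>b\<in>Obj C. \<exists>p q. is_product C a b p q) \<and>
     (\<forall>f\<in>Arr C. \<exists>k. is_kernel C f k) \<and>
     (\<forall>f\<in>Arr C. \<exists>q. is_cokernel C f q) \<and>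
     (\<forall>m. mono_arr C m \<longrightarrow> (\<exists>f. is_kernel C f m)) \<and>
     (\<forall>e. epi_arr C e \<longrightarrow> (\<exists>f. is_cokernel C f e))"

section \<open>Functors and natural transformations\<close>

text \<open>Functors and natural transformations are extensional (\<open>undefined\<close> outside the category), so
  that equality of records is equality of functors and of natural transformations.\<close>

record ('a, 'm, 'b, 'n) func =
  omap :: "'a \<Rightarrow> 'b"
  amap :: "'m \<Rightarrow> 'n"

definition is_functor :: "('a, 'm) cat \<Rightarrow> ('b, 'n) cat \<Rightarrow> ('a, 'm, 'b, 'n) func \<Rightarrow> bool" where
  "is_functor A B F \<longleftrightarrow>
     omap F \<in> Obj A \<rightarrow>\<^sub>E Obj B \<and> amap F \<in> extensional (Arr A) \<and>
     (\<forall>f\<in>Arr A. amap F f \<in> Hom B (omap F (Dom A f)) (omap F (Cod A f))) \<and>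
     (\<forall>a\<in>Obj A. amap F (Idn A a) = Idn B (omap F a)) \<and>
     (\<forall>f\<in>Arr A. \<forall>g\<in>Arr A. Dom A g = Cod A f \<longrightarrow>
        amap F (g \<bullet>\<^bsub>A\<^esub> f) = amap F g \<bullet>\<^bsub>B\<^esub> amap F f)"

definition fid :: "('a, 'm) cat \<Rightarrow> ('a, 'm, 'a, 'm) func" where
  "fid A = \<lparr>omap = (\<lambda>a\<in>Obj A. a), amap = (\<lambda>f\<in>Arr A. f)\<rparr>"

definition fcomp :: "('a, 'm) cat \<Rightarrow> ('b, 'n, 'c, 'k) func \<Rightarrow> ('a, 'm, 'b, 'n) func
    \<Rightarrow> ('a, 'm, 'c, 'k) func" where
  "fcomp A G F = \<lparr>omap = (\<lambda>a\<in>Obj A. omap G (omap F a)), amap = (\<lambda>f\<in>Arr A. amap G (amap F f))\<rparr>"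

record ('a, 'm, 'b, 'n) nt =
  source :: "('a, 'm, 'b, 'n) func"
  target :: "('a, 'm, 'b, 'n) func"
  component :: "'a \<Rightarrow> 'n"

definition nat_trans :: "('a, 'm) cat \<Rightarrow> ('b, 'n) cat \<Rightarrow> ('a, 'm, 'b, 'n) nt \<Rightarrow> bool" where
  "nat_trans A B t \<longleftrightarrow>
     is_functor A B (source t) \<and> is_functor A B (target t) \<and>
     component t \<in> extensional (Obj A) \<and>
     (\<forall>a\<in>Obj A. component t a \<in> Hom B (omap (source t) a) (omap (target t) a)) \<and>
     (\<forall>f\<in>Arr A. component t (Cod A f) \<bullet>\<^bsub>B\<^esub> amap (source t) f =
                amap (target t) f \<bullet>\<^bsub>B\<^esub> component t (Dom A f))"

definition Fun :: "('a, 'm) cat \<Rightarrow> ('b, 'n) cat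
    \<Rightarrow> (('a, 'm, 'b, 'n) func, ('a, 'm, 'b, 'n) nt) cat" where
  "Fun A B = \<lparr>Obj = {F. is_functor A B F}, Arr = {t. nat_trans A B t},
     Dom = source, Cod = target,
     Idn = (\<lambda>F. \<lparr>source = F, target = F, component = (\<lambda>a\<in>Obj A. Idn B (omap F a))\<rparr>),
     Comp = (\<lambda>t s. \<lparr>source = source s, target = target t,
                    component = (\<lambda>a\<in>Obj A. component t a \<bullet>\<^bsub>B\<^esub> component s a)\<rparr>)\<rparr>"

text \<open>\<open>whisk_left A F t\<close> is \<open>Ft\<close> and \<open>whisk_right A t F\<close> is \<open>tF\<close>, where \<open>A\<close> is the domain category
  of the functors between which the result is a natural transformation.\<close>

definition whisk_left :: "('a, 'm) cat \<Rightarrow> ('b, 'n, 'c, 'k) func \<Rightarrow> ('a, 'm, 'b, 'n) nt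
    \<Rightarrow> ('a, 'm, 'c, 'k) nt" where
  "whisk_left A F t = \<lparr>source = fcomp A F (source t), target = fcomp A F (target t),
     component = (\<lambda>a\<in>Obj A. amap F (component t a))\<rparr>"

definition whisk_right :: "('a, 'm) cat \<Rightarrow> ('b, 'n, 'c, 'k) nt \<Rightarrow> ('a, 'm, 'b, 'n) func
    \<Rightarrow> ('a, 'm, 'c, 'k) nt" where
  "whisk_right A t F = \<lparr>source = fcomp A (source t) F, target = fcomp A (target t) F,
     component = (\<lambda>a\<in>Obj A. component t (omap F a))\<rparr>"

definition adjoint_pair :: "('a, 'm) cat \<Rightarrow> ('b, 'n) cat \<Rightarrow> ('a, 'm, 'b, 'n) func
    \<Rightarrow> ('b, 'n, 'a, 'm) func \<Rightarrow> ('a, 'm, 'a, 'm) nt \<Rightarrow> ('b, 'n, 'b, 'n) nt \<Rightarrow> bool" where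
  "adjoint_pair A B F G \<eta> \<epsilon> \<longleftrightarrow>
     is_functor A B F \<and> is_functor B A G \<and>
     \<eta> \<in> Hom (Fun A A) (fid A) (fcomp A G F) \<and>
     \<epsilon> \<in> Hom (Fun B B) (fcomp B F G) (fid B) \<and>
     whisk_right A \<epsilon> F \<bullet>\<^bsub>Fun A B\<^esub> whisk_left A F \<eta> = Idn (Fun A B) F \<and>
     whisk_left B G \<epsilon> \<bullet>\<^bsub>Fun B A\<^esub> whisk_right B \<eta> G = Idn (Fun B A) G"

section \<open>Subobjects\<close>

definition factors_through :: "('o, 'm) cat \<Rightarrow> 'm \<Rightarrow> 'm \<Rightarrow> bool" where
  "factors_through C m n \<longleftrightarrow> (\<exists>u. u \<in> Hom C (Dom C m) (Dom C n) \<and> m = n \<bullet>\<^bsub>C\<^esub> u)"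

definition subobj_class :: "('o, 'm) cat \<Rightarrow> 'm \<Rightarrow> 'm set" where
  "subobj_class C m = {n. mono_arr C n \<and> Cod C n = Cod C m \<and>
     factors_through C m n \<and> factors_through C n m}"

definition Sub :: "('o, 'm) cat \<Rightarrow> 'o \<Rightarrow> 'm set set" where
  "Sub C x = {subobj_class C m | m. mono_arr C m \<and> Cod C m = x}"

section \<open>Size conditions\<close>

text \<open>There being no classes in HOL, sets in the sense of the theory of categories (as opposed to
  classes) are modelled as those sets of any type having fewer elements than a type \<open>'u\<close>.  If the
  cardinality of \<open>'u\<close> is inaccessible, this is smallness with respect to a Grothendieck universe;
  the type is left arbitrary.  Up to isomorphism every small category has its
  objects and arrows in \<open>'u\<close>.\<close>

definition small :: "'u itself \<Rightarrow> 'x set \<Rightarrow> bool" where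
  "small U X \<longleftrightarrow> X \<prec> (UNIV :: 'u set)"

definition small_category :: "('u, 'u) cat \<Rightarrow> bool" where
  "small_category J \<longleftrightarrow> category J \<and> small TYPE('u) (Obj J) \<and> small TYPE('u) (Arr J)"

definition locally_small :: "'u itself \<Rightarrow> ('o, 'm) cat \<Rightarrow> bool" where
  "locally_small U C \<longleftrightarrow>
     (\<forall>a\<in>Obj C. \<forall>b\<in>Obj C. small U (Hom C a b)) \<and> (\<forall>x\<in>Obj C. small U (Sub C x))"

definition is_cone :: "('j, 'k) cat \<Rightarrow> ('o, 'm) cat \<Rightarrow> ('j, 'k, 'o, 'm) func \<Rightarrow> 'o \<Rightarrow> ('j \<Rightarrow> 'm) \<Rightarrow> bool"
  where
  "is_cone J C D x p \<longleftrightarrow> x \<in> Obj C \<and> (\<forall>j\<in>Obj J. p j \<in> Hom C x (omap D j)) \<and>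
     (\<forall>f\<in>Arr J. amap D f \<bullet>\<^bsub>C\<^esub> p (Dom J f) = p (Cod J f))"

definition is_limit :: "('j, 'k) cat \<Rightarrow> ('o, 'm) cat \<Rightarrow> ('j, 'k, 'o, 'm) func \<Rightarrow> 'o \<Rightarrow> ('j \<Rightarrow> 'm) \<Rightarrow> bool"
  where
  "is_limit J C D x p \<longleftrightarrow> is_cone J C D x p \<and>
     (\<forall>y q. is_cone J C D y q \<longrightarrow>
        (\<exists>!u. u \<in> Hom C y x \<and> (\<forall>j\<in>Obj J. p j \<bullet>\<^bsub>C\<^esub> u = q j)))"

definition complete_cat :: "'u itself \<Rightarrow> ('o, 'm) cat \<Rightarrow> bool" where
  "complete_cat U C \<longleftrightarrow>
     (\<forall>(J :: ('u, 'u) cat) D. small_category J \<and> is_functor J C D \<longrightarrow> (\<exists>x p. is_limit J C D x p))"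

definition cocomplete_cat :: "'u itself \<Rightarrow> ('o, 'm) cat \<Rightarrow> bool" where
  "cocomplete_cat U C \<longleftrightarrow> complete_cat U (op_cat C)"

definition bicomplete :: "'u itself \<Rightarrow> ('o, 'm) cat \<Rightarrow> bool" where
  "bicomplete U C \<longleftrightarrow> complete_cat U C \<and> cocomplete_cat U C"

section \<open>Preradicals\<close>

text \<open>Operations on preradicals are given by representatives; since a preradical is literally an
  equivalence class, the union over all representatives (and all choices of cokernels, kernels and
  pullbacks) of the resulting classes is the common value.\<close>

definition Pr :: "('a, 'm) cat \<Rightarrow> ('a, 'm, 'a, 'm) nt set set" where
  "Pr A = Sub (Fun A A) (fid A)"

definition prerad_prod :: "('a, 'm) cat \<Rightarrow> ('a, 'm, 'a, 'm) nt set \<Rightarrow> ('a, 'm, 'a, 'm) nt set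
    \<Rightarrow> ('a, 'm, 'a, 'm) nt set" where
  "prerad_prod A \<tau> \<sigma> =
     \<Union>{subobj_class (Fun A A) (s \<bullet>\<^bsub>Fun A A\<^esub> whisk_right A t (source s)) | t s. t \<in> \<tau> \<and> s \<in> \<sigma>}"

definition prerad_coprod :: "('a, 'm) cat \<Rightarrow> ('a, 'm, 'a, 'm) nt set \<Rightarrow> ('a, 'm, 'a, 'm) nt set
    \<Rightarrow> ('a, 'm, 'a, 'm) nt set" where
  "prerad_coprod A \<sigma> \<tau> =
     \<Union>{subobj_class (Fun A A) p | p q t s c. t \<in> \<tau> \<and> s \<in> \<sigma> \<and> is_cokernel (Fun A A) s c \<and>
         is_pullback (Fun A A) c (whisk_right A t (target c)) p q}"

definition idempotent_prerad :: "('a, 'm) cat \<Rightarrow> ('a, 'm, 'a, 'm) nt set \<Rightarrow> bool" where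
  "idempotent_prerad A \<tau> \<longleftrightarrow> \<tau> \<in> Pr A \<and> prerad_prod A \<tau> \<tau> = \<tau>"

definition radical :: "('a, 'm) cat \<Rightarrow> ('a, 'm, 'a, 'm) nt set \<Rightarrow> bool" where
  "radical A \<sigma> \<longleftrightarrow> \<sigma> \<in> Pr A \<and> prerad_coprod A \<sigma> \<sigma> = \<sigma>"

definition adj_phi :: "('b, 'n) cat \<Rightarrow> ('a, 'm, 'b, 'n) func \<Rightarrow> ('b, 'n, 'a, 'm) func
    \<Rightarrow> ('b, 'n, 'b, 'n) nt \<Rightarrow> ('a, 'm, 'a, 'm) nt set \<Rightarrow> ('b, 'n, 'b, 'n) nt set" where
  "adj_phi B F G \<epsilon> \<tau> =
     \<Union>{subobj_class (Fun B B) m | m t. t \<in> \<tau> \<and>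
         is_image (Fun B B) (\<epsilon> \<bullet>\<^bsub>Fun B B\<^esub> whisk_left B F (whisk_right B t G)) m}"

definition adj_psi :: "('a, 'm) cat \<Rightarrow> ('a, 'm, 'b, 'n) func \<Rightarrow> ('b, 'n, 'a, 'm) func
    \<Rightarrow> ('a, 'm, 'a, 'm) nt \<Rightarrow> ('b, 'n, 'b, 'n) nt set \<Rightarrow> ('a, 'm, 'a, 'm) nt set" where
  "adj_psi A F G \<eta> \<sigma> =
     \<Union>{subobj_class (Fun A A) k | k s c. s \<in> \<sigma> \<and>
         is_cokernel (Fun A A) (whisk_left A G (whisk_right A s F)) c \<and>
         is_kernel (Fun A A) (c \<bullet>\<^bsub>Fun A A\<^esub> \<eta>) k}"

end

theory Submission
  imports Defs
begin

text \<open>Monomorphisms, kernels and cokernels in \<open>Fun A B\<close> are computed objectwise, so every comparison of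
  preradicals can be made at each object. There \<open>\<phi>(\<tau>)\<close> at \<open>b\<close> is the least subobject through which
  \<open>\<epsilon>\<^sub>b \<circ> F \<tau>\<close> (at \<open>G b\<close>) factors, and, by adjointness, an arrow \<open>h\<close> into \<open>a\<close> factors through \<open>\<psi>(\<sigma>)\<close> at \<open>a\<close> iff
  \<open>F h\<close> factors through \<open>\<sigma>\<close> at \<open>F a\<close>. Idempotence of \<open>\<tau>\<close> means that \<open>\<tau>\<close> restricted to \<open>T\<close> is split epi, and
  \<open>\<sigma>\<close> being a radical means that \<open>\<sigma>\<close> vanishes on \<open>S\<^sup>*\<close>; both properties are carried across the adjunction
  by naturality.\<close>

section \<open>Categories with zero\<close>

text \<open>A preradical is a whole class of natural transformations, and product, coproduct,
  \<open>\<phi>\<close> and \<open>\<psi>\<close> are unions over all representatives and all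
  choices of cokernel, kernel or pullback. Computing such a value therefore takes two steps: some
  choice exists, and every choice lands in the same class. Conversely, an equation such as
  \<open>prerad_coprod A \<sigma> \<sigma> = \<sigma>\<close> only supplies data for some
  representatives, which cannot be prescribed. The left adjoint \<open>F\<close> need not preserve
  monomorphisms, so \<open>F t\<close> is never treated as a subobject; all questions about it are
  put as factorizations of single arrows. \<open>G\<close> does preserve monomorphisms, which makes
  the cokernel in the definition of \<open>\<psi>\<close> disappear from the final criterion.
  Pullbacks of functors are never built: for \<open>\<psi>(\<sigma>)\<close> its own representative
  is shown to be the required pullback, with a zero arrow as second leg. The category
  \<open>Fun A B\<close> is used merely as a category with zero object whose kernels and cokernels
  come from those of \<open>B\<close>.\<close>

lemma in_Hom [simp]: "f \<in> Hom C a b \<longleftrightarrow> f \<in> Arr C \<and> Dom C f = a \<and> Cod C f = b"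
  by (auto simp: Hom_def)

section \<open>Opposite categories and duality\<close>

text \<open>Dualizing only swaps record fields and is strictly involutive, so facts on epimorphisms
  and cokernels are obtained by instantiating those on monomorphisms and kernels at
  \<open>op_cat C\<close> and rewriting.\<close>

lemma op_cat_simps [simp]:
  "Obj (op_cat C) = Obj C" "Arr (op_cat C) = Arr C" "Dom (op_cat C) = Cod C" "Cod (op_cat C) = Dom C"
  "Idn (op_cat C) = Idn C" "g \<bullet>\<^bsub>op_cat C\<^esub> f = f \<bullet>\<^bsub>C\<^esub> g" "op_cat (op_cat C) = C"
  by (simp_all add: op_cat_def)

lemma category_op: "category C \<Longrightarrow> category (op_cat C)"
  by (simp add: category_def)

lemma mono_arr_op: "mono_arr (op_cat C) f = epi_arr C f"
  by (auto simp: mono_arr_def epi_arr_def)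

lemma zero_obj_op: "zero_obj (op_cat C) z = zero_obj C z"
  by (auto simp: zero_obj_def Hom_def conj_commute)

lemma zero_arr_op: "zero_arr (op_cat C) f = zero_arr C f"
  by (simp add: zero_arr_def zero_obj_op) metis

lemma is_kernel_op: "is_kernel (op_cat C) f k = is_cokernel C f k"
  by (simp add: is_kernel_def is_cokernel_def zero_arr_op conj_ac)

lemma is_functor_op: "is_functor (op_cat A) (op_cat B) F = is_functor A B F"
  by (auto simp: is_functor_def)

locale cat =
  fixes C :: "('o, 'm) cat" (structure)
  assumes category_axiom: "category C"
begin

text \<open>The identity laws carry a separate equation such as \<open>Dom C f = a\<close>, so that
  they also rewrite when the object of the identity is not literally \<open>Dom C f\<close> or
  \<open>Cod C f\<close>.\<close>

lemma dom_obj [simp]: "f \<in> Arr C \<Longrightarrow> Dom C f \<in> Obj C"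
  and cod_obj [simp]: "f \<in> Arr C \<Longrightarrow> Cod C f \<in> Obj C"
  and id_arr [simp]: "a \<in> Obj C \<Longrightarrow> Idn C a \<in> Arr C"
  and dom_id [simp]: "a \<in> Obj C \<Longrightarrow> Dom C (Idn C a) = a"
  and cod_id [simp]: "a \<in> Obj C \<Longrightarrow> Cod C (Idn C a) = a"
  and comp_id [simp]: "f \<in> Arr C \<Longrightarrow> Dom C f = a \<Longrightarrow> f \<bullet> Idn C a = f"
  and id_comp [simp]: "f \<in> Arr C \<Longrightarrow> Cod C f = a \<Longrightarrow> Idn C a \<bullet> f = f"
  using category_axiom by (auto simp: category_def)

lemma comp_arr [simp]: "f \<in> Arr C \<Longrightarrow> g \<in> Arr C \<Longrightarrow> Dom C g = Cod C f \<Longrightarrow> g \<bullet> f \<in> Arr C"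
  and dom_comp [simp]: "f \<in> Arr C \<Longrightarrow> g \<in> Arr C \<Longrightarrow> Dom C g = Cod C f \<Longrightarrow> Dom C (g \<bullet> f) = Dom C f"
  and cod_comp [simp]: "f \<in> Arr C \<Longrightarrow> g \<in> Arr C \<Longrightarrow> Dom C g = Cod C f \<Longrightarrow> Cod C (g \<bullet> f) = Cod C g"
  using category_axiom by (auto simp: category_def)

lemma comp_assoc:
  "f \<in> Arr C \<Longrightarrow> g \<in> Arr C \<Longrightarrow> h \<in> Arr C \<Longrightarrow> Dom C g = Cod C f \<Longrightarrow> Dom C h = Cod C g \<Longrightarrow>
    (h \<bullet> g) \<bullet> f = h \<bullet> (g \<bullet> f)"
  using category_axiom by (simp add: category_def)

lemma op_cat: "cat (op_cat C)"
  using category_axiom by unfold_locales (rule category_op)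

lemma mono_arrow [simp]: "mono_arr C m \<Longrightarrow> m \<in> Arr C"
  by (simp add: mono_arr_def)

lemma mono_cancel:
  "mono_arr C m \<Longrightarrow> m \<bullet> f = m \<bullet> g \<Longrightarrow> f \<in> Arr C \<Longrightarrow> g \<in> Arr C \<Longrightarrow> Dom C f = Dom C g \<Longrightarrow>
    Cod C f = Dom C m \<Longrightarrow> Cod C g = Dom C m \<Longrightarrow> f = g"
  unfolding mono_arr_def by blast

lemma mono_arrI:
  assumes "m \<in> Arr C" "\<And>f g. f \<in> Arr C \<Longrightarrow> g \<in> Arr C \<Longrightarrow> Dom C f = Dom C g \<Longrightarrow>
    Cod C f = Dom C m \<Longrightarrow> Cod C g = Dom C m \<Longrightarrow> m \<bullet> f = m \<bullet> g \<Longrightarrow> f = g"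
  shows "mono_arr C m"
  using assms unfolding mono_arr_def by blast

lemma epi_arrow [simp]: "epi_arr C e \<Longrightarrow> e \<in> Arr C"
  by (simp add: epi_arr_def)

lemma epi_cancel:
  "epi_arr C e \<Longrightarrow> f \<bullet> e = g \<bullet> e \<Longrightarrow> f \<in> Arr C \<Longrightarrow> g \<in> Arr C \<Longrightarrow> Cod C f = Cod C g \<Longrightarrow>
    Dom C f = Cod C e \<Longrightarrow> Dom C g = Cod C e \<Longrightarrow> f = g"
  unfolding epi_arr_def by blast

lemma mono_comp:
  assumes "mono_arr C m" "mono_arr C n" "Dom C m = Cod C n"
  shows "mono_arr C (m \<bullet> n)"
proof -
  have "f = g" if "f \<in> Arr C" "g \<in> Arr C" "Dom C f = Dom C g" "Cod C f = Dom C n" "Cod C g = Dom C n"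
    "(m \<bullet> n) \<bullet> f = (m \<bullet> n) \<bullet> g" for f g
  proof -
    have "m \<bullet> (n \<bullet> f) = m \<bullet> (n \<bullet> g)"
      using that assms by (simp add: comp_assoc)
    then have "n \<bullet> f = n \<bullet> g"
      by (rule mono_cancel[OF assms(1)]) (use that assms in auto)
    then show ?thesis
      by (rule mono_cancel[OF assms(2)]) (use that assms in auto)
  qed
  then show ?thesis
    using assms by (intro mono_arrI) auto
qed

lemma epi_comp:
  assumes "epi_arr C m" "epi_arr C n" "Dom C m = Cod C n"
  shows "epi_arr C (m \<bullet> n)"
  using cat.mono_comp[OF op_cat, of n m] assms by (simp add: mono_arr_op)

section \<open>Factorization as a preorder and subobject classes\<close>

lemma factors_throughI:
  "n \<bullet> u = m \<Longrightarrow> u \<in> Arr C \<Longrightarrow> n \<in> Arr C \<Longrightarrow> Cod C u = Dom C n \<Longrightarrow> factors_through C m n"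
  by (auto simp: factors_through_def)

lemma factors_throughE:
  assumes "factors_through C m n"
  obtains u where "u \<in> Arr C" "Dom C u = Dom C m" "Cod C u = Dom C n" "n \<bullet> u = m"
  using assms by (metis factors_through_def in_Hom)

lemma factors_refl: "m \<in> Arr C \<Longrightarrow> factors_through C m m"
  by (rule factors_throughI[of _ "Idn C (Dom C m)"]) auto

lemma factors_trans:
  assumes "factors_through C k m" "factors_through C m n" "n \<in> Arr C"
  shows "factors_through C k n"
proof -
  obtain u v where u: "u \<in> Arr C" "Cod C u = Dom C m" "m \<bullet> u = k"
    and v: "v \<in> Arr C" "Dom C v = Dom C m" "Cod C v = Dom C n" "n \<bullet> v = m"
    using assms by (elim factors_throughE)
  have "n \<bullet> (v \<bullet> u) = k"
    unfolding u(3)[symmetric] v(4)[symmetric] using u(1,2) v(1-3) assms(3) by (simp add: comp_assoc)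
  then show ?thesis
    by (rule factors_throughI) (use u(1,2) v(1-3) assms(3) in auto)
qed

lemma factors_precomp:
  assumes "factors_through C m n" "n \<in> Arr C" "x \<in> Arr C" "Cod C x = Dom C m"
  shows "factors_through C (m \<bullet> x) n"
proof -
  obtain u where u: "u \<in> Arr C" "Dom C u = Dom C m" "Cod C u = Dom C n" "n \<bullet> u = m"
    using assms(1) by (elim factors_throughE)
  have "n \<bullet> (u \<bullet> x) = m \<bullet> x"
    unfolding u(4)[symmetric] using u(1-3) assms by (simp add: comp_assoc)
  then show ?thesis
    by (rule factors_throughI) (use u(1-3) assms in auto)
qed

lemma factors_postcomp:
  assumes "factors_through C m n" "n \<in> Arr C" "x \<in> Arr C" "Dom C x = Cod C n"
  shows "factors_through C (x \<bullet> m) (x \<bullet> n)"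
proof -
  obtain u where u: "u \<in> Arr C" "Dom C u = Dom C m" "Cod C u = Dom C n" "n \<bullet> u = m"
    using assms(1) by (elim factors_throughE)
  have "(x \<bullet> n) \<bullet> u = x \<bullet> m"
    unfolding u(4)[symmetric] using u(1-3) assms by (simp add: comp_assoc)
  then show ?thesis
    by (rule factors_throughI) (use u(1-3) assms in auto)
qed

text \<open>Mutual factorization is an equivalence, so any member may replace the representative;
  this is how independence of choices is concluded throughout.\<close>

lemma subobj_class_eq:
  assumes "n \<in> subobj_class C m" "m \<in> Arr C"
  shows "subobj_class C n = subobj_class C m"
proof -
  have n: "Cod C n = Cod C m" "factors_through C m n" "factors_through C n m" "n \<in> Arr C"
    using assms(1) mono_arrow by (simp_all add: subobj_class_def)
  have "factors_through C n l \<longleftrightarrow> factors_through C m l"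
    "factors_through C l n \<longleftrightarrow> factors_through C l m" if "mono_arr C l" for l
    using that n assms(2) factors_trans mono_arrow by blast+
  then show ?thesis
    unfolding subobj_class_def n(1) by blast
qed

lemma subobj_class_self: "mono_arr C m \<Longrightarrow> m \<in> subobj_class C m"
  by (simp add: subobj_class_def factors_refl)

lemma is_kernelE:
  assumes "is_kernel C f k" "h \<in> Arr C" "Cod C h = Dom C f" "zero_arr C (f \<bullet> h)"
  shows "factors_through C h k"
proof -
  have "\<exists>u. u \<in> Hom C (Dom C h) (Dom C k) \<and> k \<bullet> u = h"
    using assms unfolding is_kernel_def by blast
  then show ?thesis
    unfolding factors_through_def by metis
qed

text \<open>If \<open>k \<bullet> x = k \<bullet> y\<close>, then \<open>x\<close> and
  \<open>y\<close> are both factorizations of the same annihilated arrow, and uniqueness identifies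
  them. That zero arrows absorb precomposition is an assumption here, discharged once
  \<open>zero_comp_right\<close> is available.\<close>

lemma kernel_mono:
  assumes "is_kernel C f k" "\<And>g h. zero_arr C g \<Longrightarrow> h \<in> Arr C \<Longrightarrow> Cod C h = Dom C g \<Longrightarrow> zero_arr C (g \<bullet> h)"
  shows "mono_arr C k"
proof -
  have k: "f \<in> Arr C" "k \<in> Arr C" "Cod C k = Dom C f" "zero_arr C (f \<bullet> k)"
    using assms(1) unfolding is_kernel_def by blast+
  have "x = y" if "x \<in> Arr C" "y \<in> Arr C" "Dom C x = Dom C y" "Cod C x = Dom C k" "Cod C y = Dom C k"
    "k \<bullet> x = k \<bullet> y" for x y
  proof -
    have "zero_arr C (f \<bullet> (k \<bullet> x))"
      using assms(2)[OF k(4), of x] that k by (simp add: comp_assoc)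
    moreover have "k \<bullet> x \<in> Arr C" "Cod C (k \<bullet> x) = Dom C f"
      using that(1,4) k by auto
    ultimately have "\<exists>!u. u \<in> Hom C (Dom C (k \<bullet> x)) (Dom C k) \<and> k \<bullet> u = k \<bullet> x"
      using assms(1) unfolding is_kernel_def by blast
    then show ?thesis using that k by auto
  qed
  then show ?thesis using k by (intro mono_arrI) auto
qed

end

section \<open>Zero arrows, kernels and cokernels\<close>

text \<open>The calculus of kernels is developed at this generality because it is applied both to an
  abelian category and to a functor category, for which only a zero object is exhibited.\<close>

locale zero_cat = cat +
  assumes has_zero: "\<exists>z. zero_obj C z"
begin

lemma op_zero_cat: "zero_cat (op_cat C)"
  by (intro zero_cat.intro zero_cat_axioms.intro op_cat) (simp add: zero_obj_op has_zero)

lemma zero_arr_arrow: "zero_arr C f \<Longrightarrow> f \<in> Arr C"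
  unfolding zero_arr_def by blast

text \<open>The two arrows may pass through different zero objects \<open>z\<close> and
  \<open>w\<close>. The arrow \<open>r\<close> from \<open>z\<close> to \<open>w\<close> satisfies
  \<open>r \<bullet> p = q\<close> and \<open>j \<bullet> r = i\<close> by uniqueness, whence
  \<open>i \<bullet> p = j \<bullet> q\<close>.\<close>

lemma zero_unique:
  assumes "zero_arr C f" "zero_arr C g" "Dom C f = Dom C g" "Cod C f = Cod C g"
  shows "f = g"
proof -
  obtain z p i where z: "zero_obj C z" "p \<in> Hom C (Dom C f) z" "i \<in> Hom C z (Cod C f)" "i \<bullet> p = f"
    using assms(1) unfolding zero_arr_def by metis
  obtain w q j where w: "zero_obj C w" "q \<in> Hom C (Dom C g) w" "j \<in> Hom C w (Cod C g)" "j \<bullet> q = g"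
    using assms(2) unfolding zero_arr_def by metis
  have o: "z \<in> Obj C" "w \<in> Obj C" "Dom C f \<in> Obj C" "Cod C f \<in> Obj C"
    using z(1) w(1) zero_arr_arrow[OF assms(1)] unfolding zero_obj_def by auto
  then obtain r where r: "r \<in> Hom C z w"
    using z(1) unfolding zero_obj_def by blast
  have "r \<bullet> p \<in> Hom C (Dom C f) w" "q \<in> Hom C (Dom C f) w"
    using r z w assms by auto
  moreover have "j \<bullet> r \<in> Hom C z (Cod C f)"
    using r z w assms by auto
  ultimately have "r \<bullet> p = q" "j \<bullet> r = i"
    using z w o unfolding zero_obj_def by blast+
  then show ?thesis using z w r by (metis comp_assoc in_Hom)
qed

lemma zero_comp_left:
  assumes "zero_arr C f" "g \<in> Arr C" "Dom C g = Cod C f"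
  shows "zero_arr C (g \<bullet> f)"
proof -
  obtain z p i where z: "zero_obj C z" "p \<in> Hom C (Dom C f) z" "i \<in> Hom C z (Cod C f)" "i \<bullet> p = f"
    using assms(1) unfolding zero_arr_def by metis
  then have "g \<bullet> f = (g \<bullet> i) \<bullet> p" "g \<bullet> i \<in> Hom C z (Cod C (g \<bullet> f))" "p \<in> Hom C (Dom C (g \<bullet> f)) z"
    using assms zero_arr_arrow[OF assms(1)] by (simp_all add: comp_assoc)
  moreover have "g \<bullet> f \<in> Arr C" using assms zero_arr_arrow by auto
  ultimately show ?thesis using z(1) unfolding zero_arr_def by blast
qed

lemma zero_comp_right:
  assumes "zero_arr C f" "g \<in> Arr C" "Cod C g = Dom C f"
  shows "zero_arr C (f \<bullet> g)"
  using zero_cat.zero_comp_left[OF op_zero_cat, of f g] assms by (simp add: zero_arr_op)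

text \<open>The zero object is prescribed instead of chosen: in \<open>Fun A B\<close> the zero
  arrow through a constant functor is wanted, since its components are visibly zero.\<close>

lemma zero_through:
  assumes "a \<in> Obj C" "b \<in> Obj C" "zero_obj C z"
  obtains p i where "p \<in> Hom C a z" "i \<in> Hom C z b" "zero_arr C (i \<bullet> p)"
proof -
  have "\<exists>p. p \<in> Hom C a z" "\<exists>i. i \<in> Hom C z b"
    using assms unfolding zero_obj_def by (meson ex1_implies_ex)+
  then obtain p i where pi: "p \<in> Hom C a z" "i \<in> Hom C z b"
    by blast
  then have "i \<bullet> p \<in> Arr C" "p \<in> Hom C (Dom C (i \<bullet> p)) z"
    "i \<in> Hom C z (Cod C (i \<bullet> p))"
    by auto
  then have "zero_arr C (i \<bullet> p)"
    using assms(3) unfolding zero_arr_def by blast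
  then show ?thesis by (rule that[OF pi])
qed

lemma zero_exists:
  assumes "a \<in> Obj C" "b \<in> Obj C"
  obtains f where "f \<in> Hom C a b" "zero_arr C f"
proof -
  obtain z where z: "zero_obj C z" using has_zero by blast
  from zero_through[OF assms z] obtain p i
    where "p \<in> Hom C a z" "i \<in> Hom C z b" "zero_arr C (i \<bullet> p)" .
  then show ?thesis using that[of "i \<bullet> p"] by auto
qed

lemma zero_cancel_mono:
  assumes "mono_arr C m" "zero_arr C (m \<bullet> f)" "f \<in> Arr C" "Cod C f = Dom C m"
  shows "zero_arr C f"
proof -
  obtain z where z: "z \<in> Hom C (Dom C f) (Cod C f)" "zero_arr C z"
    using zero_exists assms by (metis cod_obj dom_obj)
  have "zero_arr C (m \<bullet> z)"
    by (rule zero_comp_left) (use z assms in auto)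
  from zero_unique[OF assms(2) this] have "m \<bullet> f = m \<bullet> z"
    using z assms by auto
  then have "f = z"
    by (rule mono_cancel[OF assms(1)]) (use z assms in auto)
  then show ?thesis using z by simp
qed

lemma is_kernelD:
  assumes "is_kernel C f k"
  shows "f \<in> Arr C" "k \<in> Arr C" "Cod C k = Dom C f" "zero_arr C (f \<bullet> k)" "mono_arr C k"
  using assms kernel_mono[OF assms] zero_comp_right by (auto simp: is_kernel_def)

text \<open>Uniqueness of factorizations is traded for \<open>mono_arr C k\<close>, a condition that
  can be checked objectwise in a functor category.\<close>

lemma is_kernelI:
  assumes "f \<in> Arr C" "Cod C k = Dom C f" "zero_arr C (f \<bullet> k)" "mono_arr C k"
    "\<And>h. h \<in> Arr C \<Longrightarrow> Cod C h = Dom C f \<Longrightarrow> zero_arr C (f \<bullet> h) \<Longrightarrow> factors_through C h k"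
  shows "is_kernel C f k"
proof -
  have "\<exists>!u. u \<in> Hom C (Dom C h) (Dom C k) \<and> k \<bullet> u = h"
    if h: "h \<in> Arr C" "Cod C h = Dom C f" "zero_arr C (f \<bullet> h)" for h
  proof -
    obtain u where "u \<in> Arr C" "Dom C u = Dom C h" "Cod C u = Dom C k" "k \<bullet> u = h"
      using factors_throughE[OF assms(5)[OF h]] .
    then show ?thesis
      by (intro ex1I[of _ u]) (auto intro: mono_cancel[OF assms(4)])
  qed
  then show ?thesis
    using assms by (simp add: is_kernel_def)
qed

lemma is_cokernelD:
  assumes "is_cokernel C f q"
  shows "f \<in> Arr C" "q \<in> Arr C" "Dom C q = Cod C f" "zero_arr C (q \<bullet> f)" "epi_arr C q"
  using zero_cat.is_kernelD[OF op_zero_cat, of f q] assms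
  by (simp_all add: is_kernel_op zero_arr_op mono_arr_op)

lemma is_cokernelE:
  assumes "is_cokernel C f q" "h \<in> Arr C" "Dom C h = Cod C f" "zero_arr C (h \<bullet> f)"
  obtains u where "u \<in> Arr C" "Dom C u = Cod C q" "Cod C u = Cod C h" "u \<bullet> q = h"
proof -
  have "\<exists>u. u \<in> Hom C (Cod C q) (Cod C h) \<and> u \<bullet> q = h"
    using assms unfolding is_cokernel_def by blast
  then show ?thesis
    using that by auto
qed

lemma is_cokernelI:
  assumes "f \<in> Arr C" "Dom C q = Cod C f" "zero_arr C (q \<bullet> f)" "epi_arr C q"
    "\<And>h. h \<in> Arr C \<Longrightarrow> Dom C h = Cod C f \<Longrightarrow> zero_arr C (h \<bullet> f) \<Longrightarrow>
      factors_through (op_cat C) h q"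
  shows "is_cokernel C f q"
  unfolding is_kernel_op[symmetric]
  by (rule zero_cat.is_kernelI[OF op_zero_cat])
    (simp_all add: zero_arr_op mono_arr_op assms)

text \<open>Each kernel factors through the other, and cancelling \<open>k\<close> shows that the
  comparison arrows compose to an identity.\<close>

lemma kernel_iso:
  assumes "is_kernel C f k" "is_kernel C f k'"
  obtains u v where "u \<in> Hom C (Dom C k) (Dom C k')" "v \<in> Hom C (Dom C k') (Dom C k)"
    "k' \<bullet> u = k" "k \<bullet> v = k'" "v \<bullet> u = Idn C (Dom C k)"
proof -
  note k = is_kernelD[OF assms(1)] and k' = is_kernelD[OF assms(2)]
  obtain u where u: "u \<in> Arr C" "Dom C u = Dom C k" "Cod C u = Dom C k'" "k' \<bullet> u = k"
    using is_kernelE[OF assms(2) k(2,3,4)] by (rule factors_throughE)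
  obtain v where v: "v \<in> Arr C" "Dom C v = Dom C k'" "Cod C v = Dom C k" "k \<bullet> v = k'"
    using is_kernelE[OF assms(1) k'(2,3,4)] by (rule factors_throughE)
  have "k \<bullet> (v \<bullet> u) = (k \<bullet> v) \<bullet> u"
    using u(1-3) v(1-3) k(2) by (simp add: comp_assoc)
  also have "\<dots> = k \<bullet> Idn C (Dom C k)"
    using u v(4) k(2) by simp
  finally have "v \<bullet> u = Idn C (Dom C k)"
    by (rule mono_cancel[OF k(5)]) (use u(1-3) v(1-3) k(2) in auto)
  then show ?thesis using u v by (intro that) auto
qed

text \<open>Equations between arrows survive evaluation of natural transformations at an object,
  while a universal property does not obviously do so. The output of \<open>kernel_iso\<close> in a
  functor category is thus evaluated and fed in here.\<close>

lemma kernel_transport: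
  assumes "is_kernel C f k'" "u \<in> Hom C (Dom C k) (Dom C k')" "v \<in> Hom C (Dom C k') (Dom C k)"
    "k' \<bullet> u = k" "k \<bullet> v = k'" "v \<bullet> u = Idn C (Dom C k)"
  shows "is_kernel C f k"
proof (rule is_kernelI)
  note k' = is_kernelD[OF assms(1)]
  have u: "u \<in> Arr C" "Dom C u = Dom C k" "Cod C u = Dom C k'" "v \<in> Arr C" "Cod C v = Dom C k"
    "Dom C v = Dom C k'"
    using assms(2,3) by auto
  have "k' \<bullet> u \<in> Arr C" "Cod C (k' \<bullet> u) = Dom C f" using u k' by auto
  then have k: "k \<in> Arr C" "Cod C k = Dom C f" unfolding assms(4) .
  show "f \<in> Arr C" "Cod C k = Dom C f" by (fact k'(1)) (fact k(2))
  have "zero_arr C (f \<bullet> (k' \<bullet> u))"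
    using zero_comp_right[OF k'(4), of u] u(1,3) k' by (simp add: comp_assoc)
  then show "zero_arr C (f \<bullet> k)"
    unfolding assms(4) .
  have "x = y" if that: "x \<in> Arr C" "y \<in> Arr C" "Dom C x = Dom C y" "Cod C x = Dom C k"
    "Cod C y = Dom C k" "k \<bullet> x = k \<bullet> y" for x y
  proof -
    have "(k' \<bullet> u) \<bullet> x = k' \<bullet> (u \<bullet> x)" "(k' \<bullet> u) \<bullet> y = k' \<bullet> (u \<bullet> y)"
      by (rule comp_assoc; use that(1-5) u k' in simp)+
    then have "k' \<bullet> (u \<bullet> x) = k' \<bullet> (u \<bullet> y)"
      using that(6) unfolding assms(4) by simp
    then have "u \<bullet> x = u \<bullet> y"
      by (rule mono_cancel[OF k'(5)]) (use that u in auto)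
    then have "(v \<bullet> u) \<bullet> x = (v \<bullet> u) \<bullet> y"
      using u that(1-5) by (simp add: comp_assoc)
    then show ?thesis using assms(6) that(1-5) by simp
  qed
  then show "mono_arr C k" using k by (intro mono_arrI) auto
  show "factors_through C h k" if "h \<in> Arr C" "Cod C h = Dom C f" "zero_arr C (f \<bullet> h)" for h
  proof (rule factors_trans[OF is_kernelE[OF assms(1) that] _ k(1)])
    show "factors_through C k' k"
      by (rule factors_throughI[OF assms(5) u(4) k(1) u(5)])
  qed
qed

section \<open>Pullbacks of monomorphisms\<close>

text \<open>The legs \<open>p\<close> and \<open>q\<close> are jointly monic, and since
  \<open>g\<close> can be cancelled, equality after \<open>p\<close> already forces equality after
  \<open>q\<close>.\<close>

lemma pullback_mono:
  assumes "is_pullback C f g p q" "mono_arr C g"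
  shows "mono_arr C p"
proof -
  have pb: "f \<in> Arr C" "p \<in> Arr C" "q \<in> Arr C" "Cod C p = Dom C f" "Cod C q = Dom C g" "Dom C p = Dom C q"
    "Cod C f = Cod C g" "f \<bullet> p = g \<bullet> q"
    using assms(1) unfolding is_pullback_def by blast+
  have "x = y" if that: "x \<in> Arr C" "y \<in> Arr C" "Dom C x = Dom C y" "Cod C x = Dom C p" "Cod C y = Dom C p"
    "p \<bullet> x = p \<bullet> y" for x y
  proof -
    have fpx: "f \<bullet> (p \<bullet> w) = g \<bullet> (q \<bullet> w)" if "w \<in> Arr C" "Cod C w = Dom C p" for w
    proof -
      have "f \<bullet> (p \<bullet> w) = (f \<bullet> p) \<bullet> w"
        by (rule comp_assoc[symmetric]) (use that pb in auto)
      also have "\<dots> = g \<bullet> (q \<bullet> w)"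
        unfolding pb(8) by (rule comp_assoc) (use that pb assms(2) in auto)
      finally show ?thesis .
    qed
    have "g \<bullet> (q \<bullet> x) = g \<bullet> (q \<bullet> y)"
      using fpx[OF that(1,4)] fpx[OF that(2,5)] that(6) by metis
    then have q: "q \<bullet> x = q \<bullet> y"
      by (rule mono_cancel[OF assms(2)]) (use that(1-5) pb(1-7) in auto)
    have "p \<bullet> x \<in> Arr C" "q \<bullet> x \<in> Arr C" "Dom C (p \<bullet> x) = Dom C (q \<bullet> x)" "Cod C (p \<bullet> x) = Dom C f"
      "Cod C (q \<bullet> x) = Dom C g" "Dom C (p \<bullet> x) = Dom C x"
      using that(1-5) pb(1-7) by auto
    then have "\<exists>!u. u \<in> Hom C (Dom C x) (Dom C p) \<and> p \<bullet> u = p \<bullet> x \<and> q \<bullet> u = q \<bullet> x"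
      using assms(1) fpx[OF that(1,4)] unfolding is_pullback_def by metis
    moreover have "x \<in> Hom C (Dom C x) (Dom C p)" "y \<in> Hom C (Dom C x) (Dom C p)"
      using that(1-5) by auto
    ultimately show ?thesis using that(6) q by metis
  qed
  then show ?thesis using pb by (intro mono_arrI) auto
qed

text \<open>Pairing \<open>h\<close> with a zero arrow into the domain of \<open>g\<close> gives a
  commuting square. Applied to a cokernel \<open>f\<close> of \<open>s\<close>, it yields the
  inequality between \<open>\<sigma>\<close> and \<open>(\<sigma>:\<tau>)\<close> that holds for all
  preradicals.\<close>

lemma zero_factors_pullback:
  assumes "is_pullback C f g p q" "h \<in> Arr C" "Cod C h = Dom C f" "zero_arr C (f \<bullet> h)"
  shows "factors_through C h p"
proof -
  have pb: "f \<in> Arr C" "g \<in> Arr C" "p \<in> Arr C" "Cod C f = Cod C g"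
    using assms(1) unfolding is_pullback_def by blast+
  obtain z where z: "z \<in> Hom C (Dom C h) (Dom C g)" "zero_arr C z"
    using zero_exists assms(2) pb(2) by (metis dom_obj)
  have "zero_arr C (g \<bullet> z)"
    by (rule zero_comp_left[OF z(2)]) (use z pb in auto)
  from zero_unique[OF assms(4) this] have "f \<bullet> h = g \<bullet> z"
    using z assms(2,3) pb by auto
  then have "\<exists>u. u \<in> Hom C (Dom C h) (Dom C p) \<and> p \<bullet> u = h"
    using assms(1-3) z(1) unfolding is_pullback_def by (metis in_Hom)
  then show ?thesis
    using pb(3) by (auto intro: factors_throughI)
qed

text \<open>Describes the pullback along \<open>f\<close> when it is no larger than the part
  annihilated by \<open>f\<close>. The second leg needs no separate construction: with
  \<open>u\<close> the factorization of \<open>h\<close>, both \<open>q \<bullet> u\<close> and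
  \<open>k\<close> become \<open>f \<bullet> h\<close> after the monomorphism
  \<open>g\<close>.\<close>

lemma is_pullbackI_zero:
  assumes "f \<in> Arr C" "mono_arr C g" "mono_arr C p" "Cod C f = Cod C g" "Cod C p = Dom C f"
    "zero_arr C (f \<bullet> p)" "q \<in> Hom C (Dom C p) (Dom C g)" "zero_arr C q"
    and fac: "\<And>h k. h \<in> Arr C \<Longrightarrow> k \<in> Arr C \<Longrightarrow> Dom C h = Dom C k \<Longrightarrow> Cod C h = Dom C f \<Longrightarrow>
      Cod C k = Dom C g \<Longrightarrow> f \<bullet> h = g \<bullet> k \<Longrightarrow> factors_through C h p"
  shows "is_pullback C f g p q"
proof -
  have pq: "g \<in> Arr C" "p \<in> Arr C" "q \<in> Arr C" "Dom C q = Dom C p" "Cod C q = Dom C g"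
    using assms by auto
  have "zero_arr C (g \<bullet> q)"
    by (rule zero_comp_left[OF assms(8)]) (use pq in auto)
  from zero_unique[OF assms(6) this] have e: "f \<bullet> p = g \<bullet> q"
    using pq assms(1,4,5) by auto
  have "\<exists>!u. u \<in> Hom C (Dom C h) (Dom C p) \<and> p \<bullet> u = h \<and> q \<bullet> u = k"
    if h: "h \<in> Arr C" "k \<in> Arr C" "Dom C h = Dom C k" "Cod C h = Dom C f" "Cod C k = Dom C g" "f \<bullet> h = g \<bullet> k" for h k
  proof -
    obtain u where u: "u \<in> Arr C" "Dom C u = Dom C h" "Cod C u = Dom C p" "p \<bullet> u = h"
      using fac[OF h] by (rule factors_throughE)
    have "f \<bullet> (p \<bullet> u) = (f \<bullet> p) \<bullet> u"
      by (rule comp_assoc[symmetric]) (use u(1-3) pq assms(1,5) in auto)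
    also have "\<dots> = g \<bullet> (q \<bullet> u)"
      unfolding e by (rule comp_assoc) (use u(1-3) pq in auto)
    finally have "g \<bullet> (q \<bullet> u) = g \<bullet> k"
      using h(6) u(4) by simp
    then have "q \<bullet> u = k"
      by (rule mono_cancel[OF assms(2)]) (use u(1-3) h(1-5) pq in auto)
    then have "u \<in> Hom C (Dom C h) (Dom C p) \<and> p \<bullet> u = h \<and> q \<bullet> u = k"
      using u by simp
    moreover have "w = u" if w: "w \<in> Hom C (Dom C h) (Dom C p)" "p \<bullet> w = h" for w
    proof -
      have "p \<bullet> w = p \<bullet> u" using w u by simp
      then show ?thesis
        by (rule mono_cancel[OF assms(3)]) (use u(1-3) w(1) in auto)
    qed
    ultimately show ?thesis
      by blast
  qed
  then show ?thesis
    using pq assms(1,4,5) e unfolding is_pullback_def by metis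
qed

end

section \<open>Abelian categories\<close>

locale abelian = cat +
  assumes abelian_axiom: "abelian_cat C"

lemma abelianI: "abelian_cat C \<Longrightarrow> abelian C"
  by (simp add: abelian_def abelian_axioms_def cat_def abelian_cat_def)

sublocale abelian \<subseteq> zero_cat
  using abelian_axiom by unfold_locales (simp add: abelian_cat_def)

context abelian
begin

lemma kernel_exists: "f \<in> Arr C \<Longrightarrow> \<exists>k. is_kernel C f k"
  and cokernel_exists: "f \<in> Arr C \<Longrightarrow> \<exists>q. is_cokernel C f q"
  and mono_normal: "mono_arr C m \<Longrightarrow> \<exists>f. is_kernel C f m"
  and epi_normal: "epi_arr C e \<Longrightarrow> \<exists>f. is_cokernel C f e"
  using abelian_axiom by (simp_all add: abelian_cat_def)

section \<open>Monomorphisms, epimorphisms and images in an abelian category\<close>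

text \<open>The usual subtraction argument: \<open>m \<bullet> f = m \<bullet> g\<close> makes
  \<open>m\<close> annihilate the difference \<open>add f n\<close>, where \<open>n\<close> is the
  additive inverse of \<open>g\<close>, so the difference is zero and \<open>f = g\<close>. This is
  where the additive structure enters.\<close>

lemma mono_if_trivial_kernel:
  assumes m: "m \<in> Arr C"
    and tr: "\<And>h. h \<in> Arr C \<Longrightarrow> Cod C h = Dom C m \<Longrightarrow> zero_arr C (m \<bullet> h) \<Longrightarrow> zero_arr C h"
  shows "mono_arr C m"
proof -
  obtain add zer where pre: "preadditive C add zer"
    using abelian_axiom by (auto simp: abelian_cat_def)
  have grp: "comm_group (hom_group C add zer a b)" if "a \<in> Obj C" "b \<in> Obj C" for a b
    using pre that by (simp add: preadditive_def)
  have distr: "h \<bullet> add f g = add (h \<bullet> f) (h \<bullet> g)"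
    if "f \<in> Arr C" "g \<in> Arr C" "h \<in> Arr C" "Dom C f = Dom C g" "Cod C f = Cod C g" "Dom C h = Cod C g"
    for f g h
  proof -
    have "\<forall>a\<in>Obj C. \<forall>b\<in>Obj C. \<forall>c\<in>Obj C. \<forall>f\<in>Hom C a b. \<forall>g\<in>Hom C a b. \<forall>h\<in>Hom C b c.
        h \<bullet> add f g = add (h \<bullet> f) (h \<bullet> g)"
      using pre unfolding preadditive_def by (elim conjE)
    moreover have "f \<in> Hom C (Dom C g) (Cod C g)" "g \<in> Hom C (Dom C g) (Cod C g)"
      "h \<in> Hom C (Cod C g) (Cod C h)" using that by auto
    ultimately show ?thesis
      using that(1-3) dom_obj cod_obj by blast
  qed
  \<comment> \<open>Preadditivity does not mention zero objects, so the categorical zero has to be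
    matched with the neutral element. An arrow \<open>p\<close> into a zero object is the only one,
    hence \<open>add p p = p\<close>; composing with \<open>i\<close> gives
    \<open>add z z = z\<close>, and in a group only the neutral element is idempotent.\<close>
  have zer: "z = zer (Dom C z) (Cod C z)" if z: "zero_arr C z" for z
  proof -
    obtain w p i where w: "zero_obj C w" "p \<in> Hom C (Dom C z) w" "i \<in> Hom C w (Cod C z)" "i \<bullet> p = z"
      using z unfolding zero_arr_def by metis
    have ob: "Dom C z \<in> Obj C" "Cod C z \<in> Obj C" "w \<in> Obj C" "z \<in> Arr C"
      using w(1) zero_arr_arrow[OF z] unfolding zero_obj_def by auto
    interpret P: comm_group "hom_group C add zer (Dom C z) w" using grp ob by blast
    interpret H: comm_group "hom_group C add zer (Dom C z) (Cod C z)" using grp ob by blast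
    have "add p p \<in> Hom C (Dom C z) w"
      using P.m_closed[of p p] w by (simp add: hom_group_def)
    then have "add p p = p"
      using w ob unfolding zero_obj_def by blast
    then have "add z z = z"
      using distr[of p p i] w by auto
    then show ?thesis
      using H.l_cancel_one[of z z] ob by (simp add: hom_group_def)
  qed
  have "f = g" if f: "f \<in> Arr C" and g: "g \<in> Arr C" and d: "Dom C f = Dom C g" "Cod C f = Dom C m"
    "Cod C g = Dom C m" and e: "m \<bullet> f = m \<bullet> g" for f g
  proof -
    let ?H = "hom_group C add zer (Dom C g) (Dom C m)"
    interpret H: comm_group ?H using grp g m by simp
    have fg: "f \<in> carrier ?H" "g \<in> carrier ?H" using f g d by (auto simp: hom_group_def)
    define n where "n = inv\<^bsub>?H\<^esub> g"
    have n: "n \<in> Hom C (Dom C g) (Dom C m)"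
      using H.inv_closed[OF fg(2)] by (simp add: n_def hom_group_def)
    have "add g n = zer (Dom C g) (Dom C m)"
      using H.r_inv[OF fg(2)] by (simp add: n_def hom_group_def)
    moreover obtain z where z: "z \<in> Hom C (Dom C g) (Dom C m)" "zero_arr C z"
      using zero_exists g m by (metis dom_obj)
    ultimately have gn: "add g n = z"
      using zer[OF z(2)] by simp
    have fn: "add f n \<in> Hom C (Dom C g) (Dom C m)"
      using H.m_closed[of f n] n fg by (simp add: hom_group_def)
    have "m \<bullet> add f n = m \<bullet> z"
      using distr[of f n m] distr[of g n m] n f g d m e gn by simp
    moreover have "zero_arr C (m \<bullet> z)"
      using zero_comp_left[OF z(2) m] z(1) by simp
    ultimately have "zero_arr C (add f n)"
      using fn by (intro tr[of "add f n"]) (simp_all only: in_Hom)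
    from zero_unique[OF this z(2)] have "add f n = add g n"
      using gn z(1) fn by simp
    then show ?thesis
      using H.right_cancel[of n f g] fg n by (simp add: hom_group_def)
  qed
  then show ?thesis using m by (intro mono_arrI) auto
qed

text \<open>A monomorphism is a kernel of its cokernel: \<open>m\<close> is a kernel of some
  \<open>f\<close>, this \<open>f\<close> factors through \<open>c\<close>, and so whatever
  \<open>c\<close> annihilates is annihilated by \<open>f\<close>.\<close>

lemma factors_mono_if_cokernel_zero:
  assumes "mono_arr C m" "is_cokernel C m c" "h \<in> Arr C" "Cod C h = Cod C m" "zero_arr C (c \<bullet> h)"
  shows "factors_through C h m"
proof -
  note c = is_cokernelD[OF assms(2)]
  obtain f where f: "is_kernel C f m" using mono_normal assms by blast
  note fD = is_kernelD[OF f]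
  obtain u where u: "u \<in> Arr C" "Dom C u = Cod C c" "u \<bullet> c = f"
    using is_cokernelE[OF assms(2) fD(1) fD(3)[symmetric] fD(4)] by metis
  have "zero_arr C (u \<bullet> (c \<bullet> h))"
    by (rule zero_comp_left) (use u c assms in auto)
  moreover have "(u \<bullet> c) \<bullet> h = u \<bullet> (c \<bullet> h)"
    using u c assms by (intro comp_assoc) auto
  ultimately have "zero_arr C (f \<bullet> h)"
    unfolding u(3) by simp
  then show ?thesis
    using is_kernelE[OF f] assms fD by simp
qed

text \<open>By normality \<open>e\<close> is a cokernel of some \<open>f\<close>, and
  \<open>f\<close> factors through the kernel \<open>k\<close>; an arrow annihilating
  \<open>k\<close> therefore annihilates \<open>f\<close>.\<close>

lemma epi_is_cokernel_of_kernel: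
  assumes "epi_arr C e" "is_kernel C e k" "h \<in> Arr C" "Dom C h = Dom C e" "zero_arr C (h \<bullet> k)"
  obtains u where "u \<in> Arr C" "Dom C u = Cod C e" "Cod C u = Cod C h" "u \<bullet> e = h"
proof -
  note k = is_kernelD[OF assms(2)]
  obtain f where f: "is_cokernel C f e" using epi_normal assms by blast
  note fD = is_cokernelD[OF f]
  obtain v where v: "v \<in> Arr C" "Cod C v = Dom C k" "k \<bullet> v = f"
    using is_kernelE[OF assms(2) fD(1) fD(3)[symmetric] fD(4)] by (elim factors_throughE)
  have "zero_arr C ((h \<bullet> k) \<bullet> v)"
    by (rule zero_comp_right) (use v k assms in auto)
  moreover have "(h \<bullet> k) \<bullet> v = h \<bullet> (k \<bullet> v)"
    using v k assms by (intro comp_assoc) auto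
  ultimately have "zero_arr C (h \<bullet> f)"
    unfolding v(3) by simp
  then show ?thesis
    using is_cokernelE[OF f assms(3)] assms fD that by metis
qed

text \<open>A cokernel \<open>c\<close> of \<open>n\<close> annihilates \<open>f\<close>, hence
  factors through \<open>q\<close> and annihilates \<open>m\<close>. As \<open>n\<close> is a kernel
  of \<open>c\<close>, the image \<open>m\<close> factors through \<open>n\<close>.\<close>

lemma image_minimal:
  assumes "is_cokernel C f q" "is_kernel C q m" "mono_arr C n" "factors_through C f n" "Cod C n = Cod C f"
  shows "factors_through C m n"
proof -
  note q = is_cokernelD[OF assms(1)] and m = is_kernelD[OF assms(2)]
  obtain c where c: "is_cokernel C n c" using cokernel_exists mono_arrow[OF assms(3)] by blast
  note cD = is_cokernelD[OF c]
  obtain u where u: "u \<in> Arr C" "Cod C u = Dom C n" "n \<bullet> u = f"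
    using assms(4) by (elim factors_throughE)
  have "zero_arr C ((c \<bullet> n) \<bullet> u)"
    by (rule zero_comp_right) (use u cD in auto)
  moreover have "(c \<bullet> n) \<bullet> u = c \<bullet> (n \<bullet> u)"
    using u cD assms(3) by (intro comp_assoc) auto
  ultimately have "zero_arr C (c \<bullet> f)"
    unfolding u(3) by simp
  then obtain v where v: "v \<in> Arr C" "Dom C v = Cod C q" "v \<bullet> q = c"
    using is_cokernelE[OF assms(1)] cD assms(5) by metis
  have "zero_arr C (v \<bullet> (q \<bullet> m))"
    by (rule zero_comp_left) (use v m q in auto)
  moreover have "(v \<bullet> q) \<bullet> m = v \<bullet> (q \<bullet> m)"
    using v m q by (intro comp_assoc) auto
  ultimately have "zero_arr C (c \<bullet> m)"
    unfolding v(3) by simp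
  then show ?thesis
    using factors_mono_if_cokernel_zero[OF assms(3) c m(2)] m q assms by simp
qed

end

section \<open>Functor categories\<close>

lemma Fun_simps [simp]:
  "Obj (Fun A B) = {F. is_functor A B F}" "Arr (Fun A B) = {t. nat_trans A B t}"
  "Dom (Fun A B) = source" "Cod (Fun A B) = target"
  "source (Idn (Fun A B) F) = F" "target (Idn (Fun A B) F) = F"
  "source (t \<bullet>\<^bsub>Fun A B\<^esub> s) = source s" "target (t \<bullet>\<^bsub>Fun A B\<^esub> s) = target t"
  by (simp_all add: Fun_def)

lemma Fun_component [simp]:
  "a \<in> Obj A \<Longrightarrow> component (t \<bullet>\<^bsub>Fun A B\<^esub> s) a = component t a \<bullet>\<^bsub>B\<^esub> component s a"
  "a \<in> Obj A \<Longrightarrow> component (Idn (Fun A B) F) a = Idn B (omap F a)"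
  by (simp_all add: Fun_def)

text \<open>Components stay, only source and target are exchanged; unlike functors, natural
  transformations change direction in the opposite categories.\<close>

definition nt_op :: "('a, 'm, 'b, 'n) nt \<Rightarrow> ('a, 'm, 'b, 'n) nt" where
  "nt_op t = \<lparr>source = target t, target = source t, component = component t\<rparr>"

lemma nt_op_simps [simp]:
  "source (nt_op t) = target t" "target (nt_op t) = source t" "component (nt_op t) = component t"
  "nt_op (nt_op t) = t"
  by (simp_all add: nt_op_def)

lemma nat_trans_op: "nat_trans (op_cat A) (op_cat B) (nt_op t) = nat_trans A B t"
  by (auto simp: nat_trans_def is_functor_op)

lemma nt_op_comp: "nt_op (s \<bullet>\<^bsub>Fun (op_cat A) (op_cat B)\<^esub> t) = nt_op t \<bullet>\<^bsub>Fun A B\<^esub> nt_op s"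
  by (simp add: nt_op_def Fun_def)

locale functor_cats = A: cat A + B: cat B
  for A :: "('a, 'm) cat" and B :: "('b, 'n) cat"
begin

lemma op_functor_cats: "functor_cats (op_cat A) (op_cat B)"
  by (intro functor_cats.intro A.op_cat B.op_cat)

lemma functor_obj [simp]: "is_functor A B F \<Longrightarrow> a \<in> Obj A \<Longrightarrow> omap F a \<in> Obj B"
  and functor_arr [simp]: "is_functor A B F \<Longrightarrow> f \<in> Arr A \<Longrightarrow> amap F f \<in> Arr B"
  and functor_dom [simp]: "is_functor A B F \<Longrightarrow> f \<in> Arr A \<Longrightarrow> Dom B (amap F f) = omap F (Dom A f)"
  and functor_cod [simp]: "is_functor A B F \<Longrightarrow> f \<in> Arr A \<Longrightarrow> Cod B (amap F f) = omap F (Cod A f)"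
  and functor_id [simp]: "is_functor A B F \<Longrightarrow> a \<in> Obj A \<Longrightarrow> amap F (Idn A a) = Idn B (omap F a)"
  and functor_comp: "is_functor A B F \<Longrightarrow> f \<in> Arr A \<Longrightarrow> g \<in> Arr A \<Longrightarrow> Dom A g = Cod A f \<Longrightarrow>
    amap F (g \<bullet>\<^bsub>A\<^esub> f) = amap F g \<bullet>\<^bsub>B\<^esub> amap F f"
  by (auto simp: is_functor_def)

lemma nt_arr [simp]: "nat_trans A B t \<Longrightarrow> a \<in> Obj A \<Longrightarrow> component t a \<in> Arr B"
  and nt_dom [simp]: "nat_trans A B t \<Longrightarrow> a \<in> Obj A \<Longrightarrow> Dom B (component t a) = omap (source t) a"
  and nt_cod [simp]: "nat_trans A B t \<Longrightarrow> a \<in> Obj A \<Longrightarrow> Cod B (component t a) = omap (target t) a"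
  and nt_source [simp]: "nat_trans A B t \<Longrightarrow> is_functor A B (source t)"
  and nt_target [simp]: "nat_trans A B t \<Longrightarrow> is_functor A B (target t)"
  and nt_natural: "nat_trans A B t \<Longrightarrow> f \<in> Arr A \<Longrightarrow>
    component t (Cod A f) \<bullet>\<^bsub>B\<^esub> amap (source t) f = amap (target t) f \<bullet>\<^bsub>B\<^esub> component t (Dom A f)"
  by (auto simp: nat_trans_def)

lemma nt_eqI:
  assumes "nat_trans A B s" "nat_trans A B t" "source s = source t" "target s = target t"
    "\<And>a. a \<in> Obj A \<Longrightarrow> component s a = component t a"
  shows "s = t"
proof -
  have "component s = component t"
    by (rule extensionalityI[OF _ _ assms(5)])
      (use assms(1,2) in \<open>simp_all only: nat_trans_def\<close>)
  then show ?thesis using assms(3,4) by simp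
qed

lemma nt_comp:
  assumes s: "nat_trans A B s" and t: "nat_trans A B t" and e: "source t = target s"
  shows "nat_trans A B (t \<bullet>\<^bsub>Fun A B\<^esub> s)"
proof -
  have "(component t (Cod A f) \<bullet>\<^bsub>B\<^esub> component s (Cod A f)) \<bullet>\<^bsub>B\<^esub> amap (source s) f =
      amap (target t) f \<bullet>\<^bsub>B\<^esub> (component t (Dom A f) \<bullet>\<^bsub>B\<^esub> component s (Dom A f))" if f: "f \<in> Arr A" for f
  proof -
    have "(component t (Cod A f) \<bullet>\<^bsub>B\<^esub> component s (Cod A f)) \<bullet>\<^bsub>B\<^esub> amap (source s) f =
        component t (Cod A f) \<bullet>\<^bsub>B\<^esub> (amap (source t) f \<bullet>\<^bsub>B\<^esub> component s (Dom A f))"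
      using s t e f by (simp add: B.comp_assoc nt_natural)
    also have "\<dots> = (component t (Cod A f) \<bullet>\<^bsub>B\<^esub> amap (source t) f) \<bullet>\<^bsub>B\<^esub> component s (Dom A f)"
      using s t e f by (intro B.comp_assoc[symmetric]) auto
    also have "\<dots> = amap (target t) f \<bullet>\<^bsub>B\<^esub> (component t (Dom A f) \<bullet>\<^bsub>B\<^esub> component s (Dom A f))"
      using s t e f nt_natural[OF t f, unfolded e] by (simp add: B.comp_assoc[symmetric])
    finally show ?thesis .
  qed
  moreover have "component (t \<bullet>\<^bsub>Fun A B\<^esub> s) \<in> extensional (Obj A)"
    by (simp add: Fun_def)
  ultimately show ?thesis
    using s t e unfolding nat_trans_def[of A B "t \<bullet>\<^bsub>Fun A B\<^esub> s"] by simp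
qed

lemma category_Fun: "category (Fun A B)"
proof -
  have "nat_trans A B (Idn (Fun A B) F)" if "is_functor A B F" for F
    using that unfolding nat_trans_def by (auto simp: Fun_def)
  moreover have "t \<bullet>\<^bsub>Fun A B\<^esub> Idn (Fun A B) (source t) = t" "Idn (Fun A B) (target t) \<bullet>\<^bsub>Fun A B\<^esub> t = t"
    if "nat_trans A B t" for t
    by (rule nt_eqI; use that calculation in \<open>auto intro!: nt_comp\<close>)+
  moreover have "h \<bullet>\<^bsub>Fun A B\<^esub> (g \<bullet>\<^bsub>Fun A B\<^esub> f) = (h \<bullet>\<^bsub>Fun A B\<^esub> g) \<bullet>\<^bsub>Fun A B\<^esub> f"
    if "nat_trans A B f" "nat_trans A B g" "nat_trans A B h" "source g = target f" "source h = target g"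
    for f g h
    by (rule nt_eqI) (use that in \<open>auto intro!: nt_comp simp: B.comp_assoc\<close>)
  ultimately show ?thesis
    unfolding category_def by (auto intro: nt_comp)
qed

sublocale Fun: cat "Fun A B"
  by unfold_locales (rule category_Fun)

section \<open>Gluing objectwise data into functors and natural transformations\<close>

text \<open>A compatible family of subobjects is a subfunctor: the action on an arrow is its
  factorization through \<open>m\<close>, and the functor laws hold because they hold after
  composing with the monomorphism.\<close>

lemma functor_lift:
  assumes S: "is_functor A B S"
    and m: "\<And>a. a \<in> Obj A \<Longrightarrow> mono_arr B (m a)" "\<And>a. a \<in> Obj A \<Longrightarrow> Cod B (m a) = omap S a"
    and fac: "\<And>f. f \<in> Arr A \<Longrightarrow> factors_through B (amap S f \<bullet>\<^bsub>B\<^esub> m (Dom A f)) (m (Cod A f))"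
  obtains k where "nat_trans A B k" "target k = S" "\<And>a. a \<in> Obj A \<Longrightarrow> component k a = m a"
proof -
  have marr: "m a \<in> Arr B" if "a \<in> Obj A" for a using m(1)[OF that] by simp
  have "\<exists>u. u \<in> Arr B \<and> Dom B u = Dom B (m (Dom A f)) \<and> Cod B u = Dom B (m (Cod A f)) \<and>
      m (Cod A f) \<bullet>\<^bsub>B\<^esub> u = amap S f \<bullet>\<^bsub>B\<^esub> m (Dom A f)" if f: "f \<in> Arr A" for f
    using B.factors_throughE[OF fac[OF f]] S f m(2) marr
    by (metis A.dom_obj B.dom_comp functor_arr functor_dom)
  then obtain k where k: "k f \<in> Arr B" "Dom B (k f) = Dom B (m (Dom A f))"
    "Cod B (k f) = Dom B (m (Cod A f))" "m (Cod A f) \<bullet>\<^bsub>B\<^esub> k f = amap S f \<bullet>\<^bsub>B\<^esub> m (Dom A f)"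
    if "f \<in> Arr A" for f by metis
  \<comment> \<open>The restrictions make \<open>K\<close> extensional, as functors are required to
    be.\<close>
  define K where "K = \<lparr>omap = (\<lambda>a\<in>Obj A. Dom B (m a)), amap = restrict k (Arr A)\<rparr>"
  have "k (Idn A a) = Idn B (Dom B (m a))" if a: "a \<in> Obj A" for a
  proof -
    have "m a \<bullet>\<^bsub>B\<^esub> k (Idn A a) = m a \<bullet>\<^bsub>B\<^esub> Idn B (Dom B (m a))"
      using k[of "Idn A a"] a S m(2) marr by simp
    then show ?thesis
      by (rule B.mono_cancel[OF m(1)[OF a]]) (use k[of "Idn A a"] a marr in auto)
  qed
  moreover have "k (g \<bullet>\<^bsub>A\<^esub> f) = k g \<bullet>\<^bsub>B\<^esub> k f" if f: "f \<in> Arr A" "g \<in> Arr A" "Dom A g = Cod A f" for f g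
  proof -
    have "m (Cod A g) \<bullet>\<^bsub>B\<^esub> k (g \<bullet>\<^bsub>A\<^esub> f) = (amap S g \<bullet>\<^bsub>B\<^esub> amap S f) \<bullet>\<^bsub>B\<^esub> m (Dom A f)"
      using k(4)[of "g \<bullet>\<^bsub>A\<^esub> f"] f S by (simp add: functor_comp)
    also have "\<dots> = amap S g \<bullet>\<^bsub>B\<^esub> (m (Cod A f) \<bullet>\<^bsub>B\<^esub> k f)"
      using f S m(2) marr k(4)[of f] by (simp add: B.comp_assoc)
    also have "\<dots> = (amap S g \<bullet>\<^bsub>B\<^esub> m (Cod A f)) \<bullet>\<^bsub>B\<^esub> k f"
      using f S m(2) marr k(1-3) by (intro B.comp_assoc[symmetric]) auto
    also have "\<dots> = (m (Cod A g) \<bullet>\<^bsub>B\<^esub> k g) \<bullet>\<^bsub>B\<^esub> k f"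
      using f k(4)[of g] by simp
    also have "\<dots> = m (Cod A g) \<bullet>\<^bsub>B\<^esub> (k g \<bullet>\<^bsub>B\<^esub> k f)"
      using f S m(2) marr k(1-3) by (intro B.comp_assoc) auto
    finally show ?thesis
      by (rule B.mono_cancel[OF m(1)[OF A.cod_obj[OF f(2)]]]) (use k(1-3) f in auto)
  qed
  ultimately have K: "is_functor A B K"
    using k(1-3) marr unfolding is_functor_def K_def by auto
  define l where "l = \<lparr>source = K, target = S, component = restrict m (Obj A)\<rparr>"
  have "nat_trans A B l"
    using K S m(2) marr k(4) unfolding nat_trans_def l_def by (simp add: K_def)
  then show ?thesis
    by (rule that) (simp_all add: l_def)
qed

text \<open>Factorizations chosen independently at each object are automatically natural: the two
  sides of the naturality square agree after the monomorphic component of \<open>t\<close>.\<close>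

lemma nt_lift:
  assumes t: "nat_trans A B t" and h: "nat_trans A B h" and tgt: "target h = target t"
    and m: "\<And>a. a \<in> Obj A \<Longrightarrow> mono_arr B (component t a)"
    and fac: "\<And>a. a \<in> Obj A \<Longrightarrow> factors_through B (component h a) (component t a)"
  shows "factors_through (Fun A B) h t"
proof -
  have "\<exists>u. u \<in> Arr B \<and> Dom B u = omap (source h) a \<and> Cod B u = omap (source t) a \<and>
      component t a \<bullet>\<^bsub>B\<^esub> u = component h a" if a: "a \<in> Obj A" for a
    using B.factors_throughE[OF fac[OF a]] a t h by (metis nt_dom)
  then obtain u where u: "u a \<in> Arr B" "Dom B (u a) = omap (source h) a"
    "Cod B (u a) = omap (source t) a" "component t a \<bullet>\<^bsub>B\<^esub> u a = component h a" if "a \<in> Obj A" for a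
    by metis
  have nat: "u (Cod A f) \<bullet>\<^bsub>B\<^esub> amap (source h) f = amap (source t) f \<bullet>\<^bsub>B\<^esub> u (Dom A f)" if f: "f \<in> Arr A" for f
  proof -
    have ob: "Dom A f \<in> Obj A" "Cod A f \<in> Obj A" using f by auto
    have "component t (Cod A f) \<bullet>\<^bsub>B\<^esub> (u (Cod A f) \<bullet>\<^bsub>B\<^esub> amap (source h) f) =
        (component t (Cod A f) \<bullet>\<^bsub>B\<^esub> u (Cod A f)) \<bullet>\<^bsub>B\<^esub> amap (source h) f"
      using f t h ob u(1-3) by (intro B.comp_assoc[symmetric]) auto
    also have "\<dots> = amap (target t) f \<bullet>\<^bsub>B\<^esub> component h (Dom A f)"
      using u(4)[OF ob(2)] nt_natural[OF h f] tgt by simp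
    also have "\<dots> = amap (target t) f \<bullet>\<^bsub>B\<^esub> (component t (Dom A f) \<bullet>\<^bsub>B\<^esub> u (Dom A f))"
      using u(4)[OF ob(1)] by simp
    also have "\<dots> = (amap (target t) f \<bullet>\<^bsub>B\<^esub> component t (Dom A f)) \<bullet>\<^bsub>B\<^esub> u (Dom A f)"
      using f t h ob u(1-3) by (intro B.comp_assoc[symmetric]) auto
    also have "\<dots> = (component t (Cod A f) \<bullet>\<^bsub>B\<^esub> amap (source t) f) \<bullet>\<^bsub>B\<^esub> u (Dom A f)"
      using nt_natural[OF t f] by simp
    also have "\<dots> = component t (Cod A f) \<bullet>\<^bsub>B\<^esub> (amap (source t) f \<bullet>\<^bsub>B\<^esub> u (Dom A f))"
      using f t h ob u(1-3) by (intro B.comp_assoc) auto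
    finally show ?thesis
      by (rule B.mono_cancel[OF m[OF ob(2)]]) (use f t h ob u(1-3) in auto)
  qed
  define v where "v = \<lparr>source = source h, target = source t, component = restrict u (Obj A)\<rparr>"
  have v: "nat_trans A B v"
    using t h u nat unfolding nat_trans_def[of A B v] by (simp add: v_def)
  have vs: "source v = source h" "target v = source t" "\<And>a. a \<in> Obj A \<Longrightarrow> component v a = u a"
    by (simp_all add: v_def)
  have "t \<bullet>\<^bsub>Fun A B\<^esub> v = h"
    by (rule nt_eqI) (use t v vs h tgt u(4) in \<open>auto intro!: nt_comp\<close>)
  then show ?thesis
    by (rule Fun.factors_throughI) (use t v vs in auto)
qed

text \<open>This is \<open>nt_lift\<close> for the opposite categories, with the factorization
  carried back by \<open>nt_op\<close>.\<close>

lemma nt_colift: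
  assumes t: "nat_trans A B t" and h: "nat_trans A B h" and src: "source h = source t"
    and e: "\<And>a. a \<in> Obj A \<Longrightarrow> epi_arr B (component t a)"
    and fac: "\<And>a. a \<in> Obj A \<Longrightarrow> factors_through (op_cat B) (component h a) (component t a)"
  shows "factors_through (op_cat (Fun A B)) h t"
proof -
  let ?F = "Fun (op_cat A) (op_cat B)"
  interpret op: functor_cats "op_cat A" "op_cat B" by (rule op_functor_cats)
  have "factors_through ?F (nt_op h) (nt_op t)"
    by (rule op.nt_lift) (use assms in \<open>simp_all add: nat_trans_op mono_arr_op\<close>)
  then obtain u where u: "nat_trans (op_cat A) (op_cat B) u" "source u = target h" "target u = target t"
    "nt_op t \<bullet>\<^bsub>?F\<^esub> u = nt_op h"
    by (rule op.Fun.factors_throughE) simp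
  have "nt_op u \<bullet>\<^bsub>Fun A B\<^esub> t = h"
    using nt_op_comp[where s = "nt_op t" and t = u and A = A and B = B] u(4) by simp
  moreover have "nat_trans A B (nt_op u)"
    using u(1) nat_trans_op[where t = "nt_op u" and A = A and B = B] by simp
  ultimately show ?thesis
    using u t unfolding factors_through_def by (intro exI[of _ "nt_op u"]) simp
qed

lemma functor_colift:
  assumes S: "is_functor A B S"
    and m: "\<And>a. a \<in> Obj A \<Longrightarrow> epi_arr B (m a)" "\<And>a. a \<in> Obj A \<Longrightarrow> Dom B (m a) = omap S a"
    and fac: "\<And>f. f \<in> Arr A \<Longrightarrow> factors_through (op_cat B) (m (Cod A f) \<bullet>\<^bsub>B\<^esub> amap S f) (m (Dom A f))"
  obtains k where "nat_trans A B k" "source k = S" "\<And>a. a \<in> Obj A \<Longrightarrow> component k a = m a"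
proof -
  interpret op: functor_cats "op_cat A" "op_cat B" by (rule op_functor_cats)
  obtain k where k: "nat_trans (op_cat A) (op_cat B) k" "target k = S"
    "\<And>a. a \<in> Obj A \<Longrightarrow> component k a = m a"
    by (rule op.functor_lift[of S m]) (use assms in \<open>simp_all add: is_functor_op mono_arr_op\<close>)
  show ?thesis
    by (rule that[of "nt_op k"])
      (use k nat_trans_op[where t = "nt_op k" and A = A and B = B] in simp_all)
qed

text \<open>This half is mere cancellation at each object; the converse in
  \<open>mono_Fun_iff\<close> rests on kernels in an abelian target.\<close>

lemma mono_Fun_if_pointwise:
  assumes t: "nat_trans A B t" and m: "\<And>a. a \<in> Obj A \<Longrightarrow> mono_arr B (component t a)"
  shows "mono_arr (Fun A B) t"
proof (rule Fun.mono_arrI)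
  fix f g assume fg: "f \<in> Arr (Fun A B)" "g \<in> Arr (Fun A B)" "Dom (Fun A B) f = Dom (Fun A B) g"
    "Cod (Fun A B) f = Dom (Fun A B) t" "Cod (Fun A B) g = Dom (Fun A B) t"
    "t \<bullet>\<^bsub>Fun A B\<^esub> f = t \<bullet>\<^bsub>Fun A B\<^esub> g"
  show "f = g"
  proof (rule nt_eqI)
    fix a assume a: "a \<in> Obj A"
    have "component t a \<bullet>\<^bsub>B\<^esub> component f a = component t a \<bullet>\<^bsub>B\<^esub> component g a"
      using Fun_component(1)[OF a] fg(6) by metis
    then show "component f a = component g a"
      by (rule B.mono_cancel[OF m[OF a]]) (use fg t a in auto)
  qed (use fg in auto)
qed (use t in simp)

lemma epi_Fun_if_pointwise:
  assumes t: "nat_trans A B t" and m: "\<And>a. a \<in> Obj A \<Longrightarrow> epi_arr B (component t a)"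
  shows "epi_arr (Fun A B) t"
  unfolding mono_arr_op[symmetric]
proof (rule cat.mono_arrI[OF Fun.op_cat])
  fix f g assume "f \<in> Arr (op_cat (Fun A B))" "g \<in> Arr (op_cat (Fun A B))"
    "Dom (op_cat (Fun A B)) f = Dom (op_cat (Fun A B)) g"
    "Cod (op_cat (Fun A B)) f = Dom (op_cat (Fun A B)) t"
    "Cod (op_cat (Fun A B)) g = Dom (op_cat (Fun A B)) t"
    "t \<bullet>\<^bsub>op_cat (Fun A B)\<^esub> f = t \<bullet>\<^bsub>op_cat (Fun A B)\<^esub> g"
  then have fg: "nat_trans A B f" "nat_trans A B g" "target f = target g" "source f = target t"
    "source g = target t" "f \<bullet>\<^bsub>Fun A B\<^esub> t = g \<bullet>\<^bsub>Fun A B\<^esub> t"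
    by simp_all
  show "f = g"
  proof (rule nt_eqI)
    fix a assume a: "a \<in> Obj A"
    have "component f a \<bullet>\<^bsub>B\<^esub> component t a = component g a \<bullet>\<^bsub>B\<^esub> component t a"
      using Fun_component(1)[OF a] fg(6) by metis
    then show "component f a = component g a"
      by (rule B.epi_cancel[OF m[OF a]]) (use fg(1-5) t a in auto)
  qed (use fg in auto)
qed (use t in simp)

end

locale functor_abelian = functor_cats A B + B: abelian B
  for A :: "('a, 'm) cat" and B :: "('b, 'n) cat"
begin

section \<open>Objectwise zero arrows, kernels and cokernels of functors\<close>

definition const_functor :: "'b \<Rightarrow> ('a, 'm, 'b, 'n) func" where
  "const_functor z = \<lparr>omap = (\<lambda>a\<in>Obj A. z), amap = (\<lambda>f\<in>Arr A. Idn B z)\<rparr>"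

lemma const_functor: "z \<in> Obj B \<Longrightarrow> is_functor A B (const_functor z)"
  by (auto simp: is_functor_def const_functor_def)

lemma omap_const [simp]: "a \<in> Obj A \<Longrightarrow> omap (const_functor z) a = z"
  by (simp add: const_functor_def)

text \<open>Arrows into and out of \<open>z\<close> are unique, which supplies the components and
  makes naturality and uniqueness immediate.\<close>

lemma zero_const_functor:
  assumes z: "zero_obj B z"
  shows "zero_obj (Fun A B) (const_functor z)"
proof -
  have zo: "z \<in> Obj B" using z by (simp add: zero_obj_def)
  note K = const_functor[OF zo]
  have into: "\<exists>f. f \<in> Hom B b z" "f \<in> Hom B b z \<Longrightarrow> g \<in> Hom B b z \<Longrightarrow> f = g"
    and out: "\<exists>f. f \<in> Hom B z b" "f \<in> Hom B z b \<Longrightarrow> g \<in> Hom B z b \<Longrightarrow> f = g" if "b \<in> Obj B" for b f g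
    using z that unfolding zero_obj_def by metis+
  have "(\<exists>!t. t \<in> Hom (Fun A B) H (const_functor z)) \<and> (\<exists>!t. t \<in> Hom (Fun A B) (const_functor z) H)"
    if H: "is_functor A B H" for H
  proof
    have "\<exists>p. a \<in> Obj A \<longrightarrow> p \<in> Hom B (omap H a) z" for a
      using into(1) functor_obj[OF H] by blast
    then obtain p where p: "p a \<in> Hom B (omap H a) z" if "a \<in> Obj A" for a
      by metis
    define t where "t = \<lparr>source = H, target = const_functor z, component = restrict p (Obj A)\<rparr>"
    have "p (Cod A f) \<bullet>\<^bsub>B\<^esub> amap H f = amap (const_functor z) f \<bullet>\<^bsub>B\<^esub> p (Dom A f)" if f: "f \<in> Arr A" for f
      by (rule into(2)[of "omap H (Dom A f)"]) (use f p[of "Cod A f"] p[of "Dom A f"] K H in auto)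
    then have "nat_trans A B t"
      using p H K unfolding nat_trans_def by (auto simp: t_def)
    then have "t \<in> Hom (Fun A B) H (const_functor z)"
      by (simp add: t_def)
    then show "\<exists>!t. t \<in> Hom (Fun A B) H (const_functor z)"
    proof (rule ex1I)
      fix s assume s: "s \<in> Hom (Fun A B) H (const_functor z)"
      show "s = t"
      proof (rule nt_eqI)
        show "component s a = component t a" if "a \<in> Obj A" for a
          by (rule into(2)[of "omap H a"]) (use that s p[OF that] H in \<open>auto simp: t_def\<close>)
      qed (use s \<open>nat_trans A B t\<close> in \<open>auto simp: t_def\<close>)
    qed
  next
    have "\<exists>p. a \<in> Obj A \<longrightarrow> p \<in> Hom B z (omap H a)" for a
      using out(1) functor_obj[OF H] by blast
    then obtain p where p: "p a \<in> Hom B z (omap H a)" if "a \<in> Obj A" for a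
      by metis
    define t where "t = \<lparr>source = const_functor z, target = H, component = restrict p (Obj A)\<rparr>"
    have "p (Cod A f) \<bullet>\<^bsub>B\<^esub> amap (const_functor z) f = amap H f \<bullet>\<^bsub>B\<^esub> p (Dom A f)" if f: "f \<in> Arr A" for f
      by (rule out(2)[of "omap H (Cod A f)"]) (use f p[of "Cod A f"] p[of "Dom A f"] K H in auto)
    then have "nat_trans A B t"
      using p H K unfolding nat_trans_def by (auto simp: t_def)
    then have "t \<in> Hom (Fun A B) (const_functor z) H"
      by (simp add: t_def)
    then show "\<exists>!t. t \<in> Hom (Fun A B) (const_functor z) H"
    proof (rule ex1I)
      fix s assume s: "s \<in> Hom (Fun A B) (const_functor z) H"
      show "s = t"
      proof (rule nt_eqI)
        show "component s a = component t a" if "a \<in> Obj A" for a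
          by (rule out(2)[of "omap H a"]) (use that s p[OF that] H in \<open>auto simp: t_def\<close>)
      qed (use s \<open>nat_trans A B t\<close> in \<open>auto simp: t_def\<close>)
    qed
  qed
  then show ?thesis
    using K unfolding zero_obj_def by simp
qed

sublocale Fun: zero_cat "Fun A B"
  by unfold_locales (use B.has_zero zero_const_functor in blast)

text \<open>Both directions compare \<open>t\<close> with the transformation through a constant zero
  functor, which is zero in \<open>Fun A B\<close> and at every object; zero arrows with the same
  ends coincide.\<close>

lemma zero_Fun_iff:
  assumes t: "nat_trans A B t"
  shows "zero_arr (Fun A B) t \<longleftrightarrow> (\<forall>a\<in>Obj A. zero_arr B (component t a))"
proof -
  obtain z where z: "zero_obj B z" using B.has_zero by blast
  have st: "source t \<in> Obj (Fun A B)" "target t \<in> Obj (Fun A B)" using t by simp_all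
  obtain p i where pi: "p \<in> Hom (Fun A B) (source t) (const_functor z)"
    "i \<in> Hom (Fun A B) (const_functor z) (target t)" "zero_arr (Fun A B) (i \<bullet>\<^bsub>Fun A B\<^esub> p)"
    using Fun.zero_through[OF st zero_const_functor[OF z]] .
  have ip: "zero_arr B (component (i \<bullet>\<^bsub>Fun A B\<^esub> p) a)" if a: "a \<in> Obj A" for a
    unfolding zero_arr_def
    by (rule conjI, use pi(1,2) a in simp, rule exI[of _ z], rule exI[of _ "component p a"],
        rule exI[of _ "component i a"]) (use pi(1,2) a z in simp)
  have nt: "nat_trans A B (i \<bullet>\<^bsub>Fun A B\<^esub> p)"
    using pi(1,2) by (intro nt_comp) auto
  show ?thesis
  proof
    assume "zero_arr (Fun A B) t"
    from Fun.zero_unique[OF this pi(3)] have "t = i \<bullet>\<^bsub>Fun A B\<^esub> p"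
      using pi(1,2) by simp
    then show "\<forall>a\<in>Obj A. zero_arr B (component t a)"
      using ip by simp
  next
    assume *: "\<forall>a\<in>Obj A. zero_arr B (component t a)"
    have "t = i \<bullet>\<^bsub>Fun A B\<^esub> p"
    proof (rule nt_eqI[OF t nt])
      fix a assume a: "a \<in> Obj A"
      show "component t a = component (i \<bullet>\<^bsub>Fun A B\<^esub> p) a"
        by (rule B.zero_unique[OF bspec[OF * a] ip[OF a]])
          (use t a pi(1,2) nt in \<open>simp_all del: Fun_component\<close>)
    qed (use pi(1,2) in simp_all)
    then show "zero_arr (Fun A B) t" using pi(3) by simp
  qed
qed

text \<open>Kernels chosen at the single objects are compatible by naturality of \<open>t\<close>,
  so \<open>functor_lift\<close> turns them into a subfunctor; \<open>nt_lift\<close> then provides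
  its universal property.\<close>

lemma pointwise_kernel:
  assumes t: "nat_trans A B t"
  obtains k where "is_kernel (Fun A B) t k" "\<And>a. a \<in> Obj A \<Longrightarrow> is_kernel B (component t a) (component k a)"
proof -
  have "\<exists>m. a \<in> Obj A \<longrightarrow> is_kernel B (component t a) m" for a
    using B.kernel_exists nt_arr[OF t] by blast
  then obtain m where m: "is_kernel B (component t a) (m a)" if "a \<in> Obj A" for a
    by metis
  note mD = B.is_kernelD[OF m]
  have md: "Cod B (m a) = omap (source t) a" if "a \<in> Obj A" for a
    using mD(3)[OF that] t that by simp
  have "factors_through B (amap (source t) f \<bullet>\<^bsub>B\<^esub> m (Dom A f)) (m (Cod A f))" if f: "f \<in> Arr A" for f
  proof (rule B.is_kernelE[OF m])
    have ob: "Dom A f \<in> Obj A" "Cod A f \<in> Obj A" using f by auto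
    have "zero_arr B (amap (target t) f \<bullet>\<^bsub>B\<^esub> (component t (Dom A f) \<bullet>\<^bsub>B\<^esub> m (Dom A f)))"
      by (rule B.zero_comp_left[OF mD(4)[OF ob(1)]]) (use f t ob mD(2) md in auto)
    also have "amap (target t) f \<bullet>\<^bsub>B\<^esub> (component t (Dom A f) \<bullet>\<^bsub>B\<^esub> m (Dom A f)) =
        (component t (Cod A f) \<bullet>\<^bsub>B\<^esub> amap (source t) f) \<bullet>\<^bsub>B\<^esub> m (Dom A f)"
      unfolding nt_natural[OF t f] by (rule B.comp_assoc[symmetric]) (use f t ob mD(2) md in auto)
    also have "\<dots> = component t (Cod A f) \<bullet>\<^bsub>B\<^esub> (amap (source t) f \<bullet>\<^bsub>B\<^esub> m (Dom A f))"
      by (rule B.comp_assoc) (use f t ob mD(2) md in auto)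
    finally show "zero_arr B (component t (Cod A f) \<bullet>\<^bsub>B\<^esub> (amap (source t) f \<bullet>\<^bsub>B\<^esub> m (Dom A f)))" .
  qed (use f t mD(2) md in auto)
  then obtain k where k: "nat_trans A B k" "target k = source t" "\<And>a. a \<in> Obj A \<Longrightarrow> component k a = m a"
    using functor_lift[OF nt_source[OF t], of m] mD(5) md by metis
  have tk: "nat_trans A B (t \<bullet>\<^bsub>Fun A B\<^esub> k)" using nt_comp[OF k(1) t] k(2) by simp
  have "is_kernel (Fun A B) t k"
  proof (rule Fun.is_kernelI)
    show "zero_arr (Fun A B) (t \<bullet>\<^bsub>Fun A B\<^esub> k)"
      using zero_Fun_iff[OF tk] mD(4) k(3) by simp
    show "mono_arr (Fun A B) k"
      by (rule mono_Fun_if_pointwise[OF k(1)]) (use mD(5) k(3) in simp)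
    fix h assume h: "h \<in> Arr (Fun A B)" "Cod (Fun A B) h = Dom (Fun A B) t" "zero_arr (Fun A B) (t \<bullet>\<^bsub>Fun A B\<^esub> h)"
    have th: "nat_trans A B (t \<bullet>\<^bsub>Fun A B\<^esub> h)" using nt_comp[of h t] h t by simp
    show "factors_through (Fun A B) h k"
    proof (rule nt_lift[OF k(1)])
      fix a assume a: "a \<in> Obj A"
      show "mono_arr B (component k a)" using mD(5) k(3) a by simp
      have "zero_arr B (component t a \<bullet>\<^bsub>B\<^esub> component h a)"
        using h(3) zero_Fun_iff[OF th] a by simp
      then show "factors_through B (component h a) (component k a)"
        unfolding k(3)[OF a] by (intro B.is_kernelE[OF m[OF a]]) (use h a t in simp_all)
    qed (use h k in simp_all)
  qed (use t k in simp_all)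
  then show ?thesis
    by (rule that) (use m k(3) in simp)
qed

lemma pointwise_cokernel:
  assumes t: "nat_trans A B t"
  obtains q where "is_cokernel (Fun A B) t q"
    "\<And>a. a \<in> Obj A \<Longrightarrow> is_cokernel B (component t a) (component q a)"
proof -
  have "\<exists>m. a \<in> Obj A \<longrightarrow> is_cokernel B (component t a) m" for a
    using B.cokernel_exists nt_arr[OF t] by blast
  then obtain m where m: "is_cokernel B (component t a) (m a)" if "a \<in> Obj A" for a
    by metis
  note mD = B.is_cokernelD[OF m]
  have md: "Dom B (m a) = omap (target t) a" if "a \<in> Obj A" for a
    using mD(3)[OF that] t that by simp
  \<comment> \<open>The universal property is phrased as a factorization in \<open>op_cat B\<close>,
    the form that \<open>functor_colift\<close> and \<open>nt_colift\<close> expect.\<close>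
  have coker_lift: "factors_through (op_cat B) h (m a)"
    if "a \<in> Obj A" "h \<in> Arr B" "Dom B h = omap (target t) a" "zero_arr B (h \<bullet>\<^bsub>B\<^esub> component t a)" for a h
    using cat.is_kernelE[OF B.op_cat, of "component t a" "m a" h] that m[OF that(1)] t
    by (simp add: is_kernel_op zero_arr_op)
  have "factors_through (op_cat B) (m (Cod A f) \<bullet>\<^bsub>B\<^esub> amap (target t) f) (m (Dom A f))" if f: "f \<in> Arr A" for f
  proof (rule coker_lift)
    have ob: "Dom A f \<in> Obj A" "Cod A f \<in> Obj A" using f by auto
    have "zero_arr B ((m (Cod A f) \<bullet>\<^bsub>B\<^esub> component t (Cod A f)) \<bullet>\<^bsub>B\<^esub> amap (source t) f)"
      by (rule B.zero_comp_right[OF mD(4)[OF ob(2)]]) (use f t ob mD(2) md in auto)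
    also have "(m (Cod A f) \<bullet>\<^bsub>B\<^esub> component t (Cod A f)) \<bullet>\<^bsub>B\<^esub> amap (source t) f =
        m (Cod A f) \<bullet>\<^bsub>B\<^esub> (amap (target t) f \<bullet>\<^bsub>B\<^esub> component t (Dom A f))"
      unfolding nt_natural[OF t f, symmetric] by (rule B.comp_assoc) (use f t ob mD(2) md in auto)
    also have "\<dots> = (m (Cod A f) \<bullet>\<^bsub>B\<^esub> amap (target t) f) \<bullet>\<^bsub>B\<^esub> component t (Dom A f)"
      by (rule B.comp_assoc[symmetric]) (use f t ob mD(2) md in auto)
    finally show "zero_arr B ((m (Cod A f) \<bullet>\<^bsub>B\<^esub> amap (target t) f) \<bullet>\<^bsub>B\<^esub> component t (Dom A f))" .
  qed (use f t mD(2) md in auto)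
  then obtain q where q: "nat_trans A B q" "source q = target t" "\<And>a. a \<in> Obj A \<Longrightarrow> component q a = m a"
    using functor_colift[OF nt_target[OF t], of m] mD(5) md by metis
  have qt: "nat_trans A B (q \<bullet>\<^bsub>Fun A B\<^esub> t)" using nt_comp[OF t q(1)] q(2) by simp
  have "is_cokernel (Fun A B) t q"
  proof (rule Fun.is_cokernelI)
    show "zero_arr (Fun A B) (q \<bullet>\<^bsub>Fun A B\<^esub> t)"
      using zero_Fun_iff[OF qt] mD(4) q(3) by simp
    show "epi_arr (Fun A B) q"
      by (rule epi_Fun_if_pointwise[OF q(1)]) (use mD(5) q(3) in simp)
    fix h assume h: "h \<in> Arr (Fun A B)" "Dom (Fun A B) h = Cod (Fun A B) t" "zero_arr (Fun A B) (h \<bullet>\<^bsub>Fun A B\<^esub> t)"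
    have ht: "nat_trans A B (h \<bullet>\<^bsub>Fun A B\<^esub> t)" using nt_comp[of t h] h t by simp
    show "factors_through (op_cat (Fun A B)) h q"
    proof (rule nt_colift[OF q(1)])
      fix a assume a: "a \<in> Obj A"
      show "epi_arr B (component q a)" using mD(5) q(3) a by simp
      have "zero_arr B (component h a \<bullet>\<^bsub>B\<^esub> component t a)"
        using h(3) zero_Fun_iff[OF ht] a by simp
      then show "factors_through (op_cat B) (component h a) (component q a)"
        unfolding q(3)[OF a] by (intro coker_lift[OF a]) (use h a t in simp_all)
    qed (use h q in simp_all)
  qed (use t q in simp_all)
  then show ?thesis
    by (rule that) (use m q(3) in simp)
qed

text \<open>If \<open>t\<close> is monic, its kernel is zero. This kernel can be taken objectwise,
  so every component of \<open>t\<close> has zero kernel and is monic by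
  \<open>mono_if_trivial_kernel\<close>.\<close>

lemma mono_Fun_iff:
  "mono_arr (Fun A B) t \<longleftrightarrow> nat_trans A B t \<and> (\<forall>a\<in>Obj A. mono_arr B (component t a))"
proof
  assume m: "mono_arr (Fun A B) t"
  then have t: "nat_trans A B t" using Fun.mono_arrow by simp
  obtain k where k: "is_kernel (Fun A B) t k" "\<And>a. a \<in> Obj A \<Longrightarrow> is_kernel B (component t a) (component k a)"
    using pointwise_kernel[OF t] by metis
  note kD = Fun.is_kernelD[OF k(1)]
  have zk: "zero_arr (Fun A B) k"
    using Fun.zero_cancel_mono[OF m kD(4) kD(2,3)] .
  have "mono_arr B (component t a)" if a: "a \<in> Obj A" for a
  proof (rule B.mono_if_trivial_kernel)
    fix h assume "h \<in> Arr B" "Cod B h = Dom B (component t a)" "zero_arr B (component t a \<bullet>\<^bsub>B\<^esub> h)"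
    from B.is_kernelE[OF k(2)[OF a] this] obtain u
      where u: "u \<in> Arr B" "Cod B u = Dom B (component k a)" "component k a \<bullet>\<^bsub>B\<^esub> u = h"
      by (rule B.factors_throughE)
    have "zero_arr B (component k a)"
      using zk zero_Fun_iff[of k] kD(2) a by simp
    from B.zero_comp_right[OF this u(1,2)] show "zero_arr B h" unfolding u(3) .
  qed (use t a in simp)
  then show "nat_trans A B t \<and> (\<forall>a\<in>Obj A. mono_arr B (component t a))" using t by blast
qed (use mono_Fun_if_pointwise in blast)

text \<open>\<open>pointwise_kernel\<close> only shows that some kernel is objectwise. The
  definitions of \<open>\<phi>\<close> and \<open>\<psi>\<close> admit all kernels, so an arbitrary
  one is compared with the objectwise one.\<close>

lemma kernel_Fun_component:
  assumes "is_kernel (Fun A B) t k" "a \<in> Obj A"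
  shows "is_kernel B (component t a) (component k a)"
proof -
  note kD = Fun.is_kernelD[OF assms(1)]
  have t: "nat_trans A B t" using kD by simp
  obtain k' where k': "is_kernel (Fun A B) t k'" "is_kernel B (component t a) (component k' a)"
    using pointwise_kernel[OF t] assms(2) by metis
  obtain u v where uv: "u \<in> Hom (Fun A B) (source k) (source k')" "v \<in> Hom (Fun A B) (source k') (source k)"
    "k' \<bullet>\<^bsub>Fun A B\<^esub> u = k" "k \<bullet>\<^bsub>Fun A B\<^esub> v = k'" "v \<bullet>\<^bsub>Fun A B\<^esub> u = Idn (Fun A B) (source k)"
    using Fun.kernel_iso[OF assms(1) k'(1)] by auto
  show ?thesis
  proof (rule B.kernel_transport[OF k'(2)])
    show "component k' a \<bullet>\<^bsub>B\<^esub> component u a = component k a"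
      using uv(3) Fun_component(1)[OF assms(2)] by metis
    show "component k a \<bullet>\<^bsub>B\<^esub> component v a = component k' a"
      using uv(4) Fun_component(1)[OF assms(2)] by metis
    have "component v a \<bullet>\<^bsub>B\<^esub> component u a = Idn B (omap (source k) a)"
      using uv(5) Fun_component[OF assms(2)] by metis
    then show "component v a \<bullet>\<^bsub>B\<^esub> component u a = Idn B (Dom B (component k a))"
      using kD(2) assms(2) by simp
  qed (use uv(1,2) kD(2) Fun.is_kernelD(2)[OF k'(1)] assms(2) in simp_all)
qed

lemma cokernel_Fun_component:
  assumes "is_cokernel (Fun A B) t k" "a \<in> Obj A"
  shows "is_cokernel B (component t a) (component k a)"
proof -
  note kD = Fun.is_cokernelD[OF assms(1)]
  have t: "nat_trans A B t" using kD by simp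
  obtain k' where k': "is_cokernel (Fun A B) t k'" "is_cokernel B (component t a) (component k' a)"
    using pointwise_cokernel[OF t] assms(2) by metis
  have "is_kernel (op_cat (Fun A B)) t k" "is_kernel (op_cat (Fun A B)) t k'"
    using assms(1) k'(1) by (simp_all add: is_kernel_op)
  then obtain u v where uv: "u \<in> Hom (Fun A B) (target k') (target k)" "v \<in> Hom (Fun A B) (target k) (target k')"
    "u \<bullet>\<^bsub>Fun A B\<^esub> k' = k" "v \<bullet>\<^bsub>Fun A B\<^esub> k = k'" "u \<bullet>\<^bsub>Fun A B\<^esub> v = Idn (Fun A B) (target k)"
    by (rule zero_cat.kernel_iso[OF Fun.op_zero_cat]) auto
  have "is_kernel (op_cat B) (component t a) (component k a)"
  proof (rule zero_cat.kernel_transport[OF B.op_zero_cat])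
    show "is_kernel (op_cat B) (component t a) (component k' a)"
      using k'(2) by (simp add: is_kernel_op)
    show "component k' a \<bullet>\<^bsub>op_cat B\<^esub> component u a = component k a"
      using uv(3) Fun_component(1)[OF assms(2)] by (metis op_cat_simps(6))
    show "component k a \<bullet>\<^bsub>op_cat B\<^esub> component v a = component k' a"
      using uv(4) Fun_component(1)[OF assms(2)] by (metis op_cat_simps(6))
    have "component u a \<bullet>\<^bsub>B\<^esub> component v a = Idn B (omap (target k) a)"
      using uv(5) Fun_component[OF assms(2)] by metis
    then show "component v a \<bullet>\<^bsub>op_cat B\<^esub> component u a = Idn (op_cat B) (Dom (op_cat B) (component k a))"
      using kD(2) assms(2) by simp
  qed (use uv(1,2) kD(2) Fun.is_cokernelD(2)[OF k'(1)] assms(2) in simp_all)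
  then show ?thesis by (simp add: is_kernel_op)
qed

lemma factors_Fun_iff:
  assumes "nat_trans A B s" "mono_arr (Fun A B) t" "target s = target t"
  shows "factors_through (Fun A B) s t \<longleftrightarrow>
    (\<forall>a\<in>Obj A. factors_through B (component s a) (component t a))"
proof
  have t: "nat_trans A B t" "\<And>a. a \<in> Obj A \<Longrightarrow> mono_arr B (component t a)"
    using assms(2) mono_Fun_iff by auto
  show "factors_through (Fun A B) s t" if "\<forall>a\<in>Obj A. factors_through B (component s a) (component t a)"
    using nt_lift[OF t(1) assms(1,3) t(2)] that by blast
  assume "factors_through (Fun A B) s t"
  then obtain u where u: "nat_trans A B u" "target u = source t" "t \<bullet>\<^bsub>Fun A B\<^esub> u = s"
    by (rule Fun.factors_throughE) simp
  have "factors_through B (component s a) (component t a)" if a: "a \<in> Obj A" for a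
  proof (rule B.factors_throughI)
    show "component t a \<bullet>\<^bsub>B\<^esub> component u a = component s a"
      using u(3) Fun_component(1)[OF a] by metis
  qed (use u t a in simp_all)
  then show "\<forall>a\<in>Obj A. factors_through B (component s a) (component t a)" by blast
qed

end

section \<open>Composition with functors\<close>

lemma fcomp_simps [simp]:
  "a \<in> Obj A \<Longrightarrow> omap (fcomp A G F) a = omap G (omap F a)"
  "f \<in> Arr A \<Longrightarrow> amap (fcomp A G F) f = amap G (amap F f)"
  by (simp_all add: fcomp_def)

lemma fid_simps [simp]:
  "a \<in> Obj A \<Longrightarrow> omap (fid A) a = a" "f \<in> Arr A \<Longrightarrow> amap (fid A) f = f"
  by (simp_all add: fid_def)

lemma whisk_left_simps [simp]:
  "source (whisk_left A F t) = fcomp A F (source t)" "target (whisk_left A F t) = fcomp A F (target t)"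
  "a \<in> Obj A \<Longrightarrow> component (whisk_left A F t) a = amap F (component t a)"
  by (simp_all add: whisk_left_def)

lemma whisk_right_simps [simp]:
  "source (whisk_right A t F) = fcomp A (source t) F" "target (whisk_right A t F) = fcomp A (target t) F"
  "a \<in> Obj A \<Longrightarrow> component (whisk_right A t F) a = component t (omap F a)"
  by (simp_all add: whisk_right_def)

text \<open>An honest equality of records, owing to extensionality. It makes the target of
  \<open>tS\<close> equal to \<open>S\<close> itself, so that composites such as the one
  representing a product are well formed.\<close>

lemma fcomp_fid:
  assumes "is_functor A B F"
  shows "fcomp A (fid B) F = F"
proof -
  have F: "omap F \<in> Obj A \<rightarrow>\<^sub>E Obj B" "amap F \<in> extensional (Arr A)" "\<And>f. f \<in> Arr A \<Longrightarrow> amap F f \<in> Arr B"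
    using assms by (auto simp: is_functor_def)
  have "omap (fcomp A (fid B) F) = omap F"
    by (rule extensionalityI[of _ "Obj A"]) (use F(1) in \<open>auto simp: fcomp_def fid_def PiE_def\<close>)
  moreover have "amap (fcomp A (fid B) F) = amap F"
    by (rule extensionalityI[of _ "Arr A"]) (use F(2,3) in \<open>auto simp: fcomp_def fid_def\<close>)
  ultimately show ?thesis by simp
qed

lemma is_functor_fcomp:
  assumes "cat A" "cat B" "is_functor A B F" "is_functor B C G"
  shows "is_functor A C (fcomp A G F)"
proof -
  interpret A: cat A by fact
  interpret B: cat B by fact
  have F: "\<And>a. a \<in> Obj A \<Longrightarrow> omap F a \<in> Obj B"
    "\<And>f. f \<in> Arr A \<Longrightarrow> amap F f \<in> Hom B (omap F (Dom A f)) (omap F (Cod A f))"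
    "\<And>a. a \<in> Obj A \<Longrightarrow> amap F (Idn A a) = Idn B (omap F a)"
    "\<And>f g. f \<in> Arr A \<Longrightarrow> g \<in> Arr A \<Longrightarrow> Dom A g = Cod A f \<Longrightarrow> amap F (g \<bullet>\<^bsub>A\<^esub> f) = amap F g \<bullet>\<^bsub>B\<^esub> amap F f"
    using assms(3) by (auto simp: is_functor_def)
  have G: "\<And>a. a \<in> Obj B \<Longrightarrow> omap G a \<in> Obj C"
    "\<And>f. f \<in> Arr B \<Longrightarrow> amap G f \<in> Hom C (omap G (Dom B f)) (omap G (Cod B f))"
    "\<And>a. a \<in> Obj B \<Longrightarrow> amap G (Idn B a) = Idn C (omap G a)"
    "\<And>f g. f \<in> Arr B \<Longrightarrow> g \<in> Arr B \<Longrightarrow> Dom B g = Cod B f \<Longrightarrow> amap G (g \<bullet>\<^bsub>B\<^esub> f) = amap G g \<bullet>\<^bsub>C\<^esub> amap G f"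
    using assms(4) by (auto simp: is_functor_def)
  have "omap (fcomp A G F) \<in> Obj A \<rightarrow>\<^sub>E Obj C" "amap (fcomp A G F) \<in> extensional (Arr A)"
    using F(1) G(1) by (auto simp: fcomp_def)
  moreover have "amap (fcomp A G F) f \<in> Hom C (omap (fcomp A G F) (Dom A f)) (omap (fcomp A G F) (Cod A f))"
    if "f \<in> Arr A" for f
    using F(2)[OF that] G(2)[of "amap F f"] that by simp
  moreover have "amap (fcomp A G F) (Idn A a) = Idn C (omap (fcomp A G F) a)" if "a \<in> Obj A" for a
    using F(1,3)[OF that] G(3) that by simp
  moreover have "amap (fcomp A G F) (g \<bullet>\<^bsub>A\<^esub> f) = amap (fcomp A G F) g \<bullet>\<^bsub>C\<^esub> amap (fcomp A G F) f"
    if "f \<in> Arr A" "g \<in> Arr A" "Dom A g = Cod A f" for f g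
    using F(2)[OF that(1)] F(2)[OF that(2)] F(4)[OF that] G(4) that by simp
  ultimately show ?thesis
    unfolding is_functor_def by blast
qed

lemma nat_trans_whisk_right:
  assumes "cat A" "cat B" "is_functor A B F" "nat_trans B C t"
  shows "nat_trans A C (whisk_right A t F)"
proof -
  interpret A: cat A by fact
  have F: "\<And>a. a \<in> Obj A \<Longrightarrow> omap F a \<in> Obj B"
    "\<And>f. f \<in> Arr A \<Longrightarrow> amap F f \<in> Hom B (omap F (Dom A f)) (omap F (Cod A f))"
    using assms(3) by (auto simp: is_functor_def)
  have t: "is_functor B C (source t)" "is_functor B C (target t)"
    "\<And>a. a \<in> Obj B \<Longrightarrow> component t a \<in> Hom C (omap (source t) a) (omap (target t) a)"
    "\<And>f. f \<in> Arr B \<Longrightarrow> component t (Cod B f) \<bullet>\<^bsub>C\<^esub> amap (source t) f = amap (target t) f \<bullet>\<^bsub>C\<^esub> component t (Dom B f)"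
    using assms(4) unfolding nat_trans_def by blast+
  have "component (whisk_right A t F) (Cod A f) \<bullet>\<^bsub>C\<^esub> amap (fcomp A (source t) F) f =
      amap (fcomp A (target t) F) f \<bullet>\<^bsub>C\<^esub> component (whisk_right A t F) (Dom A f)" if "f \<in> Arr A" for f
    using F(2)[OF that] t(4)[of "amap F f"] that by simp
  moreover have "component (whisk_right A t F) \<in> extensional (Obj A)"
    by (simp add: whisk_right_def)
  ultimately show ?thesis
    using F(1) t(3) is_functor_fcomp[OF assms(1-3) t(1)] is_functor_fcomp[OF assms(1-3) t(2)]
    unfolding nat_trans_def by simp
qed

lemma nat_trans_whisk_left:
  assumes "cat A" "cat B" "nat_trans A B t" "is_functor B C F"
  shows "nat_trans A C (whisk_left A F t)"
proof -
  interpret A: cat A by fact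
  interpret B: cat B by fact
  interpret AB: functor_cats A B ..
  have F: "\<And>a. a \<in> Obj B \<Longrightarrow> omap F a \<in> Obj C"
    "\<And>f. f \<in> Arr B \<Longrightarrow> amap F f \<in> Hom C (omap F (Dom B f)) (omap F (Cod B f))"
    "\<And>f g. f \<in> Arr B \<Longrightarrow> g \<in> Arr B \<Longrightarrow> Dom B g = Cod B f \<Longrightarrow> amap F (g \<bullet>\<^bsub>B\<^esub> f) = amap F g \<bullet>\<^bsub>C\<^esub> amap F f"
    using assms(4) by (auto simp: is_functor_def)
  have "component (whisk_left A F t) (Cod A f) \<bullet>\<^bsub>C\<^esub> amap (fcomp A F (source t)) f =
      amap (fcomp A F (target t)) f \<bullet>\<^bsub>C\<^esub> component (whisk_left A F t) (Dom A f)" if f: "f \<in> Arr A" for f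
  proof -
    have "amap F (component t (Cod A f)) \<bullet>\<^bsub>C\<^esub> amap F (amap (source t) f) =
        amap F (component t (Cod A f) \<bullet>\<^bsub>B\<^esub> amap (source t) f)"
      by (rule F(3)[symmetric]) (use assms(3) f in auto)
    also have "\<dots> = amap F (amap (target t) f) \<bullet>\<^bsub>C\<^esub> amap F (component t (Dom A f))"
      unfolding AB.nt_natural[OF assms(3) f] by (rule F(3)) (use assms(3) f in auto)
    finally show ?thesis using f by simp
  qed
  moreover have "component (whisk_left A F t) \<in> extensional (Obj A)"
    by (simp add: whisk_left_def)
  moreover have "amap F (component t a) \<in> Hom C (omap F (omap (source t) a)) (omap F (omap (target t) a))"
    if "a \<in> Obj A" for a
    using F(2)[OF AB.nt_arr[OF assms(3) that]] assms(3) that by simp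
  ultimately show ?thesis
    using is_functor_fcomp[OF assms(1,2) AB.nt_source[OF assms(3)] assms(4)]
      is_functor_fcomp[OF assms(1,2) AB.nt_target[OF assms(3)] assms(4)]
    unfolding nat_trans_def[of A C] by simp
qed

section \<open>Preradicals\<close>

text \<open>The form in which every operation on preradicals is evaluated: a choice exists, and all
  choices give the class \<open>Y\<close>.\<close>

lemma Union_eq_if_all_eq:
  assumes "\<X> \<noteq> {}" "\<And>X. X \<in> \<X> \<Longrightarrow> X = Y"
  shows "\<Union>\<X> = Y"
  using assms by blast

locale endofunctors = A: abelian A for A :: "('a, 'm) cat"
begin

sublocale functor_abelian A A ..

section \<open>Representatives of preradicals\<close>

definition prerad :: "('a, 'm, 'a, 'm) nt \<Rightarrow> bool" where
  "prerad t \<longleftrightarrow> mono_arr (Fun A A) t \<and> target t = fid A"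

lemma pr_mono_Fun: "prerad t \<Longrightarrow> mono_arr (Fun A A) t"
  unfolding prerad_def by blast

lemma prerad_iff:
  "prerad t \<longleftrightarrow> nat_trans A A t \<and> target t = fid A \<and> (\<forall>a\<in>Obj A. mono_arr A (component t a))"
  unfolding prerad_def mono_Fun_iff by blast

lemma preradI:
  "nat_trans A A t \<Longrightarrow> target t = fid A \<Longrightarrow> (\<And>a. a \<in> Obj A \<Longrightarrow> mono_arr A (component t a)) \<Longrightarrow> prerad t"
  unfolding prerad_iff by blast

lemma pr_nt [simp]: "prerad t \<Longrightarrow> nat_trans A A t"
  and pr_target [simp]: "prerad t \<Longrightarrow> target t = fid A"
  and pr_mono: "prerad t \<Longrightarrow> a \<in> Obj A \<Longrightarrow> mono_arr A (component t a)"
  and pr_obj [simp]: "prerad t \<Longrightarrow> a \<in> Obj A \<Longrightarrow> omap (source t) a \<in> Obj A"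
  and pr_source [simp]: "prerad t \<Longrightarrow> is_functor A A (source t)"
  unfolding prerad_iff by auto

lemma pr_natural:
  "prerad t \<Longrightarrow> f \<in> Arr A \<Longrightarrow>
    component t (Cod A f) \<bullet>\<^bsub>A\<^esub> amap (source t) f = f \<bullet>\<^bsub>A\<^esub> component t (Dom A f)"
  using nt_natural[of t f] by simp

text \<open>Change of representative becomes a condition at each object, after which the functor
  category can be left.\<close>

lemma mem_class_iff:
  assumes "prerad t"
  shows "s \<in> subobj_class (Fun A A) t \<longleftrightarrow> prerad s \<and>
    (\<forall>a\<in>Obj A. factors_through A (component t a) (component s a)) \<and>
    (\<forall>a\<in>Obj A. factors_through A (component s a) (component t a))"
proof -
  have "s \<in> subobj_class (Fun A A) t \<longleftrightarrow>
      prerad s \<and> factors_through (Fun A A) t s \<and> factors_through (Fun A A) s t"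
    using assms unfolding subobj_class_def prerad_def Fun_simps by auto
  moreover have "factors_through (Fun A A) t s \<longleftrightarrow>
      (\<forall>a\<in>Obj A. factors_through A (component t a) (component s a))"
    "factors_through (Fun A A) s t \<longleftrightarrow>
      (\<forall>a\<in>Obj A. factors_through A (component s a) (component t a))" if "prerad s"
    using factors_Fun_iff[of t s] factors_Fun_iff[of s t] that assms
    by (simp_all add: pr_mono_Fun)
  ultimately show ?thesis by blast
qed

lemma class_eq:
  assumes "prerad t" "s \<in> subobj_class (Fun A A) t"
  shows "subobj_class (Fun A A) s = subobj_class (Fun A A) t"
  by (rule Fun.subobj_class_eq[OF assms(2)]) (use assms(1) in simp)

lemma class_self: "prerad t \<Longrightarrow> t \<in> subobj_class (Fun A A) t"
  by (rule Fun.subobj_class_self) (rule pr_mono_Fun)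

lemma class_in_Pr: "prerad t \<Longrightarrow> subobj_class (Fun A A) t \<in> Pr A"
  unfolding Pr_def Sub_def prerad_def Fun_simps by blast

lemma PrE:
  assumes "\<tau> \<in> Pr A"
  obtains t where "prerad t" "\<tau> = subobj_class (Fun A A) t"
  using assms unfolding Pr_def Sub_def prerad_def Fun_simps by blast

lemma whisk_right_nt: "nat_trans A A t \<Longrightarrow> is_functor A A S \<Longrightarrow> nat_trans A A (whisk_right A t S)"
  by (rule nat_trans_whisk_right) (unfold_locales)

lemma prod_prerad:
  assumes "prerad t" "prerad s"
  shows "prerad (s \<bullet>\<^bsub>Fun A A\<^esub> whisk_right A t (source s))"
proof -
  have "nat_trans A A (s \<bullet>\<^bsub>Fun A A\<^esub> whisk_right A t (source s))"
    by (rule nt_comp) (use assms whisk_right_nt[of t "source s"] fcomp_fid[of A A "source s"] in auto)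
  moreover have "mono_arr A (component s a \<bullet>\<^bsub>A\<^esub> component t (omap (source s) a))" if "a \<in> Obj A" for a
    by (rule A.mono_comp) (use assms that pr_mono in auto)
  ultimately show ?thesis
    using assms by (intro preradI) simp_all
qed

section \<open>Idempotent preradicals and radicals in terms of representatives\<close>

text \<open>The product formed with \<open>t\<close> in both places is a member of the union, hence
  equivalent to \<open>t\<close>; only the nontrivial inequality between \<open>\<tau>\<close> and
  \<open>\<tau>\<cdot>\<tau>\<close> is kept.\<close>

lemma idempotent_split:
  assumes t: "prerad t" and id: "idempotent_prerad A (subobj_class (Fun A A) t)" and a: "a \<in> Obj A"
  shows "factors_through A (component t a) (component t a \<bullet>\<^bsub>A\<^esub> component t (omap (source t) a))"
proof -
  let ?p = "t \<bullet>\<^bsub>Fun A A\<^esub> whisk_right A t (source t)"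
  have "subobj_class (Fun A A) ?p \<subseteq> prerad_prod A (subobj_class (Fun A A) t) (subobj_class (Fun A A) t)"
    unfolding prerad_prod_def using class_self[OF t] by blast
  then have "?p \<in> subobj_class (Fun A A) t"
    using class_self[OF prod_prerad[OF t t]] id unfolding idempotent_prerad_def by auto
  then show ?thesis
    using mem_class_iff[OF t] a by simp
qed

text \<open>The product always factors through its left factor \<open>s\<close>, so only the
  opposite factorization is assumed. It is demanded for all pairs of representatives because the
  product ranges over them.\<close>

lemma idempotentI:
  assumes m: "prerad m"
    and fac: "\<And>t s a. t \<in> subobj_class (Fun A A) m \<Longrightarrow> s \<in> subobj_class (Fun A A) m \<Longrightarrow> a \<in> Obj A \<Longrightarrow>
      factors_through A (component m a) (component s a \<bullet>\<^bsub>A\<^esub> component t (omap (source s) a))"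
  shows "idempotent_prerad A (subobj_class (Fun A A) m)"
proof -
  let ?M = "subobj_class (Fun A A) m"
  have "prerad_prod A ?M ?M = ?M"
    unfolding prerad_prod_def
  proof (rule Union_eq_if_all_eq)
    fix X assume "X \<in> {subobj_class (Fun A A) (s \<bullet>\<^bsub>Fun A A\<^esub> whisk_right A t (source s)) | t s. t \<in> ?M \<and> s \<in> ?M}"
    then obtain t s where X: "X = subobj_class (Fun A A) (s \<bullet>\<^bsub>Fun A A\<^esub> whisk_right A t (source s))"
      and ts: "t \<in> ?M" "s \<in> ?M" by blast
    have pr: "prerad t" "prerad s"
      using ts mem_class_iff[OF m] by auto
    have "factors_through A (component s a \<bullet>\<^bsub>A\<^esub> component t (omap (source s) a)) (component m a)" if a: "a \<in> Obj A" for a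
      by (rule A.factors_precomp) (use a pr m ts(2) mem_class_iff[OF m] in auto)
    then have "(s \<bullet>\<^bsub>Fun A A\<^esub> whisk_right A t (source s)) \<in> ?M"
      using mem_class_iff[OF m] prod_prerad[OF pr] fac[OF ts] by simp
    then show "X = ?M"
      unfolding X by (rule class_eq[OF m])
  qed (use class_self[OF m] in blast)
  then show ?thesis
    using class_in_Pr[OF m] by (simp add: idempotent_prerad_def)
qed

text \<open>The pullback \<open>p\<close> witnessing the radical property exists in \<open>Fun A A\<close> because the union defining
  the coproduct is nonempty; comparing it with the kernel \<open>k\<close> of \<open>d \<circ> c\<close>, where \<open>d\<close> is the cokernel of \<open>t S\<^sup>*\<close>,
  shows that \<open>c\<close> factors through \<open>d \<circ> c\<close>, so that \<open>d\<close> is split mono.\<close>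

lemma radical_annihilates_cokernel:
  assumes s0: "prerad s0" and rad: "radical A (subobj_class (Fun A A) s0)"
  obtains t s c where "t \<in> subobj_class (Fun A A) s0" "s \<in> subobj_class (Fun A A) s0"
    "is_cokernel (Fun A A) s c" "\<And>a. a \<in> Obj A \<Longrightarrow> zero_arr A (component t (omap (target c) a))"
proof -
  let ?S = "subobj_class (Fun A A) s0"
  have "s0 \<in> prerad_coprod A ?S ?S"
    using rad class_self[OF s0] unfolding radical_def by simp
  then obtain p q t s c where p: "s0 \<in> subobj_class (Fun A A) p" and ts: "t \<in> ?S" "s \<in> ?S"
    and c: "is_cokernel (Fun A A) s c" and pb: "is_pullback (Fun A A) c (whisk_right A t (target c)) p q"
    unfolding prerad_coprod_def by blast
  note cD = Fun.is_cokernelD[OF c]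
  let ?t = "whisk_right A t (target c)"
  have pr: "prerad t" "prerad s"
    using ts mem_class_iff[OF s0] by auto
  have c': "nat_trans A A c" "source c = fid A"
    using cD pr by auto
  have Q: "is_functor A A (target c)" using c' by simp
  have t': "nat_trans A A ?t" "target ?t = target c"
    using whisk_right_nt[OF _ Q] pr(1) fcomp_fid[OF Q] by auto
  have t'm: "mono_arr A (component ?t a)" if "a \<in> Obj A" for a
    using that pr_mono[OF pr(1)] Q by simp
  obtain d where d: "is_cokernel (Fun A A) ?t d" "\<And>a. a \<in> Obj A \<Longrightarrow> is_cokernel A (component ?t a) (component d a)"
    using pointwise_cokernel[OF t'(1)] by metis
  have d': "nat_trans A A d" "source d = target c"
    using Fun.is_cokernelD[OF d(1)] t' by auto
  have dc: "nat_trans A A (d \<bullet>\<^bsub>Fun A A\<^esub> c)"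
    using nt_comp[OF c'(1) d'(1)] d' by simp
  obtain k where k: "is_kernel (Fun A A) (d \<bullet>\<^bsub>Fun A A\<^esub> c) k"
    "\<And>a. a \<in> Obj A \<Longrightarrow> is_kernel A (component (d \<bullet>\<^bsub>Fun A A\<^esub> c) a) (component k a)"
    using pointwise_kernel[OF dc] by metis
  have k': "nat_trans A A k" "target k = fid A"
    using Fun.is_kernelD[OF k(1)] c' by auto
  have ck: "nat_trans A A (c \<bullet>\<^bsub>Fun A A\<^esub> k)"
    using nt_comp[OF k'(1) c'(1)] c' k' by simp
  \<comment> \<open>\<open>d\<close> annihilates the composite of \<open>c\<close> and
    \<open>k\<close>, and \<open>t S\<^sup>*\<close> is a kernel of \<open>d\<close> at each object.
    The resulting \<open>y\<close> completes \<open>k\<close> to a cone over the pullback.\<close>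
  have "factors_through (Fun A A) (c \<bullet>\<^bsub>Fun A A\<^esub> k) ?t"
  proof (rule nt_lift[OF t'(1) ck _ t'm])
    fix a assume a: "a \<in> Obj A"
    show "factors_through A (component (c \<bullet>\<^bsub>Fun A A\<^esub> k) a) (component ?t a)"
    proof (rule A.factors_mono_if_cokernel_zero[OF t'm[OF a] d(2)[OF a]])
      have "zero_arr A ((component d a \<bullet>\<^bsub>A\<^esub> component c a) \<bullet>\<^bsub>A\<^esub> component k a)"
        using A.is_kernelD(4)[OF k(2)[OF a]] a by simp
      then show "zero_arr A (component d a \<bullet>\<^bsub>A\<^esub> component (c \<bullet>\<^bsub>Fun A A\<^esub> k) a)"
        using a c' d' k' by (simp add: A.comp_assoc)
    qed (use a ck t' in \<open>simp_all del: Fun_component whisk_right_simps(3)\<close>)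
  qed (use t' in simp_all)
  then obtain y where y: "nat_trans A A y" "source y = source k" "target y = source ?t"
    "?t \<bullet>\<^bsub>Fun A A\<^esub> y = c \<bullet>\<^bsub>Fun A A\<^esub> k"
    by (rule Fun.factors_throughE) simp
  have "\<exists>x. x \<in> Hom (Fun A A) (source k) (source p) \<and> p \<bullet>\<^bsub>Fun A A\<^esub> x = k"
    using pb k' y c' unfolding is_pullback_def
    by (metis Fun_simps(2,3,4) mem_Collect_eq)
  moreover have "p \<in> Arr (Fun A A)"
    using pb unfolding is_pullback_def by blast
  ultimately have "factors_through (Fun A A) k p"
    by (auto intro: Fun.factors_throughI)
  moreover have "factors_through (Fun A A) p s0" "factors_through (Fun A A) s0 s"
    using p ts(2) by (simp_all add: subobj_class_def)
  \<comment> \<open>The pullback \<open>p\<close> is equivalent to \<open>s0\<close>, hence to the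
    very \<open>s\<close> whose cokernel is \<open>c\<close>. Therefore \<open>c\<close> annihilates
    \<open>k\<close>.\<close>
  ultimately have ks: "factors_through (Fun A A) k s"
    using Fun.factors_trans s0 pr(2) by (metis Fun_simps(2) mem_Collect_eq pr_nt)
  have "zero_arr A (component t (omap (target c) a))" if a: "a \<in> Obj A" for a
  proof -
    note ca = cokernel_Fun_component[OF c a] and da = d(2)[OF a]
    note caD = A.is_cokernelD[OF ca] and daD = A.is_cokernelD[OF da]
    have "factors_through A (component k a) (component s a)"
      using ks factors_Fun_iff[of k s] k' pr(2) pr_mono_Fun[OF pr(2)] a by simp
    then obtain u where u: "u \<in> Arr A" "Cod A u = Dom A (component s a)" "component s a \<bullet>\<^bsub>A\<^esub> u = component k a"
      by (rule A.factors_throughE)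
    have "zero_arr A ((component c a \<bullet>\<^bsub>A\<^esub> component s a) \<bullet>\<^bsub>A\<^esub> u)"
      by (rule A.zero_comp_right[OF caD(4)]) (use u caD in auto)
    moreover have "(component c a \<bullet>\<^bsub>A\<^esub> component s a) \<bullet>\<^bsub>A\<^esub> u = component c a \<bullet>\<^bsub>A\<^esub> component k a"
      unfolding u(3)[symmetric] by (rule A.comp_assoc) (use u(1,2) caD in auto)
    ultimately have zck: "zero_arr A (component c a \<bullet>\<^bsub>A\<^esub> component k a)" by simp
    have ts: "Dom A (component d a) = Cod A (component c a)"
      using a c' d' by simp
    have ep: "epi_arr A (component d a \<bullet>\<^bsub>A\<^esub> component c a)"
      by (rule A.epi_comp[OF daD(5) caD(5) ts])
    have "is_kernel A (component d a \<bullet>\<^bsub>A\<^esub> component c a) (component k a)"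
      using k(2)[OF a] a by simp
    from A.epi_is_cokernel_of_kernel[OF ep this caD(2) _ zck] obtain x
      where x: "x \<in> Arr A" "Dom A x = Cod A (component d a)" "Cod A x = Cod A (component c a)"
        "x \<bullet>\<^bsub>A\<^esub> (component d a \<bullet>\<^bsub>A\<^esub> component c a) = component c a"
      using ts caD daD by auto
    have "(x \<bullet>\<^bsub>A\<^esub> component d a) \<bullet>\<^bsub>A\<^esub> component c a = Idn A (Cod A (component c a)) \<bullet>\<^bsub>A\<^esub> component c a"
      using x ts caD daD by (simp add: A.comp_assoc)
    then have xd: "x \<bullet>\<^bsub>A\<^esub> component d a = Idn A (Cod A (component c a))"
      by (rule A.epi_cancel[OF caD(5)]) (use x(1-3) ts caD daD in auto)
    have "zero_arr A (x \<bullet>\<^bsub>A\<^esub> (component d a \<bullet>\<^bsub>A\<^esub> component ?t a))"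
      by (rule A.zero_comp_left[OF daD(4)]) (use x(1-3) daD in auto)
    also have "x \<bullet>\<^bsub>A\<^esub> (component d a \<bullet>\<^bsub>A\<^esub> component ?t a) = (x \<bullet>\<^bsub>A\<^esub> component d a) \<bullet>\<^bsub>A\<^esub> component ?t a"
      by (rule A.comp_assoc[symmetric]) (use x(1-3) daD in auto)
    also have "\<dots> = component ?t a"
      unfolding xd by (rule A.id_comp) (use daD ts in auto)
    finally show ?thesis using a by simp
  qed
  with that[OF ts c] show ?thesis by blast
qed

text \<open>The assumption is the inequality between \<open>(\<kappa>:\<kappa>)\<close> and
  \<open>\<kappa>\<close>, for \<open>\<kappa>\<close> the class of \<open>k\<close>, tested on
  single arrows: \<open>h\<close> together with \<open>y\<close> is a cone over the pullback square
  at \<open>a\<close>. The opposite inequality comes from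
  \<open>zero_factors_pullback\<close>.\<close>

lemma radicalI:
  assumes k: "prerad k"
    and fac: "\<And>t s c a h y. t \<in> subobj_class (Fun A A) k \<Longrightarrow> s \<in> subobj_class (Fun A A) k \<Longrightarrow>
      is_cokernel (Fun A A) s c \<Longrightarrow> a \<in> Obj A \<Longrightarrow> h \<in> Arr A \<Longrightarrow> Cod A h = a \<Longrightarrow> y \<in> Arr A \<Longrightarrow>
      Dom A y = Dom A h \<Longrightarrow> Cod A y = Dom A (component t (omap (target c) a)) \<Longrightarrow>
      component c a \<bullet>\<^bsub>A\<^esub> h = component t (omap (target c) a) \<bullet>\<^bsub>A\<^esub> y \<Longrightarrow>
      factors_through A h (component k a)"
  shows "radical A (subobj_class (Fun A A) k)"
proof -
  let ?K = "subobj_class (Fun A A) k"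
  \<comment> \<open>Glues the objectwise test into a factorization of transformations, used both to
    exhibit one pullback and to bound an arbitrary one.\<close>
  have lift: "factors_through (Fun A A) h k"
    if ts: "t \<in> ?K" "s \<in> ?K" and c: "is_cokernel (Fun A A) s c"
      and h: "nat_trans A A h" "target h = fid A" and y: "nat_trans A A y" "source h = source y"
        "target y = fcomp A (source t) (target c)"
      and e: "c \<bullet>\<^bsub>Fun A A\<^esub> h = whisk_right A t (target c) \<bullet>\<^bsub>Fun A A\<^esub> y" for t s c h y
  proof (rule nt_lift)
    fix a assume a: "a \<in> Obj A"
    show "mono_arr A (component k a)" using k a by (rule pr_mono)
    have pr: "prerad t" using ts mem_class_iff[OF k] by auto
    have Q: "is_functor A A (target c)" using Fun.is_cokernelD[OF c] by auto
    have "component c a \<bullet>\<^bsub>A\<^esub> component h a = component t (omap (target c) a) \<bullet>\<^bsub>A\<^esub> component y a"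
      using arg_cong[OF e, of "\<lambda>t. component t a"] a by simp
    then show "factors_through A (component h a) (component k a)"
      by (intro fac[OF ts c a, of _ "component y a"]) (use a h y pr Q in simp_all)
  qed (use h k in simp_all)
  have "prerad_coprod A ?K ?K = ?K"
    unfolding prerad_coprod_def
  proof (rule Union_eq_if_all_eq)
    obtain c where c: "is_cokernel (Fun A A) k c"
      using pointwise_cokernel[of k] k by auto
    note cD = Fun.is_cokernelD[OF c]
    have Q: "is_functor A A (target c)" using cD by auto
    let ?t = "whisk_right A k (target c)"
    have t: "nat_trans A A ?t" "target ?t = target c"
      using whisk_right_nt[OF _ Q] k fcomp_fid[OF Q] by auto
    have tm: "mono_arr (Fun A A) ?t"
      by (rule mono_Fun_if_pointwise[OF t(1)]) (use pr_mono[OF k] Q in simp)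
    \<comment> \<open>The zero second leg with which \<open>k\<close> itself becomes a pullback, so
      that the family of choices is nonempty.\<close>
    obtain z where z: "z \<in> Hom (Fun A A) (source k) (source ?t)" "zero_arr (Fun A A) z"
      by (rule Fun.zero_exists[of "source k" "source ?t"]) (use k nt_source[OF t(1)] in auto)
    have "is_pullback (Fun A A) c ?t k z"
    proof (rule Fun.is_pullbackI_zero)
      fix h y assume "h \<in> Arr (Fun A A)" "y \<in> Arr (Fun A A)" "Dom (Fun A A) h = Dom (Fun A A) y"
        "Cod (Fun A A) h = Dom (Fun A A) c" "Cod (Fun A A) y = Dom (Fun A A) ?t"
        "c \<bullet>\<^bsub>Fun A A\<^esub> h = ?t \<bullet>\<^bsub>Fun A A\<^esub> y"
      then show "factors_through (Fun A A) h k"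
        using cD k by (intro lift[OF class_self[OF k] class_self[OF k] c, of h y]) simp_all
    qed (use cD tm z k t pr_mono_Fun[OF k] in simp_all)
    then show "{subobj_class (Fun A A) p | p q t s c. t \<in> ?K \<and> s \<in> ?K \<and> is_cokernel (Fun A A) s c \<and>
         is_pullback (Fun A A) c (whisk_right A t (target c)) p q} \<noteq> {}"
      using class_self[OF k] c by blast
  next
    fix X assume "X \<in> {subobj_class (Fun A A) p | p q t s c. t \<in> ?K \<and> s \<in> ?K \<and> is_cokernel (Fun A A) s c \<and>
         is_pullback (Fun A A) c (whisk_right A t (target c)) p q}"
    then obtain p q t s c where X: "X = subobj_class (Fun A A) p" and ts: "t \<in> ?K" "s \<in> ?K"
      and c: "is_cokernel (Fun A A) s c" and pb: "is_pullback (Fun A A) c (whisk_right A t (target c)) p q"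
      by blast
    note cD = Fun.is_cokernelD[OF c]
    have pr: "prerad t" "prerad s" using ts mem_class_iff[OF k] by auto
    have Q: "is_functor A A (target c)" using cD by auto
    have "mono_arr (Fun A A) (whisk_right A t (target c))"
      by (rule mono_Fun_if_pointwise[OF whisk_right_nt[OF _ Q]]) (use pr pr_mono Q in simp_all)
    then have pm: "mono_arr (Fun A A) p"
      by (rule Fun.pullback_mono[OF pb])
    have pbD: "p \<in> Arr (Fun A A)" "q \<in> Arr (Fun A A)" "target p = source c" "source p = source q"
      "target q = source (whisk_right A t (target c))" "c \<bullet>\<^bsub>Fun A A\<^esub> p = whisk_right A t (target c) \<bullet>\<^bsub>Fun A A\<^esub> q"
      using pb unfolding is_pullback_def Fun_simps(3,4) by blast+
    have tp: "target p = fid A" using pbD(3) cD pr by simp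
    have "factors_through (Fun A A) p k"
      by (rule lift[OF ts c, of p q]) (use pbD tp in simp_all)
    moreover have "factors_through (Fun A A) s p"
      by (rule Fun.zero_factors_pullback[OF pb]) (use cD in simp_all)
    then have "factors_through (Fun A A) k p"
      using ts(2) pbD(1) by (auto simp: subobj_class_def intro: Fun.factors_trans)
    ultimately have "p \<in> ?K"
      using pm tp k by (simp add: subobj_class_def)
    then show "X = ?K"
      unfolding X by (rule class_eq[OF k])
  qed
  then show ?thesis
    using class_in_Pr[OF k] by (simp add: radical_def)
qed

end

section \<open>Preradicals and adjunctions\<close>

locale adjunction = A: abelian A + B: abelian B
  for A :: "('a, 'm) cat" and B :: "('b, 'n) cat" +
  fixes F :: "('a, 'm, 'b, 'n) func" and G :: "('b, 'n, 'a, 'm) func"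
    and \<eta> :: "('a, 'm, 'a, 'm) nt" and \<epsilon> :: "('b, 'n, 'b, 'n) nt"
  assumes adj: "adjoint_pair A B F G \<eta> \<epsilon>"
begin

sublocale AA: endofunctors A ..
sublocale BB: endofunctors B ..
sublocale AB: functor_abelian A B ..
sublocale BA: functor_abelian B A ..

lemma F [simp]: "is_functor A B F" and G [simp]: "is_functor B A G"
  and eta [simp]: "nat_trans A A \<eta>" "source \<eta> = fid A" "target \<eta> = fcomp A G F"
  and eps [simp]: "nat_trans B B \<epsilon>" "source \<epsilon> = fcomp B F G" "target \<epsilon> = fid B"
  using adj by (auto simp: adjoint_pair_def)

lemma triangle_F: "a \<in> Obj A \<Longrightarrow> component \<epsilon> (omap F a) \<bullet>\<^bsub>B\<^esub> amap F (component \<eta> a) = Idn B (omap F a)"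
proof -
  assume a: "a \<in> Obj A"
  have "whisk_right A \<epsilon> F \<bullet>\<^bsub>Fun A B\<^esub> whisk_left A F \<eta> = Idn (Fun A B) F"
    using adj by (simp add: adjoint_pair_def)
  from arg_cong[OF this, of "\<lambda>t. component t a"] show ?thesis
    using a by simp
qed

lemma triangle_G: "b \<in> Obj B \<Longrightarrow> amap G (component \<epsilon> b) \<bullet>\<^bsub>A\<^esub> component \<eta> (omap G b) = Idn A (omap G b)"
proof -
  assume b: "b \<in> Obj B"
  have "whisk_left B G \<epsilon> \<bullet>\<^bsub>Fun B A\<^esub> whisk_right B \<eta> G = Idn (Fun B A) G"
    using adj by (simp add: adjoint_pair_def)
  from arg_cong[OF this, of "\<lambda>t. component t b"] show ?thesis
    using b by simp
qed

lemma eta_natural: "f \<in> Arr A \<Longrightarrow>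
    component \<eta> (Cod A f) \<bullet>\<^bsub>A\<^esub> f = amap G (amap F f) \<bullet>\<^bsub>A\<^esub> component \<eta> (Dom A f)"
  using AA.nt_natural[OF eta(1)] by simp

lemma eps_natural: "f \<in> Arr B \<Longrightarrow>
    component \<epsilon> (Cod B f) \<bullet>\<^bsub>B\<^esub> amap F (amap G f) = f \<bullet>\<^bsub>B\<^esub> component \<epsilon> (Dom B f)"
  using BB.nt_natural[OF eps(1)] by simp

section \<open>Transposition across the adjunction\<close>

text \<open>The adjoint transpose of an arrow from \<open>a\<close> to \<open>G b\<close>. The
  object \<open>b\<close> is an argument because it cannot be recovered from \<open>G b\<close>;
  likewise \<open>flat\<close> takes \<open>a\<close>.\<close>

definition sharp :: "'b \<Rightarrow> 'm \<Rightarrow> 'n" where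
  "sharp b g = component \<epsilon> b \<bullet>\<^bsub>B\<^esub> amap F g"

definition flat :: "'a \<Rightarrow> 'n \<Rightarrow> 'm" where
  "flat a f = amap G f \<bullet>\<^bsub>A\<^esub> component \<eta> a"

lemma sharp_arr [simp]:
  assumes "g \<in> Arr A" "Cod A g = omap G b" "b \<in> Obj B"
  shows "sharp b g \<in> Arr B" "Dom B (sharp b g) = omap F (Dom A g)" "Cod B (sharp b g) = b"
  using assms by (simp_all add: sharp_def)

lemma flat_arr [simp]:
  assumes "f \<in> Arr B" "Dom B f = omap F a" "a \<in> Obj A"
  shows "flat a f \<in> Arr A" "Dom A (flat a f) = a" "Cod A (flat a f) = omap G (Cod B f)"
  using assms by (simp_all add: flat_def)

lemma sharp_comp:
  assumes "g \<in> Arr A" "Cod A g = omap G b" "b \<in> Obj B" "h \<in> Arr A" "Cod A h = Dom A g"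
  shows "sharp b (g \<bullet>\<^bsub>A\<^esub> h) = sharp b g \<bullet>\<^bsub>B\<^esub> amap F h"
  using assms by (simp add: sharp_def AB.functor_comp B.comp_assoc)

lemma sharp_postcomp:
  assumes "g \<in> Arr A" "Cod A g = omap G (Dom B f)" "f \<in> Arr B"
  shows "sharp (Cod B f) (amap G f \<bullet>\<^bsub>A\<^esub> g) = f \<bullet>\<^bsub>B\<^esub> sharp (Dom B f) g"
proof -
  have "sharp (Cod B f) (amap G f \<bullet>\<^bsub>A\<^esub> g) = (component \<epsilon> (Cod B f) \<bullet>\<^bsub>B\<^esub> amap F (amap G f)) \<bullet>\<^bsub>B\<^esub> amap F g"
    using assms by (simp add: sharp_def AB.functor_comp B.comp_assoc)
  also have "\<dots> = f \<bullet>\<^bsub>B\<^esub> sharp (Dom B f) g"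
    unfolding eps_natural[OF assms(3)] sharp_def by (rule B.comp_assoc) (use assms in simp_all)
  finally show ?thesis .
qed

lemma flat_sharp:
  assumes "g \<in> Arr A" "Cod A g = omap G b" "b \<in> Obj B"
  shows "flat (Dom A g) (sharp b g) = g"
proof -
  have "flat (Dom A g) (sharp b g) = amap G (component \<epsilon> b) \<bullet>\<^bsub>A\<^esub> (amap G (amap F g) \<bullet>\<^bsub>A\<^esub> component \<eta> (Dom A g))"
    using assms by (simp add: sharp_def flat_def BA.functor_comp A.comp_assoc)
  also have "\<dots> = (amap G (component \<epsilon> b) \<bullet>\<^bsub>A\<^esub> component \<eta> (omap G b)) \<bullet>\<^bsub>A\<^esub> g"
    unfolding eta_natural[OF assms(1), symmetric] assms(2)
    by (rule A.comp_assoc[symmetric]) (use assms in simp_all)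
  also have "\<dots> = g"
    using assms by (simp add: triangle_G)
  finally show ?thesis .
qed

lemma sharp_flat:
  assumes "f \<in> Arr B" "Dom B f = omap F a" "a \<in> Obj A"
  shows "sharp (Cod B f) (flat a f) = f"
proof -
  have "sharp (Cod B f) (flat a f) = f \<bullet>\<^bsub>B\<^esub> sharp (Dom B f) (component \<eta> a)"
    unfolding flat_def by (rule sharp_postcomp) (use assms in simp_all)
  also have "\<dots> = f"
    using assms by (simp add: sharp_def triangle_F)
  finally show ?thesis .
qed

text \<open>No additivity of \<open>G\<close> is invoked. Arrows into \<open>G z\<close> correspond
  to arrows into the zero object \<open>z\<close>, so any two parallel ones coincide; in particular
  \<open>G p\<close> is a zero arrow.\<close>

lemma zero_right_adjoint:
  assumes "zero_arr B f"
  shows "zero_arr A (amap G f)"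
proof -
  obtain z p i where z: "zero_obj B z" "p \<in> Hom B (Dom B f) z" "i \<in> Hom B z (Cod B f)" "i \<bullet>\<^bsub>B\<^esub> p = f"
    using assms unfolding zero_arr_def by metis
  have zo: "z \<in> Obj B" using z(1) unfolding zero_obj_def by blast
  have eq: "x = y" if "x \<in> Hom A a (omap G z)" "y \<in> Hom A a (omap G z)" for x y a
  proof -
    have "omap F a \<in> Obj B"
      using that by auto
    then have "\<exists>!f. f \<in> Hom B (omap F a) z"
      using z(1) unfolding zero_obj_def by blast
    moreover have "sharp z x \<in> Hom B (omap F a) z" "sharp z y \<in> Hom B (omap F a) z"
      using that zo by simp_all
    ultimately have *: "sharp z x = sharp z y" by blast
    have "x = flat a (sharp z x)"
      using that(1) zo flat_sharp[of x z] by simp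
    also have "\<dots> = y"
      unfolding * using that(2) zo flat_sharp[of y z] by simp
    finally show ?thesis .
  qed
  have ob: "omap G (Dom B f) \<in> Obj A" "omap G z \<in> Obj A"
    using B.zero_arr_arrow[OF assms] zo by simp_all
  obtain w where w: "w \<in> Hom A (omap G (Dom B f)) (omap G z)" "zero_arr A w"
    by (rule A.zero_exists[OF ob])
  have "amap G p = w"
    by (rule eq[OF _ w(1)]) (use z(2) in simp)
  then have "zero_arr A (amap G p)"
    using w by simp
  then have "zero_arr A (amap G i \<bullet>\<^bsub>A\<^esub> amap G p)"
    by (rule A.zero_comp_left) (use z(2,3) in simp_all)
  then show ?thesis
    using z(2,3) BA.functor_comp[OF G, of p i] unfolding z(4)[symmetric] by simp
qed

text \<open>Transposing \<open>G m \<bullet> x = G m \<bullet> y\<close> gives an equation of arrows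
  after \<open>m\<close>, where \<open>m\<close> can be cancelled.\<close>

lemma mono_right_adjoint:
  assumes "mono_arr B m"
  shows "mono_arr A (amap G m)"
proof (rule A.mono_arrI)
  have m: "m \<in> Arr B" using assms by simp
  then show "amap G m \<in> Arr A" by simp
  fix x y assume xy: "x \<in> Arr A" "y \<in> Arr A" "Dom A x = Dom A y" "Cod A x = Dom A (amap G m)"
    "Cod A y = Dom A (amap G m)" "amap G m \<bullet>\<^bsub>A\<^esub> x = amap G m \<bullet>\<^bsub>A\<^esub> y"
  then have "m \<bullet>\<^bsub>B\<^esub> sharp (Dom B m) x = m \<bullet>\<^bsub>B\<^esub> sharp (Dom B m) y"
    using sharp_postcomp[of x m] sharp_postcomp[of y m] m by simp
  then have "sharp (Dom B m) x = sharp (Dom B m) y"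
    by (rule B.mono_cancel[OF assms]) (use xy(1-5) m in simp_all)
  moreover have "flat (Dom A x) (sharp (Dom B m) x) = x" "flat (Dom A y) (sharp (Dom B m) y) = y"
    by (rule flat_sharp; use xy(1-5) m in simp)+
  ultimately show "x = y"
    using xy(3) by metis
qed

text \<open>The arrow \<open>\<epsilon>\<^sub>b \<circ> F t\<^bsub>G b\<^esub>\<close> whose image is \<open>\<phi>(\<tau>)\<^sub>b\<close>.\<close>

abbreviation counit_arr :: "('a, 'm, 'a, 'm) nt \<Rightarrow> 'b \<Rightarrow> 'n" where
  "counit_arr t b \<equiv> sharp b (component t (omap G b))"

section \<open>The image construction \<open>\<phi>\<close> and idempotence\<close>

lemma counit_nt:
  assumes "AA.prerad t"
  defines "x \<equiv> \<epsilon> \<bullet>\<^bsub>Fun B B\<^esub> whisk_left B F (whisk_right B t G)"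
  shows "nat_trans B B x" "target x = fid B" "\<And>b. b \<in> Obj B \<Longrightarrow> component x b = counit_arr t b"
proof -
  have "nat_trans B A (whisk_right B t G)"
    by (rule nat_trans_whisk_right[OF B.cat_axioms A.cat_axioms G]) (use assms(1) in simp)
  then have "nat_trans B B (whisk_left B F (whisk_right B t G))"
    by (rule nat_trans_whisk_left[OF B.cat_axioms A.cat_axioms _ F])
  then show "nat_trans B B x"
    unfolding x_def using fcomp_fid[OF G] assms(1) by (intro BB.nt_comp) simp_all
qed (simp_all add: x_def sharp_def)

text \<open>An image is a kernel of a cokernel, and both are objectwise, so
  \<open>image_minimal\<close> applies at each \<open>b\<close>. Minimality thus holds against any
  subobject \<open>n\<close> of \<open>b\<close>, not only against components of
  preradicals.\<close>

lemma phi_representative: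
  assumes t: "AA.prerad t"
    and im: "is_image (Fun B B) (\<epsilon> \<bullet>\<^bsub>Fun B B\<^esub> whisk_left B F (whisk_right B t G)) m"
  shows "BB.prerad m"
    and "b \<in> Obj B \<Longrightarrow> factors_through B (counit_arr t b) (component m b)"
    and "b \<in> Obj B \<Longrightarrow> mono_arr B n \<Longrightarrow> Cod B n = b \<Longrightarrow> factors_through B (counit_arr t b) n \<Longrightarrow>
      factors_through B (component m b) n"
proof -
  let ?x = "\<epsilon> \<bullet>\<^bsub>Fun B B\<^esub> whisk_left B F (whisk_right B t G)"
  note x = counit_nt[OF t]
  obtain q where q: "is_cokernel (Fun B B) ?x q" "is_kernel (Fun B B) q m"
    using im unfolding is_image_def by blast
  note qD = BB.Fun.is_cokernelD[OF q(1)] and mD = BB.Fun.is_kernelD[OF q(2)]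
  show "BB.prerad m"
    unfolding BB.prerad_def using mD qD x(2) by simp
  assume b: "b \<in> Obj B"
  note qb = BB.cokernel_Fun_component[OF q(1) b] and mb = BB.kernel_Fun_component[OF q(2) b]
  show "factors_through B (counit_arr t b) (component m b)"
    using B.is_kernelE[OF mb, of "counit_arr t b"] B.is_cokernelD[OF qb] x(3)[OF b] by simp
  show "factors_through B (component m b) n" if "mono_arr B n" "Cod B n = b" "factors_through B (counit_arr t b) n"
    by (rule B.image_minimal[OF qb mb]) (use that b x t in \<open>simp_all del: Fun_component\<close>)
qed

lemma counit_arr_mono:
  assumes "AA.prerad t" "AA.prerad s" "b \<in> Obj B"
    "factors_through A (component s (omap G b)) (component t (omap G b))"
  shows "factors_through B (counit_arr s b) (counit_arr t b)"
proof -
  obtain u where u: "u \<in> Arr A" "Cod A u = Dom A (component t (omap G b))"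
    "component t (omap G b) \<bullet>\<^bsub>A\<^esub> u = component s (omap G b)"
    using assms(4) by (rule A.factors_throughE)
  have "counit_arr t b \<bullet>\<^bsub>B\<^esub> amap F u = counit_arr s b"
    unfolding u(3)[symmetric] by (rule sharp_comp[symmetric]) (use u(1,2) assms(1,3) in simp_all)
  then show ?thesis
    by (rule B.factors_throughI) (use u(1,2) assms(1,3) in simp_all)
qed

text \<open>For equivalent \<open>t\<close> and \<open>s\<close> the counit arrows factor through
  each other, and minimality makes any two images equivalent. The last two clauses determine the
  representative up to equivalence and are all that is used of it.\<close>

lemma phi_class:
  assumes t: "AA.prerad t"
  obtains m where "BB.prerad m" "adj_phi B F G \<epsilon> (subobj_class (Fun A A) t) = subobj_class (Fun B B) m"
    "\<And>b. b \<in> Obj B \<Longrightarrow> factors_through B (counit_arr t b) (component m b)"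
    "\<And>b n. b \<in> Obj B \<Longrightarrow> mono_arr B n \<Longrightarrow> Cod B n = b \<Longrightarrow> factors_through B (counit_arr t b) n \<Longrightarrow>
      factors_through B (component m b) n"
proof -
  let ?x = "\<lambda>t. \<epsilon> \<bullet>\<^bsub>Fun B B\<^esub> whisk_left B F (whisk_right B t G)"
  obtain q where q: "is_cokernel (Fun B B) (?x t) q"
    using BB.pointwise_cokernel[OF counit_nt(1)[OF t]] by metis
  obtain m where "is_kernel (Fun B B) q m"
    using BB.pointwise_kernel[of q] BB.Fun.is_cokernelD(2)[OF q] by auto
  with q have im: "is_image (Fun B B) (?x t) m"
    unfolding is_image_def by blast
  note m = phi_representative[OF t im]
  have "adj_phi B F G \<epsilon> (subobj_class (Fun A A) t) = subobj_class (Fun B B) m"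
    unfolding adj_phi_def
  proof (rule Union_eq_if_all_eq)
    show "{subobj_class (Fun B B) m | m s. s \<in> subobj_class (Fun A A) t \<and> is_image (Fun B B) (?x s) m} \<noteq> {}"
      using im AA.class_self[OF t] by blast
    fix X assume "X \<in> {subobj_class (Fun B B) m | m s. s \<in> subobj_class (Fun A A) t \<and> is_image (Fun B B) (?x s) m}"
    then obtain n s where X: "X = subobj_class (Fun B B) n" and s: "s \<in> subobj_class (Fun A A) t"
      and im': "is_image (Fun B B) (?x s) n" by blast
    have st: "AA.prerad s" "\<And>a. a \<in> Obj A \<Longrightarrow> factors_through A (component t a) (component s a)"
      "\<And>a. a \<in> Obj A \<Longrightarrow> factors_through A (component s a) (component t a)"
      using s AA.mem_class_iff[OF t] by auto
    note n = phi_representative[OF st(1) im']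
    \<comment> \<open>Stated for arbitrary \<open>u\<close> and \<open>v\<close> so as to serve in
      both directions between \<open>t\<close> and \<open>s\<close>.\<close>
    have le: "factors_through B (component k b) (component l b)"
      if b: "b \<in> Obj B" and uv: "AA.prerad u" "AA.prerad v"
        "factors_through A (component u (omap G b)) (component v (omap G b))"
        and ik: "is_image (Fun B B) (?x u) k" and il: "is_image (Fun B B) (?x v) l" for b u v k l
    proof (rule phi_representative(3)[OF uv(1) ik b])
      note l = phi_representative[OF uv(2) il]
      show "mono_arr B (component l b)" using BB.pr_mono[OF l(1) b] .
      show "factors_through B (counit_arr u b) (component l b)"
        by (rule B.factors_trans[OF counit_arr_mono[OF uv(2,1) b uv(3)] l(2)[OF b]]) (use l(1) b in simp)
      show "Cod B (component l b) = b" using l(1) b by simp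
    qed
    have "n \<in> subobj_class (Fun B B) m"
      unfolding BB.mem_class_iff[OF m(1)]
      using n(1) le[OF _ t st(1) st(2) im im'] le[OF _ st(1) t st(3) im' im] by simp
    then show "X = subobj_class (Fun B B) m"
      unfolding X by (rule BB.class_eq[OF m(1)])
  qed
  from that[OF m(1) this m(2,3)] show ?thesis by blast
qed

text \<open>Since \<open>t\<^bsub>T a\<^esub>\<close> is split epi for idempotent \<open>\<tau>\<close>, a factorization \<open>v\<close> of \<open>counit_arr t b\<close> through \<open>s\<^sub>b\<close> can be
  rewritten, via naturality of \<open>t\<close> at the transpose of \<open>v\<close>, as one through \<open>counit_arr t\<close> at \<open>S b\<close>.\<close>

lemma counit_arr_factors_product:
  assumes t: "AA.prerad t"
    and split: "\<And>a. a \<in> Obj A \<Longrightarrow>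
      factors_through A (component t a) (component t a \<bullet>\<^bsub>A\<^esub> component t (omap (source t) a))"
    and s: "BB.prerad s" "\<And>b. b \<in> Obj B \<Longrightarrow> factors_through B (counit_arr t b) (component s b)"
    and r: "BB.prerad r" "\<And>b. b \<in> Obj B \<Longrightarrow> factors_through B (counit_arr t b) (component r b)"
    and b: "b \<in> Obj B"
  shows "factors_through B (counit_arr t b) (component s b \<bullet>\<^bsub>B\<^esub> component r (omap (source s) b))"
proof -
  let ?T = "source t" and ?S = "source s"
  let ?g = "omap G b" and ?c = "omap ?S b"
  have ob: "?g \<in> Obj A" "?c \<in> Obj B" "omap G ?c \<in> Obj A" "omap ?T ?g \<in> Obj A" "is_functor A A ?T"
    using b t s(1) by simp_all
  obtain v where v: "v \<in> Arr B" "Dom B v = Dom B (counit_arr t b)" "Cod B v = Dom B (component s b)"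
    "component s b \<bullet>\<^bsub>B\<^esub> v = counit_arr t b"
    using s(2)[OF b] by (rule B.factors_throughE)
  have v': "Dom B v = omap F (omap ?T ?g)" "Cod B v = ?c"
    using v t s(1) b ob by simp_all
  define w where "w = flat (omap ?T ?g) v"
  have w: "w \<in> Arr A" "Dom A w = omap ?T ?g" "Cod A w = omap G ?c"
    using v(1) v' ob by (simp_all add: w_def)
  have vw: "sharp ?c w = v"
    using sharp_flat[OF v(1) v'(1) ob(4)] v' by (simp add: w_def)
  obtain u where u: "u \<in> Arr A" "Dom A u = omap ?T ?g"
    "Cod A u = Dom A (component t ?g \<bullet>\<^bsub>A\<^esub> component t (omap ?T ?g))"
    "(component t ?g \<bullet>\<^bsub>A\<^esub> component t (omap ?T ?g)) \<bullet>\<^bsub>A\<^esub> u = component t ?g"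
    using split[OF ob(1)] t ob by (auto elim: A.factors_throughE)
  have u': "Cod A u = omap ?T (omap ?T ?g)"
    using u(3) t ob by simp
  have "component t ?g \<bullet>\<^bsub>A\<^esub> (component t (omap ?T ?g) \<bullet>\<^bsub>A\<^esub> u) = component t ?g \<bullet>\<^bsub>A\<^esub> Idn A (omap ?T ?g)"
    using u(1,4) u' t ob by (simp add: A.comp_assoc)
  then have id: "component t (omap ?T ?g) \<bullet>\<^bsub>A\<^esub> u = Idn A (omap ?T ?g)"
    by (rule A.mono_cancel[OF AA.pr_mono[OF t ob(1)]]) (use u(1,2) u' t ob in simp_all)
  have "w = w \<bullet>\<^bsub>A\<^esub> (component t (omap ?T ?g) \<bullet>\<^bsub>A\<^esub> u)"
    using w id by simp
  also have "\<dots> = (w \<bullet>\<^bsub>A\<^esub> component t (omap ?T ?g)) \<bullet>\<^bsub>A\<^esub> u"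
    by (rule A.comp_assoc[symmetric]) (use w u(1) u' t ob in simp_all)
  also have "w \<bullet>\<^bsub>A\<^esub> component t (omap ?T ?g) = component t (omap G ?c) \<bullet>\<^bsub>A\<^esub> amap ?T w"
    using AA.pr_natural[OF t w(1)] w by simp
  also have "\<dots> \<bullet>\<^bsub>A\<^esub> u = component t (omap G ?c) \<bullet>\<^bsub>A\<^esub> (amap ?T w \<bullet>\<^bsub>A\<^esub> u)"
    by (rule A.comp_assoc) (use w u(1) u' t ob in simp_all)
  finally have "v = sharp ?c (component t (omap G ?c) \<bullet>\<^bsub>A\<^esub> (amap ?T w \<bullet>\<^bsub>A\<^esub> u))"
    using vw by metis
  also have "\<dots> = counit_arr t ?c \<bullet>\<^bsub>B\<^esub> amap F (amap ?T w \<bullet>\<^bsub>A\<^esub> u)"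
    by (rule sharp_comp) (use w u(1) u' t ob in simp_all)
  finally have vt: "v = counit_arr t ?c \<bullet>\<^bsub>B\<^esub> amap F (amap ?T w \<bullet>\<^bsub>A\<^esub> u)" .
  have "factors_through B v (component r ?c)"
    unfolding vt by (rule B.factors_precomp[OF r(2)[OF ob(2)]]) (use w u(1) u' t ob r(1) in simp_all)
  then have "factors_through B (component s b \<bullet>\<^bsub>B\<^esub> v) (component s b \<bullet>\<^bsub>B\<^esub> component r ?c)"
    by (rule B.factors_postcomp) (use r(1) s(1) b ob in simp_all)
  then show ?thesis unfolding v(4) .
qed

text \<open>By the minimality clause it suffices to factor the counit arrow, instead of
  \<open>m\<close> itself, through each product of representatives.\<close>

theorem phi_idempotent:
  assumes "idempotent_prerad A \<tau>"
  shows "idempotent_prerad B (adj_phi B F G \<epsilon> \<tau>)"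
proof -
  obtain t where t: "AA.prerad t" "\<tau> = subobj_class (Fun A A) t"
    using assms AA.PrE unfolding idempotent_prerad_def by blast
  obtain m where m: "BB.prerad m" "adj_phi B F G \<epsilon> \<tau> = subobj_class (Fun B B) m"
    "\<And>b. b \<in> Obj B \<Longrightarrow> factors_through B (counit_arr t b) (component m b)"
    "\<And>b n. b \<in> Obj B \<Longrightarrow> mono_arr B n \<Longrightarrow> Cod B n = b \<Longrightarrow> factors_through B (counit_arr t b) n \<Longrightarrow>
      factors_through B (component m b) n"
    using phi_class[OF t(1)] unfolding t(2) by metis
  have mem: "BB.prerad s \<and> (\<forall>b\<in>Obj B. factors_through B (counit_arr t b) (component s b))"
    if "s \<in> subobj_class (Fun B B) m" for s
  proof -
    have s: "BB.prerad s" "\<And>b. b \<in> Obj B \<Longrightarrow> factors_through B (component m b) (component s b)"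
      using that BB.mem_class_iff[OF m(1)] by auto
    have "factors_through B (counit_arr t b) (component s b)" if "b \<in> Obj B" for b
      by (rule B.factors_trans[OF m(3)[OF that] s(2)[OF that]]) (use s(1) that in simp)
    with s(1) show ?thesis by blast
  qed
  show ?thesis
    unfolding m(2)
  proof (rule BB.idempotentI[OF m(1)])
    fix r s b assume r: "r \<in> subobj_class (Fun B B) m" and s: "s \<in> subobj_class (Fun B B) m" and b: "b \<in> Obj B"
    have pr: "BB.prerad r" "BB.prerad s" using r s mem by blast+
    let ?n = "component s b \<bullet>\<^bsub>B\<^esub> component r (omap (source s) b)"
    have "mono_arr B ?n"
      by (rule B.mono_comp) (use pr b BB.pr_mono in simp_all)
    moreover have "factors_through B (counit_arr t b) ?n"
      by (rule counit_arr_factors_product[OF t(1)])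
        (use AA.idempotent_split[OF t(1)] assms t(2) mem[OF r] mem[OF s] b in blast)+
    ultimately show "factors_through B (component m b) ?n"
      using m(4)[OF b] pr b by simp
  qed
qed

section \<open>The kernel construction \<open>\<psi>\<close> and radicals\<close>

text \<open>Three equivalences at the codomain of \<open>h\<close>. Lying in the kernel means that
  \<open>c\<close> annihilates \<open>\<eta> \<bullet> h\<close>; since \<open>G s\<close> is monic
  with cokernel \<open>c\<close>, this says that \<open>\<eta> \<bullet> h\<close> factors through
  \<open>G s\<close>; and \<open>\<eta> \<bullet> h\<close> is the transpose of
  \<open>F h\<close>.\<close>

lemma psi_representative:
  assumes s: "BB.prerad s"
    and c: "is_cokernel (Fun A A) (whisk_left A G (whisk_right A s F)) c"
    and k: "is_kernel (Fun A A) (c \<bullet>\<^bsub>Fun A A\<^esub> \<eta>) k"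
  shows "AA.prerad k"
    and "h \<in> Arr A \<Longrightarrow> factors_through A h (component k (Cod A h)) \<longleftrightarrow>
      factors_through B (amap F h) (component s (omap F (Cod A h)))"
proof -
  note cD = AA.Fun.is_cokernelD[OF c] and kD = AA.Fun.is_kernelD[OF k]
  show "AA.prerad k"
    unfolding AA.prerad_def using kD by simp
  have nc: "nat_trans A A c" using cD by simp
  assume h: "h \<in> Arr A"
  define a' where "a' = Cod A h"
  have a: "a' \<in> Obj A" using h by (simp add: a'_def)
  have fa: "omap F a' \<in> Obj B" using a by simp
  note ca = AA.cokernel_Fun_component[OF c a] and ka = AA.kernel_Fun_component[OF k a]
  let ?s = "component s (omap F a')"
  have ca': "is_cokernel A (amap G ?s) (component c a')" using ca a by simp
  have ka': "is_kernel A (component c a' \<bullet>\<^bsub>A\<^esub> component \<eta> a') (component k a')" using ka a by simp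
  note caD = A.is_cokernelD[OF ca'] and kaD = A.is_kernelD[OF ka']
  have sm: "mono_arr B ?s" using BB.pr_mono[OF s fa] .
  have sa: "?s \<in> Arr B" "Cod B ?s = omap F a'" using s fa by simp_all
  have dc: "Dom A (component c a') = omap G (omap F a')" using caD(3) sa by simp
  have e: "component \<eta> a' \<in> Arr A" "Dom A (component \<eta> a') = a'" "Cod A (component \<eta> a') = omap G (omap F a')"
    using a by simp_all
  have ass: "(component c a' \<bullet>\<^bsub>A\<^esub> component \<eta> a') \<bullet>\<^bsub>A\<^esub> h = component c a' \<bullet>\<^bsub>A\<^esub> (component \<eta> a' \<bullet>\<^bsub>A\<^esub> h)"
    by (rule A.comp_assoc) (use h e dc caD a'_def in simp_all)
  have flatF: "component \<eta> a' \<bullet>\<^bsub>A\<^esub> h = flat (Dom A h) (amap F h)"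
    unfolding flat_def a'_def by (rule eta_natural[OF h])
  have "factors_through A h (component k a') \<longleftrightarrow> zero_arr A ((component c a' \<bullet>\<^bsub>A\<^esub> component \<eta> a') \<bullet>\<^bsub>A\<^esub> h)"
  proof
    assume "zero_arr A ((component c a' \<bullet>\<^bsub>A\<^esub> component \<eta> a') \<bullet>\<^bsub>A\<^esub> h)"
    then show "factors_through A h (component k a')"
      by (intro A.is_kernelE[OF ka' h]) (use e dc caD a'_def in simp_all)
  next
    assume "factors_through A h (component k a')"
    then obtain u where u: "u \<in> Arr A" "Cod A u = Dom A (component k a')" "component k a' \<bullet>\<^bsub>A\<^esub> u = h"
      by (rule A.factors_throughE)
    have "zero_arr A (((component c a' \<bullet>\<^bsub>A\<^esub> component \<eta> a') \<bullet>\<^bsub>A\<^esub> component k a') \<bullet>\<^bsub>A\<^esub> u)"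
      by (rule A.zero_comp_right[OF kaD(4)]) (use u(1,2) kaD in simp_all)
    also have "((component c a' \<bullet>\<^bsub>A\<^esub> component \<eta> a') \<bullet>\<^bsub>A\<^esub> component k a') \<bullet>\<^bsub>A\<^esub> u =
        (component c a' \<bullet>\<^bsub>A\<^esub> component \<eta> a') \<bullet>\<^bsub>A\<^esub> (component k a' \<bullet>\<^bsub>A\<^esub> u)"
      by (rule A.comp_assoc) (use u(1,2) kaD in simp_all)
    finally show "zero_arr A ((component c a' \<bullet>\<^bsub>A\<^esub> component \<eta> a') \<bullet>\<^bsub>A\<^esub> h)"
      unfolding u(3) .
  qed
  also have "\<dots> \<longleftrightarrow> factors_through A (component \<eta> a' \<bullet>\<^bsub>A\<^esub> h) (amap G ?s)"
    unfolding ass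
  proof
    assume "zero_arr A (component c a' \<bullet>\<^bsub>A\<^esub> (component \<eta> a' \<bullet>\<^bsub>A\<^esub> h))"
    then show "factors_through A (component \<eta> a' \<bullet>\<^bsub>A\<^esub> h) (amap G ?s)"
      by (intro A.factors_mono_if_cokernel_zero[OF mono_right_adjoint[OF sm] ca'])
        (use h e sa a'_def in simp_all)
  next
    assume "factors_through A (component \<eta> a' \<bullet>\<^bsub>A\<^esub> h) (amap G ?s)"
    then obtain u where u: "u \<in> Arr A" "Cod A u = Dom A (amap G ?s)" "amap G ?s \<bullet>\<^bsub>A\<^esub> u = component \<eta> a' \<bullet>\<^bsub>A\<^esub> h"
      by (rule A.factors_throughE)
    have "zero_arr A ((component c a' \<bullet>\<^bsub>A\<^esub> amap G ?s) \<bullet>\<^bsub>A\<^esub> u)"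
      by (rule A.zero_comp_right[OF caD(4)]) (use u(1,2) caD in simp_all)
    also have "(component c a' \<bullet>\<^bsub>A\<^esub> amap G ?s) \<bullet>\<^bsub>A\<^esub> u = component c a' \<bullet>\<^bsub>A\<^esub> (amap G ?s \<bullet>\<^bsub>A\<^esub> u)"
      by (rule A.comp_assoc) (use u(1,2) caD in simp_all)
    finally show "zero_arr A (component c a' \<bullet>\<^bsub>A\<^esub> (component \<eta> a' \<bullet>\<^bsub>A\<^esub> h))"
      unfolding u(3) .
  qed
  also have "\<dots> \<longleftrightarrow> factors_through B (amap F h) ?s"
  proof
    assume "factors_through A (component \<eta> a' \<bullet>\<^bsub>A\<^esub> h) (amap G ?s)"
    then obtain u where u: "u \<in> Arr A" "Cod A u = Dom A (amap G ?s)" "amap G ?s \<bullet>\<^bsub>A\<^esub> u = flat (Dom A h) (amap F h)"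
      unfolding flatF by (rule A.factors_throughE)
    have "?s \<bullet>\<^bsub>B\<^esub> sharp (Dom B ?s) u = sharp (Cod B ?s) (amap G ?s \<bullet>\<^bsub>A\<^esub> u)"
      by (rule sharp_postcomp[symmetric]) (use u(1,2) sa in simp_all)
    also have "\<dots> = amap F h"
      unfolding u(3) using sharp_flat[of "amap F h" "Dom A h"] h sa(2) by (simp add: a'_def)
    finally show "factors_through B (amap F h) ?s"
      by (rule B.factors_throughI) (use u(1,2) sa in simp_all)
  next
    assume "factors_through B (amap F h) ?s"
    then obtain v where v: "v \<in> Arr B" "Cod B v = Dom B ?s" "Dom B v = Dom B (amap F h)" "?s \<bullet>\<^bsub>B\<^esub> v = amap F h"
      by (rule B.factors_throughE)
    have dv: "Dom B v = omap F (Dom A h)" using v(3) h by simp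
    have "amap G ?s \<bullet>\<^bsub>A\<^esub> flat (Dom A h) v = (amap G ?s \<bullet>\<^bsub>A\<^esub> amap G v) \<bullet>\<^bsub>A\<^esub> component \<eta> (Dom A h)"
      unfolding flat_def by (rule A.comp_assoc[symmetric]) (use v(1,2) dv sa h in simp_all)
    also have "\<dots> = flat (Dom A h) (?s \<bullet>\<^bsub>B\<^esub> v)"
      unfolding flat_def using BA.functor_comp[OF G v(1) sa(1)] v(2) by simp
    also have "\<dots> = component \<eta> a' \<bullet>\<^bsub>A\<^esub> h"
      unfolding v(4) flatF ..
    finally show "factors_through A (component \<eta> a' \<bullet>\<^bsub>A\<^esub> h) (amap G ?s)"
      by (rule A.factors_throughI) (use v(1,2) dv sa h in simp_all)
  qed
  finally show "factors_through A h (component k (Cod A h)) \<longleftrightarrow>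
      factors_through B (amap F h) (component s (omap F (Cod A h)))"
    unfolding a'_def .
qed

text \<open>The criterion depends on \<open>s\<close> only up to equivalence. Applying it to the
  components of two candidate kernels, each tested against the other, identifies their
  classes.\<close>

lemma psi_class:
  assumes s: "BB.prerad s"
  obtains k where "AA.prerad k" "adj_psi A F G \<eta> (subobj_class (Fun B B) s) = subobj_class (Fun A A) k"
    "\<And>h. h \<in> Arr A \<Longrightarrow> factors_through A h (component k (Cod A h)) \<longleftrightarrow>
      factors_through B (amap F h) (component s (omap F (Cod A h)))"
proof -
  let ?w = "\<lambda>s. whisk_left A G (whisk_right A s F)"
  have "nat_trans A B (whisk_right A s F)"
    by (rule nat_trans_whisk_right[OF A.cat_axioms B.cat_axioms F]) (use s in simp)
  then have w: "nat_trans A A (?w s)"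
    by (rule nat_trans_whisk_left[OF A.cat_axioms B.cat_axioms _ G])
  obtain c where c: "is_cokernel (Fun A A) (?w s) c"
    using AA.pointwise_cokernel[OF w] by metis
  have "nat_trans A A (c \<bullet>\<^bsub>Fun A A\<^esub> \<eta>)"
    using AA.Fun.is_cokernelD[OF c] s fcomp_fid[OF F] by (intro AA.nt_comp) simp_all
  then obtain k where k: "is_kernel (Fun A A) (c \<bullet>\<^bsub>Fun A A\<^esub> \<eta>) k"
    using AA.pointwise_kernel by metis
  note kr = psi_representative[OF s c k]
  have "adj_psi A F G \<eta> (subobj_class (Fun B B) s) = subobj_class (Fun A A) k"
    unfolding adj_psi_def
  proof (rule Union_eq_if_all_eq)
    show "{subobj_class (Fun A A) k | k r c. r \<in> subobj_class (Fun B B) s \<and>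
         is_cokernel (Fun A A) (?w r) c \<and> is_kernel (Fun A A) (c \<bullet>\<^bsub>Fun A A\<^esub> \<eta>) k} \<noteq> {}"
      using c k BB.class_self[OF s] by blast
    fix X assume "X \<in> {subobj_class (Fun A A) k | k r c. r \<in> subobj_class (Fun B B) s \<and>
         is_cokernel (Fun A A) (?w r) c \<and> is_kernel (Fun A A) (c \<bullet>\<^bsub>Fun A A\<^esub> \<eta>) k}"
    then obtain l r d where X: "X = subobj_class (Fun A A) l" and r: "r \<in> subobj_class (Fun B B) s"
      and d: "is_cokernel (Fun A A) (?w r) d" and l: "is_kernel (Fun A A) (d \<bullet>\<^bsub>Fun A A\<^esub> \<eta>) l"
      by blast
    have rs: "BB.prerad r" "\<And>b. b \<in> Obj B \<Longrightarrow> factors_through B (component s b) (component r b)"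
      "\<And>b. b \<in> Obj B \<Longrightarrow> factors_through B (component r b) (component s b)"
      using r BB.mem_class_iff[OF s] by auto
    note lr = psi_representative[OF rs(1) d l]
    have kl: "factors_through A (component k a) (component l a)" if a: "a \<in> Obj A" for a
    proof -
      have "factors_through B (amap F (component k a)) (component s (omap F a))"
        using kr(2)[of "component k a"] kr(1) a A.factors_refl by simp
      then have "factors_through B (amap F (component k a)) (component r (omap F a))"
        by (rule B.factors_trans) (use rs a in simp_all)
      then show ?thesis
        using lr(2)[of "component k a"] kr(1) a by simp
    qed
    have lk: "factors_through A (component l a) (component k a)" if a: "a \<in> Obj A" for a
    proof -
      have "factors_through B (amap F (component l a)) (component r (omap F a))"
        using lr(2)[of "component l a"] lr(1) a A.factors_refl by simp
      then have "factors_through B (amap F (component l a)) (component s (omap F a))"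
        by (rule B.factors_trans) (use s rs a in simp_all)
      then show ?thesis
        using kr(2)[of "component l a"] lr(1) a by simp
    qed
    have "l \<in> subobj_class (Fun A A) k"
      unfolding AA.mem_class_iff[OF kr(1)] using lr(1) kl lk by simp
    then show "X = subobj_class (Fun A A) k"
      unfolding X by (rule AA.class_eq[OF kr(1)])
  qed
  from that[OF kr(1) this] kr(2) show ?thesis by blast
qed

text \<open>Let \<open>e\<close> be a cokernel of \<open>l\<close> with value \<open>q\<close> at
  \<open>a\<close>, and \<open>d\<close> a cokernel of \<open>s\<close>. The component of
  \<open>d\<close> at \<open>F a\<close> factors as \<open>w \<bullet> F e\<close>. If
  \<open>e \<bullet> h = r \<bullet> y\<close>, then
  \<open>d \<bullet> F h = w \<bullet> F r \<bullet> F y\<close>; here \<open>F r\<close> factors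
  through \<open>t\<close> at \<open>F q\<close>, and naturality along \<open>w\<close> moves
  \<open>t\<close> to a value of \<open>S\<^sup>*\<close>, where it vanishes. So \<open>F h\<close>
  factors through \<open>s\<close>, and the criterion for \<open>\<psi>\<close> applies to
  \<open>h\<close>.\<close>

theorem psi_radical:
  assumes "radical B \<sigma>"
  shows "radical A (adj_psi A F G \<eta> \<sigma>)"
proof -
  obtain s0 where s0: "BB.prerad s0" "\<sigma> = subobj_class (Fun B B) s0"
    using assms BB.PrE unfolding radical_def by blast
  obtain t s d where ts: "t \<in> subobj_class (Fun B B) s0" "s \<in> subobj_class (Fun B B) s0"
    and d: "is_cokernel (Fun B B) s d" and zt: "\<And>b. b \<in> Obj B \<Longrightarrow> zero_arr B (component t (omap (target d) b))"
    using BB.radical_annihilates_cokernel[OF s0(1)] assms unfolding s0(2) by metis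
  have pr: "BB.prerad t" "BB.prerad s"
    using ts BB.mem_class_iff[OF s0(1)] by auto
  \<comment> \<open>The radical property supplies two representatives: \<open>t\<close>, which
    vanishes on the quotient, and \<open>s\<close>, whose cokernel is that quotient. They are
    equivalent, and this comparison lets factorizations through \<open>s\<close> continue through
    \<open>t\<close>.\<close>
  have st: "factors_through B (component s b) (component t b)" if "b \<in> Obj B" for b
  proof (rule B.factors_trans)
    show "factors_through B (component s b) (component s0 b)" "factors_through B (component s0 b) (component t b)"
      using BB.mem_class_iff[OF s0(1)] ts that by blast+
  qed (use pr(1) that in simp)
  obtain k where k: "AA.prerad k" "adj_psi A F G \<eta> (subobj_class (Fun B B) s) = subobj_class (Fun A A) k"
    "\<And>h. h \<in> Arr A \<Longrightarrow> factors_through A h (component k (Cod A h)) \<longleftrightarrow>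
      factors_through B (amap F h) (component s (omap F (Cod A h)))"
    using psi_class[OF pr(2)] by metis
  have \<sigma>: "\<sigma> = subobj_class (Fun B B) s"
    unfolding s0(2) by (rule BB.class_eq[OF s0(1) ts(2), symmetric])
  have mem: "AA.prerad l \<and> (\<forall>a\<in>Obj A. factors_through B (amap F (component l a)) (component s (omap F a)))"
    if "l \<in> subobj_class (Fun A A) k" for l
  proof -
    have l: "AA.prerad l" "\<And>a. a \<in> Obj A \<Longrightarrow> factors_through A (component l a) (component k a)"
      using that AA.mem_class_iff[OF k(1)] by auto
    have "factors_through B (amap F (component l a)) (component s (omap F a))" if "a \<in> Obj A" for a
      using k(3)[of "component l a"] l that by simp
    with l(1) show ?thesis by blast
  qed
  have dn: "nat_trans B B d" "source d = fid B"
    using BB.Fun.is_cokernelD[OF d] pr by auto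
  have D: "is_functor B B (target d)" using dn by simp
  show ?thesis
    unfolding \<sigma> k(2)
  proof (rule AA.radicalI[OF k(1)])
    fix r l e a h y
    assume r: "r \<in> subobj_class (Fun A A) k" and l: "l \<in> subobj_class (Fun A A) k"
      and e: "is_cokernel (Fun A A) l e" and a: "a \<in> Obj A" and h: "h \<in> Arr A" "Cod A h = a"
      and y: "y \<in> Arr A" "Dom A y = Dom A h" "Cod A y = Dom A (component r (omap (target e) a))"
      and sq: "component e a \<bullet>\<^bsub>A\<^esub> h = component r (omap (target e) a) \<bullet>\<^bsub>A\<^esub> y"
    have prl: "AA.prerad r" "AA.prerad l" using r l mem by blast+
    have en: "nat_trans A A e" "source e = fid A"
      using AA.Fun.is_cokernelD[OF e] prl by auto
    let ?q = "omap (target e) a" and ?f = "omap F a"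
    let ?D = "omap (target d) ?f"
    have q: "?q \<in> Obj A" "?f \<in> Obj B" "?D \<in> Obj B" using en a D by simp_all
    note ea = AA.cokernel_Fun_component[OF e a] and da = BB.cokernel_Fun_component[OF d q(2)]
    have ec: "component e a \<in> Arr A" "Dom A (component e a) = a" "Cod A (component e a) = ?q"
      using en a by simp_all
    have dc: "component d ?f \<in> Arr B" "Dom B (component d ?f) = ?f" "Cod B (component d ?f) = ?D"
      using dn q by simp_all
    have lc: "component l a \<in> Arr A" "Cod A (component l a) = a" using prl a by simp_all
    have sc: "component s ?f \<in> Arr B" "Cod B (component s ?f) = ?f" using pr q by simp_all
    obtain u where u: "u \<in> Arr B" "Cod B u = Dom B (component s ?f)"
      "component s ?f \<bullet>\<^bsub>B\<^esub> u = amap F (component l a)"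
      using mem[OF l] a by (auto elim: B.factors_throughE)
    have "zero_arr B ((component d ?f \<bullet>\<^bsub>B\<^esub> component s ?f) \<bullet>\<^bsub>B\<^esub> u)"
      by (rule B.zero_comp_right[OF B.is_cokernelD(4)[OF da]]) (use u(1,2) sc dc in simp_all)
    also have "(component d ?f \<bullet>\<^bsub>B\<^esub> component s ?f) \<bullet>\<^bsub>B\<^esub> u = component d ?f \<bullet>\<^bsub>B\<^esub> (component s ?f \<bullet>\<^bsub>B\<^esub> u)"
      by (rule B.comp_assoc) (use u(1,2) sc dc in simp_all)
    finally have "zero_arr B (component d ?f \<bullet>\<^bsub>B\<^esub> amap F (component l a))"
      unfolding u(3) .
    then have zG: "zero_arr A (amap G (component d ?f \<bullet>\<^bsub>B\<^esub> amap F (component l a)))"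
      by (rule zero_right_adjoint)
    \<comment> \<open>That \<open>F\<close> sends \<open>e\<close> to a cokernel of
      \<open>F l\<close> is not established separately. The needed factorization of \<open>d\<close>
      through \<open>F e\<close> is found on the side of \<open>A\<close>: the transpose of
      \<open>d\<close> annihilates \<open>l\<close>, descends along \<open>e\<close>, and is
      transposed back.\<close>
    let ?g = "flat a (component d ?f)"
    have g: "?g \<in> Arr A" "Dom A ?g = a" "Cod A ?g = omap G ?D"
      using dc a by simp_all
    have "?g \<bullet>\<^bsub>A\<^esub> component l a = amap G (component d ?f) \<bullet>\<^bsub>A\<^esub> (component \<eta> a \<bullet>\<^bsub>A\<^esub> component l a)"
      unfolding flat_def by (rule A.comp_assoc) (use a lc dc in simp_all)
    also have "component \<eta> a \<bullet>\<^bsub>A\<^esub> component l a =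
        amap G (amap F (component l a)) \<bullet>\<^bsub>A\<^esub> component \<eta> (Dom A (component l a))"
      using eta_natural[OF lc(1)] lc(2) by simp
    also have "amap G (component d ?f) \<bullet>\<^bsub>A\<^esub> \<dots> =
        (amap G (component d ?f) \<bullet>\<^bsub>A\<^esub> amap G (amap F (component l a))) \<bullet>\<^bsub>A\<^esub> component \<eta> (Dom A (component l a))"
      by (rule A.comp_assoc[symmetric]) (use a lc dc in simp_all)
    also have "\<dots> = amap G (component d ?f \<bullet>\<^bsub>B\<^esub> amap F (component l a)) \<bullet>\<^bsub>A\<^esub> component \<eta> (Dom A (component l a))"
      using BA.functor_comp[OF G, of "amap F (component l a)" "component d ?f"] lc dc by simp
    finally have "?g \<bullet>\<^bsub>A\<^esub> component l a =
      amap G (component d ?f \<bullet>\<^bsub>B\<^esub> amap F (component l a)) \<bullet>\<^bsub>A\<^esub> component \<eta> (Dom A (component l a))" .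
    moreover have "zero_arr A \<dots>"
      by (rule A.zero_comp_right[OF zG]) (use a lc dc in simp_all)
    ultimately have "zero_arr A (?g \<bullet>\<^bsub>A\<^esub> component l a)" by simp
    then obtain z where z: "z \<in> Arr A" "Dom A z = ?q" "Cod A z = omap G ?D" "z \<bullet>\<^bsub>A\<^esub> component e a = ?g"
      using A.is_cokernelE[OF ea g(1)] g ec lc by metis
    define w where "w = sharp ?D z"
    have w: "w \<in> Arr B" "Dom B w = omap F ?q" "Cod B w = ?D"
      using z(1-3) q by (simp_all add: w_def)
    have "w \<bullet>\<^bsub>B\<^esub> amap F (component e a) = sharp ?D (z \<bullet>\<^bsub>A\<^esub> component e a)"
      unfolding w_def by (rule sharp_comp[symmetric]) (use z(1-3) ec q in simp_all)
    also have "\<dots> = component d ?f"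
      unfolding z(4) using sharp_flat[OF dc(1,2) a] dc(3) by simp
    finally have we: "w \<bullet>\<^bsub>B\<^esub> amap F (component e a) = component d ?f" .
    have rc: "component r ?q \<in> Arr A" "Cod A (component r ?q) = ?q" using prl q by simp_all
    have tc: "component t (omap F ?q) \<in> Arr B" "Cod B (component t (omap F ?q)) = omap F ?q"
      "Dom B (component t (omap F ?q)) = omap (source t) (omap F ?q)" "is_functor B B (source t)"
      using pr q by simp_all
    have "factors_through B (amap F (component r ?q)) (component t (omap F ?q))"
      by (rule B.factors_trans[OF _ st[OF AB.functor_obj[OF F q(1)]] tc(1)]) (use mem[OF r] q(1) in blast)
    then obtain x where x: "x \<in> Arr B" "Dom B x = Dom B (amap F (component r ?q))"
      "Cod B x = Dom B (component t (omap F ?q))"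
      "component t (omap F ?q) \<bullet>\<^bsub>B\<^esub> x = amap F (component r ?q)"
      by (rule B.factors_throughE)
    have x2: "Dom B x = omap F (Dom A (component r ?q))" using x(2) rc by simp
    have nat: "component t ?D \<bullet>\<^bsub>B\<^esub> amap (source t) w = w \<bullet>\<^bsub>B\<^esub> component t (omap F ?q)"
      using BB.pr_natural[OF pr(1) w(1)] w(2,3) by simp
    \<comment> \<open>The object \<open>?D\<close> is a value of the quotient functor, which is
      where \<open>zt\<close> applies.\<close>
    have "zero_arr B (component t ?D \<bullet>\<^bsub>B\<^esub> amap (source t) w)"
      by (rule B.zero_comp_right[OF zt[OF q(2)]]) (use w q pr tc in simp_all)
    then have "zero_arr B ((w \<bullet>\<^bsub>B\<^esub> component t (omap F ?q)) \<bullet>\<^bsub>B\<^esub> (x \<bullet>\<^bsub>B\<^esub> amap F y))"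
      unfolding nat by (rule B.zero_comp_right) (use w tc(1-3) x(1,3) x2 y rc in simp_all)
    also have "(w \<bullet>\<^bsub>B\<^esub> component t (omap F ?q)) \<bullet>\<^bsub>B\<^esub> (x \<bullet>\<^bsub>B\<^esub> amap F y) =
        w \<bullet>\<^bsub>B\<^esub> ((component t (omap F ?q) \<bullet>\<^bsub>B\<^esub> x) \<bullet>\<^bsub>B\<^esub> amap F y)"
      using w tc(1-3) x(1,3) x2 y rc by (simp add: B.comp_assoc)
    also have "\<dots> = w \<bullet>\<^bsub>B\<^esub> amap F (component r ?q \<bullet>\<^bsub>A\<^esub> y)"
      unfolding x(4) using AB.functor_comp[OF F y(1) rc(1)] y(3) by simp
    also have "\<dots> = w \<bullet>\<^bsub>B\<^esub> (amap F (component e a) \<bullet>\<^bsub>B\<^esub> amap F h)"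
      unfolding sq[symmetric] using AB.functor_comp[OF F h(1) ec(1)] ec h by simp
    also have "\<dots> = (w \<bullet>\<^bsub>B\<^esub> amap F (component e a)) \<bullet>\<^bsub>B\<^esub> amap F h"
      by (rule B.comp_assoc[symmetric]) (use w ec h in simp_all)
    finally have zd: "zero_arr B (component d ?f \<bullet>\<^bsub>B\<^esub> amap F h)"
      unfolding we .
    have "factors_through B (amap F h) (component s ?f)"
      by (rule B.factors_mono_if_cokernel_zero[OF BB.pr_mono[OF pr(2) q(2)] da])
        (use zd h sc in simp_all)
    then show "factors_through A h (component k a)"
      using k(3)[OF h(1)] h(2) by simp
  qed
qed

end

theorem theorem7p16:
  fixes A :: "('a, 'm) cat" and B :: "('b, 'n) cat"
    and F :: "('a, 'm, 'b, 'n) func" and G :: "('b, 'n, 'a, 'm) func"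
    and \<eta> :: "('a, 'm, 'a, 'm) nt" and \<epsilon> :: "('b, 'n, 'b, 'n) nt"
    and \<tau> :: "('a, 'm, 'a, 'm) nt set" and \<sigma> :: "('b, 'n, 'b, 'n) nt set"
  assumes "abelian_cat A" and "abelian_cat B"
    and "locally_small TYPE('u) A" and "locally_small TYPE('u) B"
    and "bicomplete TYPE('u) A" and "bicomplete TYPE('u) B"
    and "adjoint_pair A B F G \<eta> \<epsilon>"
    and "\<tau> \<in> Pr A" and "\<sigma> \<in> Pr B"
  shows "(idempotent_prerad A \<tau> \<longrightarrow> idempotent_prerad B (adj_phi B F G \<epsilon> \<tau>)) \<and>
         (radical B \<sigma> \<longrightarrow> radical A (adj_psi A F G \<eta> \<sigma>))"
proof -
  interpret adjunction A B F G \<eta> \<epsilon>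
    using assms by (intro adjunction.intro adjunction_axioms.intro abelianI)
  show ?thesis
    using phi_idempotent psi_radical by blast
qed

end
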